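(* Let $n\ge 1$ and let $S\subseteq\{1,\dots,n\}$. The subset $T_n^S$ of $T_n^B$, consisting of the triangulations that correspond to the noncrossing partitions of type $BD_n^S$, is a lattice under the partial order induced on it by its inclusion in the $B_n$ Tamari lattice $T_n^B$.
   Context: Consider a convex, centrally symmetric $(2n+2)$-gon with vertices labelled clockwise $1,2,\dots,n+1,\bar 1,\bar 2,\dots,\overline{n+1}$, so that the half-turn exchanges $i$ and $\bar i$. A triangulation is a division of the polygon into triangles by chords (segments joining two non-adjacent vertices) which do not cross in the interior. $T_n^B$ is the set of triangulations fixed under the half-turn. For a chord $C$, $\bar C$ denotes its image under the half-turn. In a triangulation, each chord $C$ is a diagonal of a unique quadrilateral $Q(C)$, the union of the two triangles having $C$ as a side. A chord is pure if it joins two barred or two unbarred vertices; otherwise it is mixed. A pure chord $C$ is red if $Q(C)$ contains another vertex of the same type (barred/unbarred) as the endpoints of $C$ whose label is higher than those of both endpoints of $C$, and green otherwise. A mixed chord $C$ is red if $Q(C)$ contains an unbarred vertex whose label is higher than that of the unbarred endpoint of $C$, or a barred vertex whose label is higher than that of the barred endpoint of $C$; otherwise it is green. The $B_n$ Tamari lattice is the partial order on $T_n^B$ (which is a lattice) whose covering relations are: $U\lessdot V$ iff $V$ is obtained from $U$ by replacing a green chord $C$ of $U$ and its partner $\bar C$ (possibly $C=\bar C$) by the other diagonals of $Q(C)$ and $Q(\bar C)$. $NC_n^B$, the noncrossing partitions of type $B_n$, is the set of partitions of $\{1,\dots,n,\bar 1,\dots,\bar n\}$ which are fixed under interchanging $i\leftrightarrow\bar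 i$ for all $i$ and such that, if $2n$ points on a circle are labelled in cyclic order $1,\dots,n,\bar 1,\dots,\bar n$, the convex hulls of the blocks are pairwise disjoint. $NC_n^S$, the noncrossing partitions of type $BD_n^S$, is the set of those elements of $NC_n^B$ having no block equal to $\{i,\bar i\}$ with $i\in S$. The map $\psi:T_n^B\to NC_n^B$: given a triangulation, erase all green chords and all exterior edges. Move both endpoints of each mixed red chord slightly counterclockwise; move the endpoints of each pure red chord slightly together, so that both its original endpoints lie on the side of the chord which includes the larger part of the polygon (the side containing the vertices of the other type). Erase the vertices $n+1$ and $\overline{n+1}$. The remaining vertices are partitioned by the moved red chords (two vertices are in the same block iff no moved red chord separates them); this partition is the value of $\psi$. The map $\psi$ is a bijection. $T_n^S$ is the set of triangulations $T\in T_n^B$ with $\psi(T)\in NC_n^S$. *)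

theory Defs
  imports "HOL-Analysis.Analysis" "HOL-Algebra.Lattice"
begin

section \<open>Labelled points on a circle\<close>

datatype vertex = Unbarred (label: nat) | Barred (label: nat)

fun bar :: "vertex \<Rightarrow> vertex" where
  "bar (Unbarred i) = Barred i"
| "bar (Barred i) = Unbarred i"

definition same_type :: "vertex \<Rightarrow> vertex \<Rightarrow> bool" where
  "same_type u v \<longleftrightarrow> (is_Unbarred u \<longleftrightarrow> is_Unbarred v)"

text \<open>
  The points \<open>1, \<dots>, m\<close> followed by their barred copies; \<open>pos m\<close> is the place of a point,
  from \<open>1\<close> to \<open>2 * m\<close>, when they are read clockwise in this order.  The polygon of \<open>T\<^sub>n\<^sup>B\<close> uses
  \<open>m = n + 1\<close>; the circle carrying the noncrossing partitions uses \<open>m = n\<close>.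
\<close>

definition vertices :: "nat \<Rightarrow> vertex set" where
  "vertices m = Unbarred ` {1..m} \<union> Barred ` {1..m}"

fun pos :: "nat \<Rightarrow> vertex \<Rightarrow> nat" where
  "pos m (Unbarred i) = i"
| "pos m (Barred i) = m + i"


section \<open>Centrally symmetric triangulations\<close>

text \<open>
  A segment joining two vertices of the convex \<open>2 * m\<close>-gon is the set of its two endpoints.
  As the polygon is convex, the line through \<open>u\<close> and \<open>v\<close> has on one side exactly the vertices
  placed strictly between \<open>u\<close> and \<open>v\<close>, and two segments meet in their relative interiors iff
  the endpoints of the first lie strictly on different sides of the second.
\<close>

definition between :: "nat \<Rightarrow> vertex \<Rightarrow> vertex \<Rightarrow> vertex \<Rightarrow> bool" where
  "between m u v x \<longleftrightarrow>
     pos m u < pos m x \<and> pos m x < pos m v \<or> pos m v < pos m x \<and> pos m x < pos m u"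

definition separates :: "nat \<Rightarrow> vertex set \<Rightarrow> vertex \<Rightarrow> vertex \<Rightarrow> bool" where
  "separates m C x y \<longleftrightarrow>
     (\<exists>u v. C = {u, v} \<and> x \<notin> C \<and> y \<notin> C \<and> between m u v x \<noteq> between m u v y)"

definition crosses :: "nat \<Rightarrow> vertex set \<Rightarrow> vertex set \<Rightarrow> bool" where
  "crosses m C D \<longleftrightarrow> (\<exists>x y. C = {x, y} \<and> separates m D x y)"

definition adjacent :: "nat \<Rightarrow> vertex \<Rightarrow> vertex \<Rightarrow> bool" where
  "adjacent m u v \<longleftrightarrow>
     pos m v = pos m u mod (2 * m) + 1 \<or> pos m u = pos m v mod (2 * m) + 1"

definition chords :: "nat \<Rightarrow> vertex set set" where
  "chords m = {{u, v} | u v. u \<in> vertices m \<and> v \<in> vertices m \<and> u \<noteq> v \<and> \<not> adjacent m u v}"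

text \<open>
  The regions into which noncrossing chords divide the polygon are convex polygons, given here
  by their vertex sets: these are the maximal sets of vertices no two of which are separated by
  one of the chords.
\<close>

definition unseparated :: "nat \<Rightarrow> vertex set set \<Rightarrow> vertex set \<Rightarrow> bool" where
  "unseparated m T R \<longleftrightarrow>
     R \<subseteq> vertices m \<and> (\<forall>C\<in>T. \<forall>x\<in>R. \<forall>y\<in>R. \<not> separates m C x y)"

definition regions :: "nat \<Rightarrow> vertex set set \<Rightarrow> vertex set set" where
  "regions m T = {R. unseparated m T R \<and> (\<forall>R'. unseparated m T R' \<and> R \<subseteq> R' \<longrightarrow> R' = R)}"

definition triangulation :: "nat \<Rightarrow> vertex set set \<Rightarrow> bool" where
  "triangulation m T \<longleftrightarrow>
     T \<subseteq> chords m \<and> (\<forall>C\<in>T. \<forall>D\<in>T. \<not> crosses m C D) \<and> (\<forall>R\<in>regions m T. card R = 3)"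

definition triangulations_B :: "nat \<Rightarrow> vertex set set set" where
  "triangulations_B n = {T. triangulation (n + 1) T \<and> (image bar) ` T = T}"


section \<open>Colours, flips and the Tamari order\<close>

text \<open>The vertex set of the quadrilateral \<open>Q(C)\<close>.\<close>

definition quad :: "nat \<Rightarrow> vertex set set \<Rightarrow> vertex set \<Rightarrow> vertex set" where
  "quad m T C = \<Union>{R \<in> regions m T. C \<subseteq> R}"

definition pure :: "vertex set \<Rightarrow> bool" where
  "pure C \<longleftrightarrow> (\<forall>u\<in>C. \<forall>v\<in>C. same_type u v)"

definition red :: "nat \<Rightarrow> vertex set set \<Rightarrow> vertex set \<Rightarrow> bool" where
  "red m T C \<longleftrightarrow>
     (if pure C then \<exists>w\<in>quad m T C. \<forall>u\<in>C. same_type w u \<and> label u < label w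
      else \<exists>w\<in>quad m T C. \<exists>u\<in>C. same_type w u \<and> label u < label w)"

definition green_flip :: "nat \<Rightarrow> vertex set set \<Rightarrow> vertex set set \<Rightarrow> bool" where
  "green_flip n U V \<longleftrightarrow> U \<in> triangulations_B n \<and> V \<in> triangulations_B n \<and>
     (\<exists>C\<in>U. \<not> red (n + 1) U C \<and>
        V = (U - {C, bar ` C})
              \<union> {quad (n + 1) U C - C, quad (n + 1) U (bar ` C) - bar ` C})"

definition tamari_le :: "nat \<Rightarrow> vertex set set \<Rightarrow> vertex set set \<Rightarrow> bool" where
  "tamari_le n = (green_flip n)\<^sup>*\<^sup>*"


section \<open>Noncrossing partitions\<close>

definition circle_point :: "nat \<Rightarrow> vertex \<Rightarrow> complex" where
  "circle_point n v = cis (2 * pi * real (pos n v) / real (2 * n))"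

definition NC_B :: "nat \<Rightarrow> vertex set set set" where
  "NC_B n = {P. partition_on (vertices n) P \<and> (image bar) ` P = P \<and>
     (\<forall>A\<in>P. \<forall>B\<in>P. A \<noteq> B \<longrightarrow>
        convex hull (circle_point n ` A) \<inter> convex hull (circle_point n ` B) = {})}"

definition NC_S :: "nat \<Rightarrow> nat set \<Rightarrow> vertex set set set" where
  "NC_S n S = {P \<in> NC_B n. \<forall>i\<in>S. {Unbarred i, Barred i} \<notin> P}"


section \<open>From triangulations to noncrossing partitions\<close>

text \<open>
  On the boundary of the polygon in doubled coordinates, the vertex \<open>v\<close> lies at
  \<open>2 * pos m v\<close>, and the odd number before (after) it marks \<open>v\<close> moved slightly counterclockwise
  (clockwise).  For a pure red chord with endpoints \<open>u\<close>, \<open>v\<close> in this order, the smaller part of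
  the polygon is the one strictly between \<open>u\<close> and \<open>v\<close>, so \<open>u\<close> moves clockwise and \<open>v\<close>
  counterclockwise.
\<close>

definition moved_chord :: "nat \<Rightarrow> vertex \<Rightarrow> vertex \<Rightarrow> nat \<times> nat" where
  "moved_chord m u v =
     (if pure {u, v} then (2 * pos m u + 1, 2 * pos m v - 1)
      else (2 * pos m u - 1, 2 * pos m v - 1))"

definition moved_red_chords :: "nat \<Rightarrow> vertex set set \<Rightarrow> (nat \<times> nat) set" where
  "moved_red_chords m T =
     {moved_chord m u v | u v. {u, v} \<in> T \<and> red m T {u, v} \<and> pos m u < pos m v}"

definition moved_separates :: "nat \<Rightarrow> nat \<times> nat \<Rightarrow> vertex \<Rightarrow> vertex \<Rightarrow> bool" where
  "moved_separates m = (\<lambda>(a, b) x y.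
     (2 * pos m x \<in> {a<..<b}) \<noteq> (2 * pos m y \<in> {a<..<b}))"

text \<open>
  Restricting to \<open>vertices n\<close> erases \<open>n + 1\<close> and its barred copy; the positions are still those on
  the \<open>2 * (n + 1)\<close>-gon.
\<close>

definition psi :: "nat \<Rightarrow> vertex set set \<Rightarrow> vertex set set" where
  "psi n T = vertices n // {(x, y). x \<in> vertices n \<and> y \<in> vertices n \<and>
     (\<forall>c\<in>moved_red_chords (n + 1) T. \<not> moved_separates (n + 1) c x y)}"

definition triangulations_S :: "nat \<Rightarrow> nat set \<Rightarrow> vertex set set set" where
  "triangulations_S n S = {T \<in> triangulations_B n. psi n T \<in> NC_S n S}"

end

theory Submission
  imports Defs
begin

text \<open>
  Draw the polygon with the vertices \<open>m, \<dots>, 1\<close> followed by the barred vertices \<open>1, \<dots>, m\<close> from left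
  to right, where \<open>m = n + 1\<close>, and name every triangle of a triangulation by its middle vertex.
  A chord puts the triangles below it before the triangles above it, and the inversions of the last
  linear extension of this order form a set attached to the triangulation.  A green flip enlarges
  this set, the set determines the triangulation, and the sets that occur are described by
  conditions preserved under unions.  Whenever such a set properly contains the set of \<open>T\<close>, some
  green flip of \<open>T\<close> stays inside it; hence the Tamari order is inclusion of inversions, and joins
  are unions.

  The block consisting of \<open>l\<close> and its barred copy occurs iff the diameter joins \<open>l + 1\<close> to its
  copy and its quadrilateral has \<open>l\<close> and its copy as the other vertices.  Going up, this
  quadrilateral persists until its diameter is flipped.  So every excluded triangulation has
  a least admissible one above it, and the admissible triangulations are the fixed points of
  a closure operator on a finite lattice.
\<close>

section \<open>Interleaving of pairs of positions\<close>

definition interleaved :: "nat \<Rightarrow> nat \<Rightarrow> nat \<Rightarrow> nat \<Rightarrow> bool" where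
  "interleaved a b c d \<longleftrightarrow> c \<noteq> a \<and> c \<noteq> b \<and> d \<noteq> a \<and> d \<noteq> b \<and>
     (a < c \<and> c < b \<or> b < c \<and> c < a) \<noteq> (a < d \<and> d < b \<or> b < d \<and> d < a)"

lemma interleaved_commute: "interleaved a b c d \<longleftrightarrow> interleaved c d a b"
  unfolding interleaved_def by linarith

lemma interleaved_swap: "interleaved a b c d \<longleftrightarrow> interleaved b a c d" "interleaved a b c d \<longleftrightarrow> interleaved a b d c"
  unfolding interleaved_def by blast+

lemma interleaved_inside: "a < b \<Longrightarrow> x < y \<Longrightarrow> interleaved a b x y \<longleftrightarrow> a < x \<and> x < b \<and> b < y \<or> x < a \<and> a < y \<and> y < b"
  unfolding interleaved_def by auto

lemma interleaved_cyclic_order: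
  assumes "interleaved a c b d"
  obtains "a < b" "b < c" "c < d" | "b < c" "c < d" "d < a" | "c < d" "d < a" "a < b"
    | "d < a" "a < b" "b < c" | "d < c" "c < b" "b < a" | "c < b" "b < a" "a < d"
    | "b < a" "a < d" "d < c" | "a < d" "d < c" "c < b"
proof -
  have sw: "interleaved c a b d" "interleaved a c d b" "interleaved c a d b"
    using assms interleaved_swap(1)[of a c] interleaved_swap(2)[of a c b d] by simp_all
  have "a \<noteq> c" "b \<noteq> d" using assms by (auto simp: interleaved_def)
  then consider "a < c" "b < d" | "a < c" "d < b" | "c < a" "b < d" | "c < a" "d < b"
    by linarith
  then show thesis
  proof cases
    case 1 with assms that(1,7) show thesis by (auto simp: interleaved_inside)
  next
    case 2 with sw(2) that(8,4) show thesis by (auto simp: interleaved_inside)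
  next
    case 3 with sw(1) that(6,2) show thesis by (auto simp: interleaved_inside)
  next
    case 4 with sw(3) that(3,5) show thesis by (auto simp: interleaved_inside)
  qed
qed

lemma interleaved_quadrilateral_sorted:
  assumes "a < b" "b < c" "c < d" "x < y"
    and "\<not> interleaved a b x y" "\<not> interleaved b c x y" "\<not> interleaved c d x y" "\<not> interleaved a d x y"
  shows "interleaved a c x y \<Longrightarrow> x = b \<and> y = d" "interleaved b d x y \<Longrightarrow> x = a \<and> y = c"
proof -
  have "a < c" "a < d" "b < d" using assms by auto
  note less = assms(1-4) this
  note interleaved_iff = less[THEN interleaved_inside, OF \<open>x < y\<close>]
  note ab = assms(5)[unfolded interleaved_iff] and bc = assms(6)[unfolded interleaved_iff]
    and cd = assms(7)[unfolded interleaved_iff] and ad = assms(8)[unfolded interleaved_iff]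
  {
    assume "interleaved a c x y"
    then consider "a < x" "x < c" "c < y" | "x < a" "a < y" "y < c"
      unfolding interleaved_iff by blast
    then show "x = b \<and> y = d"
    proof cases
      case 1
      have "\<not> x < b" using 1 ab less by linarith
      moreover have "\<not> b < x" using 1 bc less by linarith
      moreover have "\<not> y < d" using 1 cd less by linarith
      moreover have "\<not> d < y" using 1 ad less by linarith
      ultimately show ?thesis by simp
    next
      case 2
      then show ?thesis using ad less by linarith
    qed
  }
  {
    assume "interleaved b d x y"
    then consider "b < x" "x < d" "d < y" | "x < b" "b < y" "y < d"
      unfolding interleaved_iff by blast
    then show "x = a \<and> y = c"
    proof cases
      case 1
      then show ?thesis using ad less by linarith
    next
      case 2
      have "\<not> y < c" using 2 bc less by linarith
      moreover have "\<not> c < y" using 2 cd less by linarith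
      moreover have "\<not> x < a" using 2 ad less by linarith
      moreover have "\<not> a < x" using 2 ab less by linarith
      ultimately show ?thesis by simp
    qed
  }
qed

lemma interleaved_quadrilateral:
  assumes "\<not> interleaved a b x y" "\<not> interleaved b c x y" "\<not> interleaved c d x y" "\<not> interleaved d a x y" "interleaved a c b d" "interleaved b d x y"
  shows "{x, y} = {a, c}"
proof -
  have *: "{x, y} = {a, c}" if xy: "x < y" and "\<not> interleaved a b x y" "\<not> interleaved b c x y" "\<not> interleaved c d x y" "\<not> interleaved d a x y" "interleaved b d x y" for x y
  proof -
    have s: "\<not> interleaved b a x y" "\<not> interleaved c b x y" "\<not> interleaved d c x y" "\<not> interleaved a d x y" "interleaved d b x y"
      using that interleaved_swap(1)[of a b x y] interleaved_swap(1)[of b c x y] interleaved_swap(1)[of c d x y]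
        interleaved_swap(1)[of d a x y] interleaved_swap(1)[of b d x y] by simp_all
    note f = that(2-6) s
    note l1 = interleaved_quadrilateral_sorted(1)[OF _ _ _ xy] and l2 = interleaved_quadrilateral_sorted(2)[OF _ _ _ xy]
    from \<open>interleaved a c b d\<close> show ?thesis
    proof (cases rule: interleaved_cyclic_order)
      case 1 then show ?thesis using l2[of a b c d] f by simp
    next
      case 2 then show ?thesis using l1[of b c d a] f by (simp add: insert_commute)
    next
      case 3 then show ?thesis using l2[of c d a b] f by (simp add: insert_commute)
    next
      case 4 then show ?thesis using l1[of d a b c] f by (simp add: insert_commute)
    next
      case 5 then show ?thesis using l1[of d c b a] f by (simp add: insert_commute)
    next
      case 6 then show ?thesis using l2[of c b a d] f by (simp add: insert_commute)
    next
      case 7 then show ?thesis using l1[of b a d c] f by (simp add: insert_commute)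
    next
      case 8 then show ?thesis using l2[of a d c b] f by (simp add: insert_commute)
    qed
  qed
  have "x \<noteq> y" using assms(6) by (auto simp: interleaved_def)
  then consider "x < y" | "y < x" by linarith
  then show ?thesis
    using *[of x y] *[of y x] assms interleaved_swap(2)[of _ _ x y] by cases (simp_all add: insert_commute)
qed

lemma interleaved_apex_unique:
  assumes "interleaved a c b d" "\<not> interleaved a b c w" "\<not> interleaved c b a w" "\<not> interleaved a d c w" "\<not> interleaved c d a w" "w \<noteq> a" "w \<noteq> c"
  shows "w = b \<or> w = d"
  using \<open>interleaved a c b d\<close>
  by (cases rule: interleaved_cyclic_order) (use assms(2-) in \<open>auto simp: interleaved_def\<close>)

lemma interleaved_four_points:
  assumes "distinct [a, b, c, d]"
  shows "interleaved a b c d \<or> interleaved a c b d \<or> interleaved a d b c"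
proof -
  have ne: "a \<noteq> b" "a \<noteq> c" "a \<noteq> d" "b \<noteq> c" "b \<noteq> d" "c \<noteq> d" using assms by auto
  show ?thesis
    using ne
    by (cases a b rule: linorder_cases; cases a c rule: linorder_cases; cases a d rule: linorder_cases)
      (simp_all add: interleaved_def, (cases b c rule: linorder_cases; cases b d rule: linorder_cases;
        cases c d rule: linorder_cases; simp)+)
qed

definition clockwise :: "nat \<Rightarrow> nat \<Rightarrow> nat \<Rightarrow> nat" where
  "clockwise N u x = (if u \<le> x then x - u else x + N - u)"

lemma clockwise_less:
  assumes "u \<le> N" "a \<in> {1..N}" "b \<in> {1..N}"
  shows "clockwise N u a < clockwise N u b \<longleftrightarrow> (if u \<le> a \<longleftrightarrow> u \<le> b then a < b else u \<le> a)"
  using assms by (auto simp: clockwise_def)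

lemma clockwise_eq_iff:
  assumes "u \<le> N" "a \<in> {1..N}" "b \<in> {1..N}"
  shows "clockwise N u a = clockwise N u b \<longleftrightarrow> a = b"
  using assms by (auto simp: clockwise_def)

lemma interleaved_clockwise:
  assumes "u \<le> N" "{a, b, c, d} \<subseteq> {1..N}"
  shows "interleaved (clockwise N u a) (clockwise N u b) (clockwise N u c) (clockwise N u d) \<longleftrightarrow> interleaved a b c d"
  using assms unfolding interleaved_def
  by (cases "u \<le> a"; cases "u \<le> b"; cases "u \<le> c"; cases "u \<le> d")
    (simp_all add: clockwise_less clockwise_eq_iff, (auto dest!: leI)?)

section \<open>Edges and crossings\<close>

lemma finite_vertices [simp]: "finite (vertices m)"
  by (simp add: vertices_def)

lemma in_vertices [simp]:
  "Unbarred i \<in> vertices m \<longleftrightarrow> 1 \<le> i \<and> i \<le> m"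
  "Barred i \<in> vertices m \<longleftrightarrow> 1 \<le> i \<and> i \<le> m"
  by (auto simp: vertices_def)

lemma vertices_cases:
  assumes "u \<in> vertices m"
  obtains i where "u = Unbarred i" "1 \<le> i" "i \<le> m" | i where "u = Barred i" "1 \<le> i" "i \<le> m"
  using assms by (auto simp: vertices_def)

lemma pos_range: "u \<in> vertices m \<Longrightarrow> pos m u \<in> {1..2 * m}"
  by (auto simp: vertices_def)

lemma pos_eq_iff: "u \<in> vertices m \<Longrightarrow> v \<in> vertices m \<Longrightarrow> pos m u = pos m v \<longleftrightarrow> u = v"
  by (auto simp: vertices_def)

lemma pos_surj: "p \<in> {1..2 * m} \<Longrightarrow> \<exists>u\<in>vertices m. pos m u = p"
proof (cases "p \<le> m")
  case True
  moreover assume "p \<in> {1..2 * m}"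
  ultimately show ?thesis by (intro bexI[of _ "Unbarred p"]) auto
next
  case False
  moreover assume "p \<in> {1..2 * m}"
  ultimately show ?thesis by (intro bexI[of _ "Barred (p - m)"]) auto
qed

definition crossing :: "nat \<Rightarrow> vertex \<Rightarrow> vertex \<Rightarrow> vertex \<Rightarrow> vertex \<Rightarrow> bool" where
  "crossing m u v x y \<longleftrightarrow> interleaved (pos m u) (pos m v) (pos m x) (pos m y)"

lemma crossing_commute: "crossing m u v x y \<longleftrightarrow> crossing m x y u v"
  unfolding crossing_def by (rule interleaved_commute)

lemma crossing_swap:
  "crossing m u v x y \<longleftrightarrow> crossing m v u x y"
  "crossing m u v x y \<longleftrightarrow> crossing m u v y x"
  unfolding crossing_def by (fact interleaved_swap)+

lemma not_crossing_shared [simp]: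
  "\<not> crossing m u v u y" "\<not> crossing m u v v y" "\<not> crossing m u v x u" "\<not> crossing m u v x v"
  "\<not> crossing m u v x x" "\<not> crossing m u u x y"
  by (auto simp: crossing_def interleaved_def)

lemma separates_iff_crossing:
  assumes "{u, v, x, y} \<subseteq> vertices m"
  shows "separates m {u, v} x y \<longleftrightarrow> crossing m u v x y"
proof -
  have "separates m {u, v} x y \<longleftrightarrow> x \<notin> {u, v} \<and> y \<notin> {u, v} \<and> between m u v x \<noteq> between m u v y"
    unfolding separates_def by (auto simp: doubleton_eq_iff between_def)
  also have "\<dots> \<longleftrightarrow> crossing m u v x y"
    using assms pos_eq_iff[of _ m] unfolding crossing_def interleaved_def between_def by auto
  finally show ?thesis .
qed

lemma crosses_iff_crossing:
  assumes "{u, v, x, y} \<subseteq> vertices m"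
  shows "crosses m {u, v} {x, y} \<longleftrightarrow> crossing m u v x y"
proof -
  have "crosses m {u, v} {x, y} \<longleftrightarrow> separates m {x, y} u v \<or> separates m {x, y} v u"
    unfolding crosses_def by (auto simp: doubleton_eq_iff)
  also have "\<dots> \<longleftrightarrow> crossing m u v x y"
    using assms separates_iff_crossing[of x y u v m] separates_iff_crossing[of x y v u m]
      crossing_commute[of m u v x y] crossing_swap(2)[of m x y u v]
    by (simp add: insert_commute)
  finally show ?thesis .
qed

lemma adjacent_commute: "adjacent m u v \<longleftrightarrow> adjacent m v u"
  by (auto simp: adjacent_def)

lemma not_crossing_adjacent:
  assumes "adjacent m u v" "{u, v, x, y} \<subseteq> vertices m"
  shows "\<not> crossing m u v x y"
proof -
  have *: "\<not> interleaved a b c d" if "b = a mod (2 * m) + 1" "{a, b, c, d} \<subseteq> {1..2 * m}" for a b c d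
  proof (cases "a = 2 * m")
    case True
    with that show ?thesis by (auto simp: interleaved_def)
  next
    case False
    with that have "b = a + 1" by simp
    then show ?thesis by (auto simp: interleaved_def)
  qed
  have r: "{pos m u, pos m v, pos m x, pos m y} \<subseteq> {1..2 * m}"
    using assms(2) pos_range by blast
  from assms(1) consider "pos m v = pos m u mod (2 * m) + 1" | "pos m u = pos m v mod (2 * m) + 1"
    by (auto simp: adjacent_def)
  then show ?thesis
  proof cases
    case 1
    from *[OF this r] show ?thesis by (simp add: crossing_def)
  next
    case 2
    from *[OF 2, of "pos m x" "pos m y"] r show ?thesis
      using interleaved_swap(1) by (simp add: crossing_def insert_commute)
  qed
qed

lemma doubleton_in_chords:
  "{u, v} \<in> chords m \<longleftrightarrow> u \<in> vertices m \<and> v \<in> vertices m \<and> u \<noteq> v \<and> \<not> adjacent m u v"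
  unfolding chords_def by (auto simp: doubleton_eq_iff adjacent_commute)

definition edge :: "nat \<Rightarrow> vertex set set \<Rightarrow> vertex \<Rightarrow> vertex \<Rightarrow> bool" where
  "edge m T u v \<longleftrightarrow> u \<in> vertices m \<and> v \<in> vertices m \<and> u \<noteq> v \<and> ({u, v} \<in> T \<or> adjacent m u v)"

lemma edge_commute: "edge m T u v \<longleftrightarrow> edge m T v u"
  by (auto simp: edge_def insert_commute adjacent_commute)

lemma chord_edge: "T \<subseteq> chords m \<Longrightarrow> {u, v} \<in> T \<Longrightarrow> edge m T u v"
  using doubleton_in_chords by (auto simp: edge_def)

definition noncrossing :: "nat \<Rightarrow> vertex set set \<Rightarrow> bool" where
  "noncrossing m T \<longleftrightarrow> T \<subseteq> chords m \<and>
     (\<forall>u v x y. edge m T u v \<longrightarrow> edge m T x y \<longrightarrow> \<not> crossing m u v x y)"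

definition uncrossed :: "nat \<Rightarrow> vertex set set \<Rightarrow> vertex \<Rightarrow> vertex \<Rightarrow> bool" where
  "uncrossed m T u v \<longleftrightarrow> (\<forall>x y. edge m T x y \<longrightarrow> \<not> crossing m x y u v)"

lemma uncrossed_commute: "uncrossed m T u v \<longleftrightarrow> uncrossed m T v u"
  unfolding uncrossed_def by (subst crossing_swap(2)) (rule refl)

lemma uncrossed_edge: "noncrossing m T \<Longrightarrow> edge m T u v \<Longrightarrow> uncrossed m T u v"
  by (auto simp: noncrossing_def uncrossed_def)

definition maximal_noncrossing :: "nat \<Rightarrow> vertex set set \<Rightarrow> bool" where
  "maximal_noncrossing m T \<longleftrightarrow> noncrossing m T \<and>
     (\<forall>u\<in>vertices m. \<forall>v\<in>vertices m. u \<noteq> v \<longrightarrow> uncrossed m T u v \<longrightarrow> edge m T u v)"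

lemma noncrossing_iff:
  assumes "T \<subseteq> chords m"
  shows "noncrossing m T \<longleftrightarrow> (\<forall>C\<in>T. \<forall>D\<in>T. \<not> crosses m C D)"
proof
  assume nc: "noncrossing m T"
  show "\<forall>C\<in>T. \<forall>D\<in>T. \<not> crosses m C D"
  proof (intro ballI)
    fix C D
    assume CD: "C \<in> T" "D \<in> T"
    then have "C \<in> chords m" "D \<in> chords m" using assms by auto
    then obtain u v x y where eq: "C = {u, v}" "D = {x, y}"
      by (auto simp: chords_def)
    have e: "edge m T u v" "edge m T x y" using CD chord_edge[OF assms] eq by auto
    then have "{u, v, x, y} \<subseteq> vertices m" by (auto simp: edge_def)
    moreover have "\<not> crossing m u v x y" using nc e unfolding noncrossing_def by blast
    ultimately show "\<not> crosses m C D"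
      using eq crosses_iff_crossing by simp
  qed
next
  assume *: "\<forall>C\<in>T. \<forall>D\<in>T. \<not> crosses m C D"
  have "\<not> crossing m u v x y" if e: "edge m T u v" "edge m T x y" for u v x y
  proof -
    have V: "{u, v, x, y} \<subseteq> vertices m" using e by (auto simp: edge_def)
    from e consider "adjacent m u v" | "adjacent m x y" | "{u, v} \<in> T" "{x, y} \<in> T"
      by (auto simp: edge_def)
    then show ?thesis
    proof cases
      case 1 then show ?thesis using not_crossing_adjacent V by blast
    next
      case 2
      moreover have "{x, y, u, v} \<subseteq> vertices m" using V by blast
      ultimately show ?thesis using not_crossing_adjacent crossing_commute[of m u v x y] by simp
    next
      case 3 then show ?thesis using * crosses_iff_crossing[OF V] by blast
    qed
  qed
  with assms show "noncrossing m T" by (simp add: noncrossing_def)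
qed

lemma unseparated_iff:
  assumes "T \<subseteq> chords m"
  shows "unseparated m T R \<longleftrightarrow> R \<subseteq> vertices m \<and> (\<forall>x\<in>R. \<forall>y\<in>R. uncrossed m T x y)"
proof (cases "R \<subseteq> vertices m")
  case R: True
  have "(\<forall>C\<in>T. \<not> separates m C x y) \<longleftrightarrow> uncrossed m T x y" if "x \<in> R" "y \<in> R" for x y
  proof
    assume *: "\<forall>C\<in>T. \<not> separates m C x y"
    show "uncrossed m T x y"
      unfolding uncrossed_def
    proof (intro allI impI)
      fix u v
      assume e: "edge m T u v"
      then have V: "{u, v, x, y} \<subseteq> vertices m" using that R by (auto simp: edge_def)
      from e show "\<not> crossing m u v x y"
        using * not_crossing_adjacent[OF _ V] separates_iff_crossing[OF V] by (auto simp: edge_def)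
    qed
  next
    assume *: "uncrossed m T x y"
    show "\<forall>C\<in>T. \<not> separates m C x y"
    proof
      fix C
      assume C: "C \<in> T"
      then have "C \<in> chords m" using assms by auto
      then obtain u v where uv: "C = {u, v}" by (auto simp: chords_def)
      then have "edge m T u v" using chord_edge assms C by blast
      moreover from this have "{u, v, x, y} \<subseteq> vertices m" using that R by (auto simp: edge_def)
      ultimately show "\<not> separates m C x y"
        using * uv by (auto simp: separates_iff_crossing uncrossed_def)
    qed
  qed
  with R show ?thesis unfolding unseparated_def by blast
qed (simp add: unseparated_def)

definition clockwise_dist :: "nat \<Rightarrow> vertex \<Rightarrow> vertex \<Rightarrow> nat" where
  "clockwise_dist m u v = clockwise (2 * m) (pos m u) (pos m v)"

lemma crossing_clockwise_dist:
  assumes "{u, a, b, c, d} \<subseteq> vertices m"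
  shows "crossing m a b c d \<longleftrightarrow> interleaved (clockwise_dist m u a) (clockwise_dist m u b) (clockwise_dist m u c) (clockwise_dist m u d)"
  unfolding crossing_def clockwise_dist_def using assms pos_range[of _ m]
  by (subst interleaved_clockwise) auto

lemma clockwise_dist_eq_0: "u \<in> vertices m \<Longrightarrow> v \<in> vertices m \<Longrightarrow> clockwise_dist m u v = 0 \<longleftrightarrow> u = v"
  using pos_range[of u m] pos_range[of v m] pos_eq_iff[of u m v]
  by (auto simp: clockwise_dist_def clockwise_def)

lemma clockwise_dist_add: "u \<in> vertices m \<Longrightarrow> v \<in> vertices m \<Longrightarrow> u \<noteq> v \<Longrightarrow> clockwise_dist m u v + clockwise_dist m v u = 2 * m"
  using pos_range[of u m] pos_range[of v m] pos_eq_iff[of u m v]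
  by (auto simp: clockwise_dist_def clockwise_def)

lemma clockwise_dist_adjacent:
  assumes "u \<in> vertices m" "v \<in> vertices m" "2 \<le> m" "clockwise_dist m u v = 1"
  shows "adjacent m u v"
proof -
  have "pos m v = pos m u mod (2 * m) + 1"
  proof (cases "pos m u = 2 * m")
    case True
    with assms pos_range[of v m] show ?thesis by (auto simp: clockwise_dist_def clockwise_def split: if_splits)
  next
    case False
    with assms(1) pos_range[of u m] have "pos m u < 2 * m" by auto
    moreover have "pos m v = pos m u + 1"
      using False assms pos_range[of v m] pos_range[of u m]
      by (auto simp: clockwise_dist_def clockwise_def split: if_splits)
    ultimately show ?thesis by simp
  qed
  then show ?thesis by (simp add: adjacent_def)
qed

lemma next_vertex:
  assumes "u \<in> vertices m" "2 \<le> m"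
  obtains s where "s \<in> vertices m" "s \<noteq> u" "adjacent m u s" "clockwise_dist m u s = 1"
proof -
  have "pos m u \<in> {1..2 * m}" using assms pos_range by blast
  have "pos m u mod (2 * m) + 1 \<in> {1..2 * m}" using assms by (auto simp: Suc_le_eq)
  then obtain s where s: "s \<in> vertices m" "pos m s = pos m u mod (2 * m) + 1"
    using pos_surj by metis
  have "clockwise_dist m u s = 1"
  proof (cases "pos m u = 2 * m")
    case True
    then show ?thesis using s assms by (simp add: clockwise_dist_def clockwise_def)
  next
    case False
    then show ?thesis using s \<open>pos m u \<in> _\<close> by (simp add: clockwise_dist_def clockwise_def)
  qed
  then have "s \<noteq> u" using clockwise_dist_eq_0[of u m u] assms by auto
  with s \<open>clockwise_dist m u s = 1\<close> that show thesis by (simp add: adjacent_def)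
qed

lemma uncrossed_apex:
  assumes nc: "noncrossing m T" and m: "2 \<le> m" and uv: "u \<in> vertices m" "v \<in> vertices m"
    and un: "uncrossed m T u v" and far: "1 < clockwise_dist m u v"
  obtains w where "w \<in> vertices m" "0 < clockwise_dist m u w" "clockwise_dist m u w < clockwise_dist m u v"
    "edge m T u w" "uncrossed m T v w"
proof -
  define A where "A = {w \<in> vertices m. edge m T u w \<and> 0 < clockwise_dist m u w \<and> clockwise_dist m u w < clockwise_dist m u v}"
  have "finite A" by (simp add: A_def)
  obtain s where "s \<in> vertices m" "s \<noteq> u" "adjacent m u s" "clockwise_dist m u s = 1"
    using next_vertex[OF uv(1) m] .
  then have "s \<in> A" using far uv(1) by (auto simp: A_def edge_def)
  then obtain w where "w \<in> A" and max: "\<And>z. z \<in> A \<Longrightarrow> clockwise_dist m u z \<le> clockwise_dist m u w"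
    using Max_in[of "clockwise_dist m u ` A"] Max_ge[of "clockwise_dist m u ` A"] \<open>finite A\<close>
    by (smt (verit) empty_iff finite_imageI image_iff image_is_empty)
  then have w: "w \<in> vertices m" "edge m T u w" "0 < clockwise_dist m u w" "clockwise_dist m u w < clockwise_dist m u v"
    by (auto simp: A_def)
  have "uncrossed m T v w"
    unfolding uncrossed_def
  proof (intro allI impI notI)
    have key: False if e: "edge m T x y" and c: "crossing m x y v w" and less: "clockwise_dist m u x < clockwise_dist m u y" for x y
    proof -
      have V: "{u, v, w, x, y} \<subseteq> vertices m" using uv w e by (auto simp: edge_def)
      have 0: "clockwise_dist m u u = 0" using uv by (simp add: clockwise_dist_eq_0)
      have cVW: "interleaved (clockwise_dist m u x) (clockwise_dist m u y) (clockwise_dist m u w) (clockwise_dist m u v)"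
        using c crossing_clockwise_dist[of u x y v w m] V interleaved_swap(2) by auto
      have n1: "\<not> interleaved (clockwise_dist m u x) (clockwise_dist m u y) 0 (clockwise_dist m u v)"
        using un e crossing_clockwise_dist[of u x y u v m] V 0 by (auto simp: uncrossed_def)
      have n2: "\<not> interleaved (clockwise_dist m u x) (clockwise_dist m u y) 0 (clockwise_dist m u w)"
        using uncrossed_edge[OF nc w(2)] e crossing_clockwise_dist[of u x y u w m] V 0
        by (auto simp: uncrossed_def)
      consider "clockwise_dist m u x < clockwise_dist m u w" "clockwise_dist m u w < clockwise_dist m u y" "clockwise_dist m u y < clockwise_dist m u v"
        | "clockwise_dist m u w < clockwise_dist m u x" "clockwise_dist m u x < clockwise_dist m u v" "clockwise_dist m u v < clockwise_dist m u y"
        using cVW unfolding interleaved_inside[OF less w(4)] by blast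
      then show False
      proof cases
        case 1
        then have "clockwise_dist m u x = 0" using n2 by (auto simp: interleaved_def)
        then have "x = u" using V by (simp add: clockwise_dist_eq_0)
        then have "y \<in> A" using e 1 V by (auto simp: A_def)
        then show False using max 1 by fastforce
      next
        case 2
        then show False using n1 by (auto simp: interleaved_def)
      qed
    qed
    fix x y
    assume e: "edge m T x y" and c: "crossing m x y v w"
    have "pos m x \<noteq> pos m y" using e pos_eq_iff by (auto simp: edge_def)
    then have "clockwise_dist m u x \<noteq> clockwise_dist m u y"
      using clockwise_eq_iff[of "pos m u" "2*m" "pos m x" "pos m y"] pos_range e uv
      by (auto simp: clockwise_dist_def edge_def)
    then consider "clockwise_dist m u x < clockwise_dist m u y" | "clockwise_dist m u y < clockwise_dist m u x" by linarith
    then show False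
      using key[OF e c] key[of y x] e c edge_commute[of m T x y] crossing_swap(1)[of m x y] by cases simp_all
  qed
  with w that show thesis by blast
qed

section \<open>Triangulations as maximal noncrossing sets\<close>

lemma clockwise_dist_beyond:
  assumes "u \<in> vertices m" "v \<in> vertices m" "w \<in> vertices m" "u \<noteq> v"
    and "0 < clockwise_dist m v w" "clockwise_dist m v w < clockwise_dist m v u"
  shows "clockwise_dist m u v < clockwise_dist m u w"
  using assms pos_range[of u m] pos_range[of v m] pos_range[of w m] pos_eq_iff[of u m v]
  by (auto simp: clockwise_dist_def clockwise_def split: if_splits)

lemma crossing_opposite_sides:
  assumes V: "{u, v, w, z} \<subseteq> vertices m"
    and w: "0 < clockwise_dist m u w" "clockwise_dist m u w < clockwise_dist m u v"
    and z: "0 < clockwise_dist m v z" "clockwise_dist m v z < clockwise_dist m v u"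
  shows "crossing m u v w z"
proof -
  have "u \<noteq> v" using w clockwise_dist_eq_0[of u m u] V by auto
  then have "clockwise_dist m u v < clockwise_dist m u z" using clockwise_dist_beyond[of u m v z] V z by auto
  moreover have "clockwise_dist m u u = 0" using V by (simp add: clockwise_dist_eq_0)
  ultimately show ?thesis
    using w V by (subst crossing_clockwise_dist[of u]) (auto simp: interleaved_def)
qed

lemma region_extends:
  assumes "unseparated m T R"
  obtains R' where "R' \<in> regions m T" "R \<subseteq> R'"
proof -
  have "{R. unseparated m T R} \<subseteq> Pow (vertices m)" by (auto simp: unseparated_def)
  then have "finite {R. unseparated m T R}" by (rule finite_subset) simp
  then obtain R' where "R' \<in> {R. unseparated m T R}" "R \<subseteq> R'"
    "\<forall>b\<in>{R. unseparated m T R}. R' \<subseteq> b \<longrightarrow> R' = b"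
    using finite_has_maximal2[of "{R. unseparated m T R}" R] assms by auto
  then show thesis using that[of R'] by (auto simp: regions_def)
qed

lemma uncrossedD:
  assumes "uncrossed m T u v" "edge m T x y"
  shows "\<not> crossing m u v x y" "\<not> crossing m v u x y"
  using assms crossing_commute[of m u v x y] crossing_swap(1)[of m u v x y]
  by (simp_all add: uncrossed_def)

lemma maximal_subset_chords: "maximal_noncrossing m T \<Longrightarrow> T \<subseteq> chords m"
  by (simp add: maximal_noncrossing_def noncrossing_def)

lemma maximal_edge:
  "maximal_noncrossing m T \<Longrightarrow> u \<in> vertices m \<Longrightarrow> v \<in> vertices m \<Longrightarrow> u \<noteq> v \<Longrightarrow>
    uncrossed m T u v \<Longrightarrow> edge m T u v"
  by (simp add: maximal_noncrossing_def)

lemma triangulation_maximal: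
  assumes m: "2 \<le> m" and T: "triangulation m T"
  shows "maximal_noncrossing m T"
proof -
  have sub: "T \<subseteq> chords m" and nc: "noncrossing m T"
    using T noncrossing_iff[of T m] by (auto simp: triangulation_def)
  have "edge m T u v" if uv: "u \<in> vertices m" "v \<in> vertices m" "u \<noteq> v" and un: "uncrossed m T u v" for u v
  proof (rule ccontr)
    assume ne: "\<not> edge m T u v"
    then have nadj: "\<not> adjacent m u v" and nT: "{u, v} \<notin> T"
      using uv by (auto simp: edge_def)
    have "clockwise_dist m u v \<noteq> 0" "clockwise_dist m v u \<noteq> 0" using uv by (auto simp: clockwise_dist_eq_0)
    moreover have "clockwise_dist m u v \<noteq> 1" "clockwise_dist m v u \<noteq> 1"
      using nadj uv m clockwise_dist_adjacent adjacent_commute by blast+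
    ultimately have far: "1 < clockwise_dist m u v" "1 < clockwise_dist m v u" by linarith+
    have un': "uncrossed m T v u" using un uncrossed_commute by simp
    obtain w where w: "w \<in> vertices m" "0 < clockwise_dist m u w" "clockwise_dist m u w < clockwise_dist m u v"
      "edge m T u w" "uncrossed m T v w"
      by (rule uncrossed_apex[OF nc m uv(1,2) un far(1)])
    obtain z where z: "z \<in> vertices m" "0 < clockwise_dist m v z" "clockwise_dist m v z < clockwise_dist m v u"
      "edge m T v z" "uncrossed m T u z"
      by (rule uncrossed_apex[OF nc m uv(2,1) un' far(2)])
    have c: "crossing m u v w z"
      using crossing_opposite_sides[of u v w z m] uv w z by simp
    have un2: "uncrossed m T u w" "uncrossed m T v z"
      using uncrossed_edge nc w z by blast+
    have wz: "uncrossed m T w z"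
      unfolding uncrossed_def
    proof (intro allI impI notI)
      fix x y
      assume e: "edge m T x y" and cx: "crossing m x y w z"
      have cx': "crossing m w z x y" using cx crossing_commute by simp
      have n: "\<not> crossing m u w x y" "\<not> crossing m w v x y" "\<not> crossing m v z x y" "\<not> crossing m z u x y"
        by (rule uncrossedD[OF _ e], fact)+
      have "{pos m x, pos m y} = {pos m u, pos m v}"
        using interleaved_quadrilateral[of "pos m u" "pos m w" "pos m x" "pos m y" "pos m v" "pos m z"] n c cx'
        by (simp add: crossing_def)
      then have "{x, y} = {u, v}"
        using e uv pos_eq_iff[of _ m] by (auto simp: edge_def doubleton_eq_iff)
      then show False using ne e edge_commute by (auto simp: doubleton_eq_iff)
    qed
    have "uncrossed m T x x" for x by (simp add: uncrossed_def)
    then have "unseparated m T {u, v, w, z}"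
      using un un2 w z wz uv uncrossed_commute[of m T]
      by (auto simp: unseparated_iff[OF sub])
    then obtain R where R: "R \<in> regions m T" "{u, v, w, z} \<subseteq> R" by (rule region_extends)
    have "card {u, v, w, z} = 4"
    proof -
      have "w \<noteq> z" "w \<noteq> u" "w \<noteq> v" "z \<noteq> u" "z \<noteq> v" using c by auto
      then show ?thesis using uv by (simp add: card_insert_if)
    qed
    moreover have "finite R" using R finite_subset[OF _ finite_vertices[of m]]
      by (auto simp: regions_def unseparated_def)
    ultimately have "4 \<le> card R" using R(2) card_mono by metis
    moreover have "card R = 3" using R T by (auto simp: triangulation_def)
    ultimately show False by simp
  qed
  with nc show ?thesis by (auto simp: maximal_noncrossing_def)
qed

lemma maximal_apex:
  assumes M: "maximal_noncrossing m T" and m: "2 \<le> m" and e: "edge m T u v" and far: "1 < clockwise_dist m u v"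
  obtains w where "edge m T u w" "edge m T v w" "0 < clockwise_dist m u w" "clockwise_dist m u w < clockwise_dist m u v"
proof -
  have nc: "noncrossing m T" using M by (simp add: maximal_noncrossing_def)
  have uv: "u \<in> vertices m" "v \<in> vertices m" using e by (auto simp: edge_def)
  obtain w where w: "w \<in> vertices m" "0 < clockwise_dist m u w" "clockwise_dist m u w < clockwise_dist m u v"
      "edge m T u w" "uncrossed m T v w"
    by (rule uncrossed_apex[OF nc m uv uncrossed_edge[OF nc e] far])
  moreover have "v \<noteq> w" using w by auto
  ultimately show thesis using maximal_edge[OF M] uv that by blast
qed

lemma maximal_no_four:
  assumes nc: "noncrossing m T"
    and V: "{a, b, c, d} \<subseteq> vertices m" "distinct [a, b, c, d]"
    and e: "edge m T a b" "edge m T c d" "edge m T a c" "edge m T b d" "edge m T a d" "edge m T b c"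
  shows False
proof -
  have "distinct [pos m a, pos m b, pos m c, pos m d]" using V by (simp add: pos_eq_iff)
  from interleaved_four_points[OF this] show False
    using nc e unfolding noncrossing_def crossing_def by blast
qed

lemma unseparated_edge:
  assumes "maximal_noncrossing m T" "unseparated m T R" "x \<in> R" "y \<in> R" "x \<noteq> y"
  shows "edge m T x y"
proof -
  have "R \<subseteq> vertices m \<and> (\<forall>x\<in>R. \<forall>y\<in>R. uncrossed m T x y)"
    using assms(2) unseparated_iff[OF maximal_subset_chords[OF assms(1)]] by simp
  then show ?thesis using maximal_edge[OF assms(1), of x y] assms(3-5) by blast
qed

lemma card_less_3_cases:
  assumes "finite R" "card R < 3"
  obtains "R = {}" | u where "R = {u}" | u v where "R = {u, v}" "u \<noteq> v"
proof -
  consider "card R = 0" | "card R = 1" | "card R = 2" using assms by linarith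
  then show thesis using assms that by cases (auto simp: card_1_singleton_iff card_2_iff)
qed

lemma maximal_triangulation:
  assumes m: "2 \<le> m" and M: "maximal_noncrossing m T"
  shows "triangulation m T"
proof -
  have nc: "noncrossing m T" and sub: "T \<subseteq> chords m"
    using M by (auto simp: maximal_noncrossing_def noncrossing_def)
  have "card R = 3" if "R \<in> regions m T" for R
  proof -
    have un: "unseparated m T R" and max: "\<And>R'. unseparated m T R' \<Longrightarrow> R \<subseteq> R' \<Longrightarrow> R' = R"
      using that by (auto simp: regions_def)
    have RV: "R \<subseteq> vertices m" using un by (simp add: unseparated_def)
    then have fin: "finite R" by (rule finite_subset) simp
    have "\<not> 4 \<le> card R"
    proof
      assume "4 \<le> card R"
      then obtain S where S: "S \<subseteq> R" "card S = 4" by (meson obtain_subset_with_card_n)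
      then obtain a b c d where "S = {a, b, c, d}" "distinct [a, b, c, d]"
        by (auto simp: card_Suc_eq numeral_eq_Suc)
      with S RV show False
        using maximal_no_four[OF nc, of a b c d] unseparated_edge[OF M un] by auto
    qed
    moreover have "\<not> card R < 3"
    proof
      have unR: "R' \<subseteq> R" if "\<And>x y. x \<in> R' \<Longrightarrow> y \<in> R' \<Longrightarrow> x \<noteq> y \<Longrightarrow> edge m T x y" "R' \<subseteq> vertices m" "R \<subseteq> R'" for R'
      proof -
        have "uncrossed m T x y" if "x \<in> R'" "y \<in> R'" for x y
          using that \<open>\<And>x y. x \<in> R' \<Longrightarrow> y \<in> R' \<Longrightarrow> x \<noteq> y \<Longrightarrow> edge m T x y\<close> uncrossed_edge[OF nc]
          by (cases "x = y") (auto simp: uncrossed_def)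
        then have "unseparated m T R'" using that by (simp add: unseparated_iff[OF sub])
        then show ?thesis using max that by blast
      qed
      assume "card R < 3"
      with fin show False
      proof (cases rule: card_less_3_cases)
        case 1
        have "Unbarred 1 \<in> vertices m" using m by simp
        then show False using unR[of "{Unbarred 1}"] 1 by auto
      next
        case (2 u)
        then have u: "u \<in> vertices m" using RV by auto
        obtain s where "s \<in> vertices m" "s \<noteq> u" "adjacent m u s"
          by (rule next_vertex[OF u m])
        then show False using unR[of "{u, s}"] 2 u edge_commute[of m T] by (auto simp: edge_def)
      next
        case (3 u v)
        then have V: "u \<in> vertices m" "v \<in> vertices m" using RV by auto
        have e: "edge m T u v" "edge m T v u" using unseparated_edge[OF M un] 3 by auto
        have "1 < clockwise_dist m u v \<or> 1 < clockwise_dist m v u" using clockwise_dist_add[OF V 3(2)] m by linarith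
        then obtain w where "edge m T u w" "edge m T v w"
          using maximal_apex[OF M m e(1)] maximal_apex[OF M m e(2)] by metis
        then show False using unR[of "{u, v, w}"] 3 e V edge_commute[of m T] by (auto simp: edge_def)
      qed
    qed
    ultimately show ?thesis by linarith
  qed
  then show ?thesis using nc noncrossing_iff[OF sub] sub by (simp add: triangulation_def)
qed

lemma triangle_region:
  assumes M: "maximal_noncrossing m T" and m: "2 \<le> m"
    and e: "edge m T u v" "edge m T u w" "edge m T v w"
  shows "{u, v, w} \<in> regions m T"
proof -
  have nc: "noncrossing m T" and sub: "T \<subseteq> chords m"
    using M by (auto simp: maximal_noncrossing_def noncrossing_def)
  have "uncrossed m T x x" for x by (simp add: uncrossed_def)
  then have "unseparated m T {u, v, w}"
    using e uncrossed_edge[OF nc] uncrossed_commute[of m T]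
    by (auto simp: unseparated_iff[OF sub] edge_def)
  then obtain R where R: "R \<in> regions m T" "{u, v, w} \<subseteq> R" by (rule region_extends)
  have "card R = 3" using maximal_triangulation[OF m M] R by (simp add: triangulation_def)
  moreover have "card {u, v, w} = 3" using e by (auto simp: edge_def card_insert_if)
  ultimately have "R = {u, v, w}" using R card_subset_eq[of R "{u, v, w}"]
    by (metis card.infinite zero_neq_numeral)
  with R show ?thesis by simp
qed

lemma quad_eq:
  assumes M: "maximal_noncrossing m T" and m: "2 \<le> m" and e: "edge m T u v"
  shows "quad m T {u, v} = {u, v} \<union> {w. edge m T u w \<and> edge m T v w}"
proof
  show "quad m T {u, v} \<subseteq> {u, v} \<union> {w. edge m T u w \<and> edge m T v w}"
    using unseparated_edge[OF M] unfolding quad_def regions_def by blast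
next
  have uv: "u \<in> vertices m" "v \<in> vertices m" "u \<noteq> v" using e by (auto simp: edge_def)
  have "1 < clockwise_dist m u v \<or> 1 < clockwise_dist m v u" using clockwise_dist_add[OF uv] m by linarith
  then obtain z where "edge m T u z" "edge m T v z"
    using maximal_apex[OF M m e] maximal_apex[OF M m, of v u] e edge_commute by metis
  then have "{u, v, z} \<in> regions m T" using triangle_region[OF M m e] by blast
  then have "{u, v} \<subseteq> quad m T {u, v}" by (auto simp: quad_def)
  moreover have "w \<in> quad m T {u, v}" if "edge m T u w" "edge m T v w" for w
    using triangle_region[OF M m e that] unfolding quad_def by blast
  ultimately show "{u, v} \<union> {w. edge m T u w \<and> edge m T v w} \<subseteq> quad m T {u, v}" by blast
qed

lemma apex_unique:
  assumes nc: "noncrossing m T"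
    and e: "edge m T a b" "edge m T b c" "edge m T c d" "edge m T d a" and c: "crossing m a c b d"
  shows "{w. edge m T a w \<and> edge m T c w} = {b, d}"
proof -
  have "w = b \<or> w = d" if "edge m T a w" "edge m T c w" for w
  proof -
    have V: "{a, b, c, d, w} \<subseteq> vertices m" "w \<noteq> a" "w \<noteq> c" using e that by (auto simp: edge_def)
    have n: "\<not> crossing m a b c w" "\<not> crossing m c b a w" "\<not> crossing m a d c w" "\<not> crossing m c d a w"
      using nc e that edge_commute unfolding noncrossing_def by metis+
    have "pos m w = pos m b \<or> pos m w = pos m d"
      using interleaved_apex_unique[of "pos m a" "pos m c" "pos m b" "pos m d" "pos m w"] n c V pos_eq_iff[of w m]
      by (auto simp: crossing_def)
    then show ?thesis using V pos_eq_iff[of w m] by auto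
  qed
  then show ?thesis using e edge_commute by blast
qed

lemma quad_diff:
  assumes M: "maximal_noncrossing m T" and m: "2 \<le> m" and "edge m T a c"
    and e: "edge m T a b" "edge m T b c" "edge m T c d" "edge m T d a" and c: "crossing m a c b d"
  shows "quad m T {a, c} - {a, c} = {b, d}"
proof -
  have "noncrossing m T" using M by (simp add: maximal_noncrossing_def)
  have "{b, d} \<inter> {a, c} = {}" using c by auto
  then show ?thesis
    unfolding quad_eq[OF M m \<open>edge m T a c\<close>] apex_unique[OF \<open>noncrossing m T\<close> e c] by blast
qed

definition flip :: "vertex set \<Rightarrow> vertex set \<Rightarrow> vertex set set \<Rightarrow> vertex set set" where
  "flip C D T = T - {C} \<union> {D}"

lemma edge_flip:
  assumes "{a, c} \<in> chords m" "{b, d} \<in> chords m"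
  shows "edge m (flip {a, c} {b, d} T) x y \<longleftrightarrow>
    edge m T x y \<and> {x, y} \<noteq> {a, c} \<or> {x, y} = {b, d}"
  using assms unfolding edge_def flip_def chords_def
  by (auto simp: doubleton_eq_iff adjacent_commute)

lemma flip_maximal:
  assumes M: "maximal_noncrossing m T" and m: "2 \<le> m" and ac: "{a, c} \<in> T"
    and e: "edge m T a b" "edge m T b c" "edge m T c d" "edge m T d a" and c: "crossing m a c b d"
  shows "maximal_noncrossing m (flip {a, c} {b, d} T)"
proof -
  have nc: "noncrossing m T" and sub: "T \<subseteq> chords m"
    using M by (auto simp: maximal_noncrossing_def noncrossing_def)
  have V: "{a, b, c, d} \<subseteq> vertices m" using e by (auto simp: edge_def)
  have ac_chord: "{a, c} \<in> chords m" using ac sub by blast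
  have c': "crossing m b d a c" using c crossing_commute by simp
  then have "\<not> adjacent m b d" using not_crossing_adjacent V by auto
  moreover have "b \<noteq> d" using c by auto
  ultimately have bd_chord: "{b, d} \<in> chords m" using V by (simp add: doubleton_in_chords)
  note ef = edge_flip[OF ac_chord bd_chord, of T]
  have neq: "{a, c} \<noteq> {b, d}" using c by auto
  have diag: "{x, y} = {a, c}" if xy: "{x, y} \<subseteq> vertices m" "crossing m b d x y"
    and n: "\<not> crossing m a b x y" "\<not> crossing m b c x y" "\<not> crossing m c d x y" "\<not> crossing m d a x y" for x y
  proof -
    have "{pos m x, pos m y} = {pos m a, pos m c}"
      using interleaved_quadrilateral[of "pos m a" "pos m b" "pos m x" "pos m y" "pos m c" "pos m d"] n c xy
      by (simp add: crossing_def)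
    then show ?thesis using xy V pos_eq_iff[of _ m] by (auto simp: doubleton_eq_iff)
  qed
  have diag': "{x, y} = {b, d}" if xy: "{x, y} \<subseteq> vertices m" "crossing m a c x y"
    and n: "\<not> crossing m a b x y" "\<not> crossing m b c x y" "\<not> crossing m c d x y" "\<not> crossing m d a x y" for x y
  proof -
    have "{pos m x, pos m y} = {pos m b, pos m d}"
      using interleaved_quadrilateral[of "pos m b" "pos m c" "pos m x" "pos m y" "pos m d" "pos m a"] n c' xy
        interleaved_swap(1)[of "pos m a" "pos m c"] interleaved_swap(2)[of "pos m b" "pos m d" "pos m a" "pos m c"]
      by (simp add: crossing_def)
    then show ?thesis using xy V pos_eq_iff[of _ m] by (auto simp: doubleton_eq_iff)
  qed
  have new: "\<not> crossing m b d x y" if "edge m T x y" "{x, y} \<noteq> {a, c}" for x y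
    using diag[of x y] that nc e by (auto simp: noncrossing_def edge_def)
  have "noncrossing m (flip {a, c} {b, d} T)"
  proof -
    have "\<not> crossing m x y z w" if "edge m (flip {a, c} {b, d} T) x y" "edge m (flip {a, c} {b, d} T) z w" for x y z w
    proof -
      have old: "\<not> crossing m x y z w" if "edge m T x y" "edge m T z w" using nc that by (auto simp: noncrossing_def)
      have p: "crossing m x y z w \<longleftrightarrow> crossing m b d z w" if "{x, y} = {b, d}"
        using that crossing_swap(1)[of m b d] by (auto simp: doubleton_eq_iff)
      have q: "crossing m x y z w \<longleftrightarrow> crossing m b d x y" if "{z, w} = {b, d}"
        using that crossing_swap(1)[of m b d] crossing_commute[of m x y] by (auto simp: doubleton_eq_iff)
      have r: "\<not> crossing m b d z w" if "{z, w} = {b, d}"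
        using that by (auto simp: doubleton_eq_iff)
      show ?thesis using that old p q r new ef by metis
    qed
    moreover have "flip {a, c} {b, d} T \<subseteq> chords m" using sub bd_chord by (auto simp: flip_def)
    ultimately show ?thesis by (simp add: noncrossing_def)
  qed
  moreover have "edge m (flip {a, c} {b, d} T) x y"
    if xy: "x \<in> vertices m" "y \<in> vertices m" "x \<noteq> y" and un: "uncrossed m (flip {a, c} {b, d} T) x y" for x y
  proof (cases "crossing m a c x y")
    case True
    have ne: "{a, b} \<noteq> {a, c}" "{b, c} \<noteq> {a, c}" "{c, d} \<noteq> {a, c}" "{d, a} \<noteq> {a, c}"
      using c by (auto simp: doubleton_eq_iff)
    have "\<not> crossing m a b x y" "\<not> crossing m b c x y" "\<not> crossing m c d x y" "\<not> crossing m d a x y"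
      using un ef e ne unfolding uncrossed_def by blast+
    then show ?thesis using diag'[of x y] True xy ef by auto
  next
    case False
    have "uncrossed m T x y"
      unfolding uncrossed_def
    proof (intro allI impI)
      fix z w
      assume "edge m T z w"
      show "\<not> crossing m z w x y"
      proof (cases "{z, w} = {a, c}")
        case True
        then show ?thesis using False crossing_swap(1)[of m a c] by (auto simp: doubleton_eq_iff)
      next
        case False
        then show ?thesis using un ef \<open>edge m T z w\<close> unfolding uncrossed_def by blast
      qed
    qed
    then have "edge m T x y" using maximal_edge[OF M] xy by blast
    moreover have "{x, y} \<noteq> {a, c}"
    proof
      assume "{x, y} = {a, c}"
      then have "crossing m b d x y"
        using c' crossing_swap(2)[of m b d] by (auto simp: doubleton_eq_iff)
      then show False using un ef unfolding uncrossed_def by blast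
    qed
    ultimately show ?thesis using ef by blast
  qed
  ultimately show ?thesis by (auto simp: maximal_noncrossing_def)
qed

section \<open>Centrally symmetric triangulations\<close>

lemma bar_bar [simp]: "bar (bar v) = v" by (cases v) auto

lemma bar_neq [simp]: "bar v \<noteq> v" "v \<noteq> bar v" by (cases v; simp)+

lemma bar_eq_iff [simp]: "bar u = bar v \<longleftrightarrow> u = v" by (metis bar_bar)

lemma bar_vertices [simp]: "bar v \<in> vertices m \<longleftrightarrow> v \<in> vertices m" by (cases v) auto

lemma interleaved_Suc [simp]: "interleaved (Suc a) (Suc b) (Suc c) (Suc d) \<longleftrightarrow> interleaved a b c d"
  by (simp add: interleaved_def)

lemma pos_bar: "v \<in> vertices m \<Longrightarrow> pos m (bar v) = Suc (clockwise (2 * m) (m + 1) (pos m v))"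
  by (cases v) (auto simp: clockwise_def)

lemma crossing_bar:
  assumes "{u, v, x, y} \<subseteq> vertices m"
  shows "crossing m (bar u) (bar v) (bar x) (bar y) \<longleftrightarrow> crossing m u v x y"
proof -
  have "1 \<le> m" using assms by (auto simp: vertices_def)
  then show ?thesis
    using assms pos_range[of _ m] by (simp add: crossing_def pos_bar interleaved_clockwise)
qed

lemma adjacent_bar:
  assumes "u \<in> vertices m" "v \<in> vertices m"
  shows "adjacent m (bar u) (bar v) \<longleftrightarrow> adjacent m u v"
proof -
  have *: "pos m (bar y) = pos m (bar x) mod (2 * m) + 1"
    if "pos m y = pos m x mod (2 * m) + 1" "x \<in> vertices m" "y \<in> vertices m" for x y
    using that by (cases x; cases y; cases "pos m x = 2 * m") (auto simp: mod_if split: if_splits)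
  have imp: "adjacent m (bar x) (bar y)" if "adjacent m x y" "x \<in> vertices m" "y \<in> vertices m" for x y
    using that(1) unfolding adjacent_def
    by (elim disjE) (use *[OF _ that(2,3)] *[OF _ that(3,2)] in blast)+
  show ?thesis
    using imp[of u v] imp[of "bar u" "bar v"] assms by auto
qed

lemma adjacent_Unbarred:
  assumes "2 \<le> m" "1 \<le> i" "i \<le> m" "1 \<le> j" "j \<le> m"
  shows "adjacent m (Unbarred i) (Unbarred j) \<longleftrightarrow> j = i + 1 \<or> i = j + 1"
    "adjacent m (Unbarred i) (Barred j) \<longleftrightarrow> i = m \<and> j = 1 \<or> i = 1 \<and> j = m"
  using assms by (cases "j = m"; auto simp: adjacent_def mod_if)+

lemma crossing_cases:
  assumes "1 \<le> b" "1 \<le> c" "i \<le> m" "j \<le> m" "k \<le> m" "l \<le> m"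
  shows "crossing m (Unbarred i) (Unbarred j) (Unbarred k) (Unbarred l) \<longleftrightarrow> interleaved i j k l"
    "i < j \<Longrightarrow> crossing m (Unbarred i) (Unbarred j) (Unbarred k) (Barred b) \<longleftrightarrow> i < k \<and> k < j"
    "\<not> crossing m (Unbarred i) (Unbarred j) (Barred b) (Barred c)"
    "crossing m (Unbarred i) (Barred b) (Unbarred j) (Barred c) \<longleftrightarrow> i < j \<and> b < c \<or> j < i \<and> c < b"
  using assms by (auto simp: crossing_def interleaved_def)

locale symmetric_triangulation =
  fixes m :: nat and T :: "vertex set set"
  assumes m2: "2 \<le> m" and maximal: "maximal_noncrossing m T" and sym: "(image bar) ` T = T"
begin

lemma noncrossing: "noncrossing m T"
  using maximal by (simp add: maximal_noncrossing_def)

lemma subset_chords: "T \<subseteq> chords m"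
  using maximal by (rule maximal_subset_chords)

lemma bar_in_iff: "bar ` C \<in> T \<longleftrightarrow> C \<in> T"
proof -
  have "bar ` C \<in> T" if "C \<in> T" for C using sym that by blast
  from this[of C] this[of "bar ` C"] show ?thesis by (auto simp: image_image)
qed

lemma edge_bar [simp]: "edge m T (bar u) (bar v) \<longleftrightarrow> edge m T u v"
  using bar_in_iff[of "{u, v}"] adjacent_bar[of u m v] by (auto simp: edge_def)

definition p :: "nat \<Rightarrow> nat \<Rightarrow> bool" where
  "p i j \<longleftrightarrow> edge m T (Unbarred i) (Unbarred j)"

definition q :: "nat \<Rightarrow> nat \<Rightarrow> bool" where
  "q i b \<longleftrightarrow> edge m T (Unbarred i) (Barred b)"

lemma edge_Unbarred:
  "edge m T (Unbarred i) (Unbarred j) \<longleftrightarrow> p i j"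
  "edge m T (Unbarred i) (Barred b) \<longleftrightarrow> q i b"
  by (simp_all add: p_def q_def)

lemma edge_Barred:
  "edge m T (Barred i) (Barred j) \<longleftrightarrow> p i j"
  "edge m T (Barred b) (Unbarred i) \<longleftrightarrow> q i b"
  using edge_bar[of "Unbarred i" "Unbarred j"] edge_commute[of m T "Unbarred i" "Barred b"]
  by (auto simp: edge_Unbarred)

lemma p_sym: "p i j \<longleftrightarrow> p j i"
  unfolding p_def by (rule edge_commute)

lemma q_sym: "q i b \<longleftrightarrow> q b i"
  using edge_bar[of "Unbarred i" "Barred b"] by (simp add: edge_Unbarred edge_Barred)

lemma p_range: "p i j \<Longrightarrow> 1 \<le> i \<and> i \<le> m \<and> 1 \<le> j \<and> j \<le> m \<and> i \<noteq> j"
  unfolding p_def edge_def by auto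

lemma q_range: "q i b \<Longrightarrow> 1 \<le> i \<and> i \<le> m \<and> 1 \<le> b \<and> b \<le> m"
  unfolding q_def edge_def by auto

lemma p_Suc: "1 \<le> i \<Longrightarrow> i < m \<Longrightarrow> p i (Suc i)"
  using adjacent_Unbarred(1)[OF m2, of i "Suc i"] by (simp add: p_def edge_def)

lemma q_outer: "q 1 m" "q m 1"
  using m2 adjacent_Unbarred(2)[OF m2, of 1 m] adjacent_Unbarred(2)[OF m2, of m 1]
  by (simp_all add: q_def edge_def)

lemma p_chord:
  assumes "p i j" "i + 1 < j"
  shows "{Unbarred i, Unbarred j} \<in> T"
proof -
  have "\<not> adjacent m (Unbarred i) (Unbarred j)"
    using p_range[OF assms(1)] assms(2) adjacent_Unbarred(1)[OF m2, of i j] by simp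
  then show ?thesis using assms(1) unfolding p_def edge_def by blast
qed

lemma q_chord:
  assumes "q i b" "\<not> (i = m \<and> b = 1)" "\<not> (i = 1 \<and> b = m)"
  shows "{Unbarred i, Barred b} \<in> T"
proof -
  have "\<not> adjacent m (Unbarred i) (Barred b)"
    using q_range[OF assms(1)] assms(2,3) adjacent_Unbarred(2)[OF m2, of i b] by simp
  then show ?thesis using assms(1) unfolding q_def edge_def by blast
qed

lemma chord_p:
  assumes "{Unbarred i, Unbarred j} \<in> T"
  shows "p i j" "i + 1 \<noteq> j"
proof -
  show p: "p i j" unfolding p_def using chord_edge[OF subset_chords] assms .
  have "\<not> adjacent m (Unbarred i) (Unbarred j)"
    using assms subset_chords doubleton_in_chords by blast
  then show "i + 1 \<noteq> j"
    using p_range[OF p] adjacent_Unbarred(1)[OF m2, of i j] by simp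
qed

lemma chord_q:
  assumes "{Unbarred i, Barred b} \<in> T"
  shows "q i b" "\<not> (i = m \<and> b = 1)" "\<not> (i = 1 \<and> b = m)"
proof -
  show q: "q i b" unfolding q_def using chord_edge[OF subset_chords] assms .
  have "\<not> adjacent m (Unbarred i) (Barred b)"
    using assms subset_chords doubleton_in_chords by blast
  then show "\<not> (i = m \<and> b = 1)" "\<not> (i = 1 \<and> b = m)"
    using q_range[OF q] adjacent_Unbarred(2)[OF m2, of i b] by simp_all
qed

lemma pp: "p i j \<Longrightarrow> p k l \<Longrightarrow> i < k \<Longrightarrow> k < j \<Longrightarrow> j < l \<Longrightarrow> False"
  using noncrossing crossing_cases(1)[of 1 1 i m j k l] p_range[of i j] p_range[of k l]
  unfolding noncrossing_def p_def by (auto simp: interleaved_def)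

lemma pq: "p i j \<Longrightarrow> q k b \<Longrightarrow> i < k \<Longrightarrow> k < j \<Longrightarrow> False"
  using noncrossing crossing_cases(2)[of b 1 i m j k 1] p_range[of i j] q_range[of k b] m2
  unfolding noncrossing_def p_def q_def by auto

lemma qq: "q i b \<Longrightarrow> q j c \<Longrightarrow> i < j \<Longrightarrow> b < c \<Longrightarrow> False"
  using noncrossing crossing_cases(4)[of b c i m j 1 1] q_range[of i b] q_range[of j c] m2
  unfolding noncrossing_def q_def by auto

declare edge_Unbarred [simp] edge_Barred [simp]

lemma p_max:
  assumes ij: "1 \<le> i" "i < j" "j \<le> m"
    and P: "\<And>k l. p k l \<Longrightarrow> i < k \<Longrightarrow> k < j \<Longrightarrow> i \<le> l \<and> l \<le> j"
    and Q: "\<And>k b. q k b \<Longrightarrow> i < k \<Longrightarrow> \<not> k < j"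
  shows "p i j"
  unfolding p_def
proof (rule maximal_edge[OF maximal])
  show "uncrossed m T (Unbarred i) (Unbarred j)"
    unfolding uncrossed_def
  proof (intro allI impI)
    fix x y
    assume e: "edge m T x y"
    then have "x \<in> vertices m" "y \<in> vertices m" by (auto simp: edge_def)
    then show "\<not> crossing m x y (Unbarred i) (Unbarred j)"
    proof (elim vertices_cases)
      fix k l
      assume "x = Unbarred k" "y = Unbarred l" "1 \<le> k" "k \<le> m" "1 \<le> l" "l \<le> m"
      moreover from this have "p k l" "p l k" using e p_sym[of k l] by auto
      ultimately have "crossing m x y (Unbarred i) (Unbarred j) \<longleftrightarrow> interleaved i j k l"
        using ij m2 crossing_cases(1)[of 1 1 i m j k l]
        by (simp add: crossing_commute[of m "Unbarred k" "Unbarred l"])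
      moreover have "\<not> interleaved i j k l"
        using P[OF \<open>p k l\<close>] P[OF \<open>p l k\<close>] ij(2)
        by (cases "i < k \<and> k < j"; cases "i < l \<and> l < j") (auto simp: interleaved_def)
      ultimately show ?thesis by simp
    next
      fix k b
      assume "x = Unbarred k" "y = Barred b" "1 \<le> k" "k \<le> m" "1 \<le> b" "b \<le> m"
      then show ?thesis
        using e Q[of k b] ij crossing_cases(2)[of b 1 i m j k 1] m2
        by (simp add: crossing_commute[of m "Unbarred k" "Barred b"])
    next
      fix k b
      assume "y = Unbarred k" "x = Barred b" "1 \<le> k" "k \<le> m" "1 \<le> b" "b \<le> m"
      then show ?thesis
        using e Q[of k b] ij crossing_cases(2)[of b 1 i m j k 1] m2
        by (simp add: crossing_commute[of m "Barred b" "Unbarred k"]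
          crossing_swap(2)[of m "Unbarred i" "Unbarred j" "Barred b"])
    next
      fix b c
      assume "x = Barred b" "y = Barred c" "1 \<le> b" "b \<le> m" "1 \<le> c" "c \<le> m"
      then show ?thesis
        using crossing_cases(3)[of b c i m j 1 1] ij m2
        by (simp add: crossing_commute[of m "Barred b" "Barred c"])
    qed
  qed
qed (use ij in auto)

lemma q_max:
  assumes ib: "1 \<le> i" "i \<le> m" "1 \<le> b" "b \<le> m"
    and P: "\<And>k l. p k l \<Longrightarrow> k < i \<Longrightarrow> \<not> i < l" "\<And>k l. p k l \<Longrightarrow> k < b \<Longrightarrow> \<not> b < l"
    and Q: "\<And>j c. q j c \<Longrightarrow> i < j \<Longrightarrow> \<not> b < c" "\<And>j c. q j c \<Longrightarrow> j < i \<Longrightarrow> \<not> c < b"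
  shows "q i b"
  unfolding q_def
proof (rule maximal_edge[OF maximal])
  have PU: "\<not> crossing m (Unbarred k) (Unbarred l) (Unbarred i) (Barred b)"
    if "p k l" "k < l" "1 \<le> b" "b \<le> m" "1 \<le> i" "i \<le> m" "\<And>k l. p k l \<Longrightarrow> k < i \<Longrightarrow> \<not> i < l" for k l i b
    using that(1-6) that(7)[of k l] crossing_cases(2)[of b 1 k m l i 1] p_range[of k l] m2 by simp
  have PU': "\<not> crossing m (Unbarred k) (Unbarred l) (Unbarred i) (Barred b)"
    if "p k l" "1 \<le> b" "b \<le> m" "1 \<le> i" "i \<le> m" "\<And>k l. p k l \<Longrightarrow> k < i \<Longrightarrow> \<not> i < l" for k l i b
    using PU[of k l b i] PU[of l k b i] that p_sym[of k l] p_range[of k l] crossing_swap(1)[of m "Unbarred k"]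
    by (cases k l rule: linorder_cases) auto
  show "uncrossed m T (Unbarred i) (Barred b)"
    unfolding uncrossed_def
  proof (intro allI impI)
    fix x y
    assume e: "edge m T x y"
    then have V: "x \<in> vertices m" "y \<in> vertices m" by (auto simp: edge_def)
    then show "\<not> crossing m x y (Unbarred i) (Barred b)"
    proof (elim vertices_cases)
      fix k l
      assume "x = Unbarred k" "y = Unbarred l" "1 \<le> k" "k \<le> m" "1 \<le> l" "l \<le> m"
      then show ?thesis using e PU'[OF _ _ _ _ _ P(1)] ib by simp
    next
      fix k c
      assume "x = Unbarred k" "y = Barred c" "1 \<le> k" "k \<le> m" "1 \<le> c" "c \<le> m"
      then show ?thesis
        using e Q[of k c] ib crossing_cases(4)[of c b k m i 1 1] m2 by auto
    next
      fix k c
      assume "y = Unbarred k" "x = Barred c" "1 \<le> k" "k \<le> m" "1 \<le> c" "c \<le> m"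
      then show ?thesis
        using e Q[of k c] ib crossing_cases(4)[of c b k m i 1 1] m2 crossing_swap(1)[of m "Barred c" "Unbarred k"] by auto
    next
      fix k l
      assume xy: "x = Barred k" "y = Barred l" "1 \<le> k" "k \<le> m" "1 \<le> l" "l \<le> m"
      then have "\<not> crossing m (bar x) (bar y) (Unbarred b) (Barred i)"
        using e PU'[OF _ _ _ _ _ P(2)] ib by simp
      moreover have "{x, y, Unbarred i, Barred b} \<subseteq> vertices m" using V ib by simp
      ultimately show ?thesis
        using crossing_bar[of x y "Unbarred i" "Barred b" m] crossing_swap(2)[of m "bar x" "bar y"] by simp
    qed
  qed
qed (use ib in auto)

lemma inner_apex:
  assumes "p i j" "i + 1 < j"
  obtains k where "i < k" "k < j" "p i k" "p k j"
proof -
  have r: "1 \<le> i" "j \<le> m" using p_range[OF assms(1)] by auto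
  have clockwise_dist: "clockwise_dist m (Unbarred i) (Unbarred j) = j - i" using assms by (simp add: clockwise_dist_def clockwise_def)
  obtain w where w: "edge m T (Unbarred i) w" "edge m T (Unbarred j) w"
    "0 < clockwise_dist m (Unbarred i) w" "clockwise_dist m (Unbarred i) w < clockwise_dist m (Unbarred i) (Unbarred j)"
    by (rule maximal_apex[OF maximal m2, of "Unbarred i" "Unbarred j"]) (use assms clockwise_dist in auto)
  then have "w \<in> vertices m" by (simp add: edge_def)
  then show thesis
    using w that r clockwise_dist by (elim vertices_cases) (auto simp: clockwise_dist_def clockwise_def p_sym split: if_splits)
qed

lemma outer_apex:
  assumes "p i j" "i < j"
  obtains k where "k < i" "p k i" "p k j" | k where "j < k" "p i k" "p j k" | b where "q i b" "q j b"
proof -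
  have r: "1 \<le> i" "j \<le> m" using p_range[OF assms(1)] by auto
  have clockwise_dist: "clockwise_dist m (Unbarred j) (Unbarred i) = i + 2 * m - j" using assms by (simp add: clockwise_dist_def clockwise_def)
  obtain w where w: "edge m T (Unbarred j) w" "edge m T (Unbarred i) w"
    "0 < clockwise_dist m (Unbarred j) w" "clockwise_dist m (Unbarred j) w < clockwise_dist m (Unbarred j) (Unbarred i)"
    by (rule maximal_apex[OF maximal m2, of "Unbarred j" "Unbarred i"])
      (use assms clockwise_dist r p_sym[of i j] in auto)
  have side: "k < i \<or> j < k" if "w = Unbarred k" for k
  proof (cases "j \<le> k")
    case True
    then show ?thesis using w(3) that by (cases "k = j") (auto simp: clockwise_dist_def clockwise_def)
  next
    case False
    then have "k + 2 * m - j < i + 2 * m - j" using w(4) that clockwise_dist by (simp add: clockwise_dist_def clockwise_def)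
    then show ?thesis by linarith
  qed
  have "w \<in> vertices m" using w by (simp add: edge_def)
  then show thesis
    using w(1,2) that side by (elim vertices_cases) (auto simp: p_sym)
qed

lemma mixed_apex:
  assumes "q i b" "\<not> (i = m \<and> b = 1)"
  obtains k where "i < k" "p i k" "q k b" | c where "c < b" "q i c" "p c b"
proof -
  have r: "1 \<le> i" "i \<le> m" "1 \<le> b" "b \<le> m" using q_range[OF assms(1)] by auto
  have clockwise_dist: "clockwise_dist m (Unbarred i) (Barred b) = m + b - i" using r by (simp add: clockwise_dist_def clockwise_def)
  obtain w where w: "edge m T (Unbarred i) w" "edge m T (Barred b) w"
    "0 < clockwise_dist m (Unbarred i) w" "clockwise_dist m (Unbarred i) w < clockwise_dist m (Unbarred i) (Barred b)"
    by (rule maximal_apex[OF maximal m2, of "Unbarred i" "Barred b"]) (use assms clockwise_dist r in auto)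
  have side: "c < b" if "w = Barred c" for c
  proof -
    have "m + c - i < m + b - i" using w(4) that clockwise_dist r by (simp add: clockwise_dist_def clockwise_def)
    then show ?thesis by linarith
  qed
  have side': "i < k" if "w = Unbarred k" "k \<le> m" for k
  proof (rule ccontr)
    assume "\<not> i < k"
    then have "k < i" using w(3) that by (cases "k = i") (auto simp: clockwise_dist_def clockwise_def)
    then have "k + 2 * m - i < m + b - i" using w(4) that clockwise_dist by (simp add: clockwise_dist_def clockwise_def)
    then show False using r that by linarith
  qed
  have "w \<in> vertices m" using w by (simp add: edge_def)
  then show thesis
    using w(1,2) that side side' by (elim vertices_cases) (auto simp: p_sym)
qed

lemma diameter: "\<exists>k. q k k"
proof -
  define k where "k = (LEAST k. \<exists>b\<le>k. q k b)"
  have ex: "\<exists>b\<le>m. q m b" using q_outer(2) q_range by blast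
  have k: "\<exists>b\<le>k. q k b" unfolding k_def by (rule LeastI[where P="\<lambda>k. \<exists>b\<le>k. q k b"], rule ex)
  have least: "k \<le> l" if "q l b" "b \<le> l" for l b unfolding k_def by (rule Least_le) (use that in blast)
  define b where "b = Max {b. b \<le> k \<and> q k b}"
  have fin: "finite {b. b \<le> k \<and> q k b}" by simp
  have b: "b \<le> k" "q k b" using Max_in[OF fin] k unfolding b_def by auto
  have max: "c \<le> b" if "c \<le> k" "q k c" for c using Max_ge[OF fin] that unfolding b_def by auto
  show ?thesis
  proof (cases "b = k")
    case True then show ?thesis using b by auto
  next
    case False
    then have "b < k" using b by simp
    have "q b k" using b q_sym by simp
    then show ?thesis
    proof (rule mixed_apex)
      show "\<not> (b = m \<and> k = 1)" using \<open>b < k\<close> m2 by simp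
    next
      fix w assume w: "b < w" "p b w" "q w k"
      then have "q k w" using q_sym by simp
      then have "k < w" using max w by (meson leD le_less_linear)
      then show ?thesis using pq w b \<open>b < k\<close> by blast
    next
      fix c assume c: "c < k" "q b c" "p c k"
      show ?thesis
      proof (cases "b \<le> c")
        case True
        then show ?thesis using least[of c b] c q_sym by fastforce
      next
        case False
        then show ?thesis using least[of b c] c \<open>b < k\<close> by fastforce
      qed
    qed
  qed
qed

lemma red_Unbarred:
  assumes "p i j" "i < j"
  shows "red m T {Unbarred i, Unbarred j} \<longleftrightarrow> (\<exists>w>j. p i w \<and> p j w)"
proof -
  have "quad m T {Unbarred i, Unbarred j} = {Unbarred i, Unbarred j} \<union> {w. edge m T (Unbarred i) w \<and> edge m T (Unbarred j) w}"
    using assms by (intro quad_eq[OF maximal m2]) simp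
  moreover have "(\<exists>w. edge m T (Unbarred i) w \<and> edge m T (Unbarred j) w \<and> is_Unbarred w \<and> j < label w) \<longleftrightarrow>
    (\<exists>w>j. p i w \<and> p j w)"
    by (metis edge_Unbarred(1) vertex.collapse(1) vertex.disc(1) vertex.sel(1))
  ultimately show ?thesis
    using assms by (auto simp: red_def pure_def same_type_def)
qed

lemma red_Barred:
  assumes "p i j" "i < j"
  shows "red m T {Barred i, Barred j} \<longleftrightarrow> (\<exists>w>j. p i w \<and> p j w)"
proof -
  have "quad m T {Barred i, Barred j} = {Barred i, Barred j} \<union> {w. edge m T (Barred i) w \<and> edge m T (Barred j) w}"
    using assms by (intro quad_eq[OF maximal m2]) simp
  moreover have "(\<exists>w. edge m T (Barred i) w \<and> edge m T (Barred j) w \<and> \<not> is_Unbarred w \<and> j < label w) \<longleftrightarrow>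
    (\<exists>w>j. p i w \<and> p j w)"
    by (metis edge_Barred(1) vertex.collapse(2) vertex.disc(2) vertex.sel(2))
  ultimately show ?thesis
    using assms by (auto simp: red_def pure_def same_type_def)
qed

lemma red_mixed:
  assumes "q i b"
  shows "red m T {Unbarred i, Barred b} \<longleftrightarrow> (\<exists>w>i. p i w \<and> q w b) \<or> (\<exists>w>b. q i w \<and> p b w)"
proof -
  have "quad m T {Unbarred i, Barred b} = {Unbarred i, Barred b} \<union> {w. edge m T (Unbarred i) w \<and> edge m T (Barred b) w}"
    using assms by (intro quad_eq[OF maximal m2]) simp
  moreover have "(\<exists>w. edge m T (Unbarred i) w \<and> edge m T (Barred b) w \<and> is_Unbarred w \<and> i < label w) \<longleftrightarrow>
    (\<exists>w>i. p i w \<and> q w b)"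
    by (metis edge_Unbarred(1) edge_Barred(2) vertex.collapse(1) vertex.disc(1) vertex.sel(1))
  moreover have "(\<exists>w. edge m T (Unbarred i) w \<and> edge m T (Barred b) w \<and> \<not> is_Unbarred w \<and> b < label w) \<longleftrightarrow>
    (\<exists>w>b. q i w \<and> p b w)"
    by (metis edge_Barred(1) edge_Unbarred(2) vertex.collapse(2) vertex.disc(2) vertex.sel(2))
  ultimately show ?thesis
    by (auto simp: red_def pure_def same_type_def)
qed

end

lemma triangulations_B_iff:
  assumes "1 \<le> n"
  shows "T \<in> triangulations_B n \<longleftrightarrow> symmetric_triangulation (n + 1) T"
  using assms triangulation_maximal[of "n + 1" T] maximal_triangulation[of "n + 1" T]
  by (auto simp: triangulations_B_def symmetric_triangulation_def)

section \<open>Green flips\<close>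

definition symmetric_flip :: "vertex set \<Rightarrow> vertex set \<Rightarrow> vertex set set \<Rightarrow> vertex set set" where
  "symmetric_flip C D T = T - {C, bar ` C} \<union> {D, bar ` D}"

lemma symmetric_flip_bar_closed:
  assumes T: "\<And>X. X \<in> T \<Longrightarrow> bar ` X \<in> T" and X: "X \<in> symmetric_flip C D T"
  shows "bar ` X \<in> symmetric_flip C D T"
proof -
  have bb: "bar ` bar ` Y = Y" for Y by (simp add: image_image)
  from X consider "X = D" | "X = bar ` D" | "X \<in> T" "X \<noteq> C" "X \<noteq> bar ` C"
    unfolding symmetric_flip_def by blast
  then show ?thesis
  proof cases
    case 3
    then have "bar ` X \<in> T" "bar ` X \<noteq> C" "bar ` X \<noteq> bar ` C" using T bb by metis+
    then show ?thesis by (simp add: symmetric_flip_def)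
  qed (simp_all add: symmetric_flip_def bb)
qed

context symmetric_triangulation
begin

lemma symmetric_flip_aux:
  assumes ac: "{a, c} \<in> T"
    and e: "edge m T a b" "edge m T b c" "edge m T c d" "edge m T d a" and c: "crossing m a c b d"
  shows "maximal_noncrossing m (symmetric_flip {a, c} {b, d} T)" (is ?max)
    and "edge m (symmetric_flip {a, c} {b, d} T) x y \<longleftrightarrow>
      edge m T x y \<and> {x, y} \<noteq> {a, c} \<and> {x, y} \<noteq> bar ` {a, c} \<or> {x, y} = {b, d} \<or> {x, y} = bar ` {b, d}"
      (is ?edge)
proof -
  have V: "{a, b, c, d} \<subseteq> vertices m" using e by (auto simp: edge_def)
  have max1: "maximal_noncrossing m (flip {a, c} {b, d} T)"
    by (rule flip_maximal[OF maximal m2 ac e c])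
  have acC: "{a, c} \<in> chords m" using ac subset_chords by blast
  have bdC: "{b, d} \<in> chords m" using maximal_subset_chords[OF max1] by (auto simp: flip_def)
  note e1 = edge_flip[OF acC bdC, of T]
  have "?max \<and> ?edge"
  proof (cases "bar ` {a, c} = {a, c}")
    case True
    then have "bar a = c" "bar c = a" using bar_neq[of a] bar_neq[of c] by auto
    then have "bar ` {w. edge m T a w \<and> edge m T c w} \<subseteq> {w. edge m T a w \<and> edge m T c w}"
      using edge_bar by (auto simp del: edge_bar) (metis bar_bar edge_bar)+
    then have "bar ` {b, d} \<subseteq> {b, d}" unfolding apex_unique[OF noncrossing e c] .
    then have bd: "bar ` {b, d} = {b, d}" using bar_neq[of b] bar_neq[of d] by auto
    have "symmetric_flip {a, c} {b, d} T = flip {a, c} {b, d} T"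
      unfolding symmetric_flip_def flip_def True bd by auto
    then show ?thesis using max1 e1 True bd by simp
  next
    case False
    let ?T1 = "flip {a, c} {b, d} T"
    have V': "bar a \<in> vertices m" "bar c \<in> vertices m" "bar b \<in> vertices m" "bar d \<in> vertices m"
      using V by auto
    have Cb: "{bar a, bar c} \<in> T" using bar_in_iff[of "{a, c}"] ac by simp
    have c': "crossing m (bar a) (bar c) (bar b) (bar d)" using c V crossing_bar by simp
    have bd_ne: "{b, d} \<noteq> {bar a, bar c}"
    proof
      assume "{b, d} = {bar a, bar c}"
      then have "edge m T b d" using chord_edge[OF subset_chords] Cb by metis
      then show False using c noncrossing chord_edge[OF subset_chords ac] unfolding noncrossing_def by blast
    qed
    have bd_ne': "{bar b, bar d} \<noteq> {a, c}"
      using bd_ne by (metis bar_bar image_empty image_insert)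
    have ne: "bar a \<noteq> c"
      using False by auto
    have in1: "{bar a, bar c} \<in> ?T1" using Cb False by (auto simp: flip_def)
    have "edge m ?T1 (bar a) (bar b)" "edge m ?T1 (bar b) (bar c)" "edge m ?T1 (bar c) (bar d)" "edge m ?T1 (bar d) (bar a)"
    proof -
      have "{bar a, z} \<noteq> {a, c}" "{bar c, z} \<noteq> {a, c}" "{z, bar a} \<noteq> {a, c}" "{z, bar c} \<noteq> {a, c}" for z
        using ne by (auto simp: doubleton_eq_iff)
      then show "edge m ?T1 (bar a) (bar b)" "edge m ?T1 (bar b) (bar c)" "edge m ?T1 (bar c) (bar d)" "edge m ?T1 (bar d) (bar a)"
        unfolding e1 using e by simp_all
    qed
    note e' = this
    have max2: "maximal_noncrossing m (flip {bar a, bar c} {bar b, bar d} ?T1)"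
      by (rule flip_maximal[OF max1 m2 in1 e' c'])
    have acC': "{bar a, bar c} \<in> chords m" using Cb subset_chords by blast
    have bdC': "{bar b, bar d} \<in> chords m" using maximal_subset_chords[OF max2] by (auto simp: flip_def)
    have "symmetric_flip {a, c} {b, d} T = flip {bar a, bar c} {bar b, bar d} ?T1"
      using bd_ne unfolding symmetric_flip_def flip_def by auto
    moreover have "edge m (flip {bar a, bar c} {bar b, bar d} ?T1) x y \<longleftrightarrow>
      edge m T x y \<and> {x, y} \<noteq> {a, c} \<and> {x, y} \<noteq> {bar a, bar c} \<or> {x, y} = {b, d} \<or> {x, y} = {bar b, bar d}"
      unfolding edge_flip[OF acC' bdC'] e1 using bd_ne by argo
    ultimately show ?thesis using max2 by simp
  qed
  then show ?max ?edge by auto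
qed

lemma symmetric_flip:
  assumes "{a, c} \<in> T"
    and e: "edge m T a b" "edge m T b c" "edge m T c d" "edge m T d a" and c: "crossing m a c b d"
  shows "symmetric_triangulation m (symmetric_flip {a, c} {b, d} T)"
proof
  have *: "bar ` C \<in> symmetric_flip {a, c} {b, d} T" if "C \<in> symmetric_flip {a, c} {b, d} T" for C
    by (rule symmetric_flip_bar_closed[OF _ that]) (simp add: bar_in_iff)
  show "(image bar) ` symmetric_flip {a, c} {b, d} T = symmetric_flip {a, c} {b, d} T"
  proof (intro equalityI subsetI)
    fix C assume "C \<in> symmetric_flip {a, c} {b, d} T"
    then show "C \<in> (image bar) ` symmetric_flip {a, c} {b, d} T"
      using *[of C] by (intro image_eqI[of _ _ "bar ` C"]) (simp_all add: image_image)
  qed (use * in auto)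
qed (fact m2 symmetric_flip_aux(1)[OF assms])+

end

text \<open>
  The flips from the diagonal \<open>a c\<close> to the diagonal \<open>b d\<close> that turn green into red.  A green chord
  with two barred endpoints is covered through its image under \<^const>\<open>bar\<close>.
\<close>

definition lowering_quad :: "vertex \<Rightarrow> vertex \<Rightarrow> vertex \<Rightarrow> vertex \<Rightarrow> bool" where
  "lowering_quad a b c d \<longleftrightarrow>
     (\<exists>i k j. a = Unbarred i \<and> b = Unbarred k \<and> c = Unbarred j \<and> i < k \<and> k < j \<and>
        ((\<exists>l<i. d = Unbarred l) \<or> (\<exists>e. d = Barred e))) \<or>
     (\<exists>j f e l. a = Unbarred j \<and> b = Barred f \<and> c = Barred e \<and> d = Unbarred l \<and> l < j \<and> f < e)"

definition green_quad :: "nat \<Rightarrow> vertex set set \<Rightarrow> vertex \<Rightarrow> vertex \<Rightarrow> vertex \<Rightarrow> vertex \<Rightarrow> bool" where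
  "green_quad m T a b c d \<longleftrightarrow> {a, c} \<in> T \<and> edge m T a b \<and> edge m T b c \<and> edge m T c d \<and> edge m T d a \<and>
     lowering_quad a b c d"

lemma lowering_quad_crossing:
  assumes "lowering_quad a b c d" "{a, b, c, d} \<subseteq> vertices m"
  shows "crossing m a c b d"
  using assms unfolding lowering_quad_def crossing_def interleaved_def by auto

context symmetric_triangulation
begin

lemma green_quad_crossing: "green_quad m T a b c d \<Longrightarrow> crossing m a c b d"
  by (rule lowering_quad_crossing) (auto simp: green_quad_def edge_def)

lemma green_quad_quad:
  assumes "green_quad m T a b c d"
  shows "quad m T {a, c} - {a, c} = {b, d}" "quad m T (bar ` {a, c}) - bar ` {a, c} = bar ` {b, d}"
proof -
  have c: "crossing m a c b d" by (rule green_quad_crossing[OF assms])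
  have V: "{a, b, c, d} \<subseteq> vertices m" using assms by (auto simp: green_quad_def edge_def)
  have e: "{a, c} \<in> T" "edge m T a b" "edge m T b c" "edge m T c d" "edge m T d a"
    using assms by (auto simp: green_quad_def)
  have ac: "edge m T a c" using chord_edge[OF subset_chords e(1)] .
  show "quad m T {a, c} - {a, c} = {b, d}"
    by (rule quad_diff[OF maximal m2 ac e(2-5) c])
  have "quad m T {bar a, bar c} - {bar a, bar c} = {bar b, bar d}"
    by (rule quad_diff[OF maximal m2]) (use e ac c V crossing_bar in auto)
  then show "quad m T (bar ` {a, c}) - bar ` {a, c} = bar ` {b, d}" by simp
qed

lemma green_quad_not_red:
  assumes "green_quad m T a b c d"
  shows "\<not> red m T {a, c}"
proof -
  have ac: "edge m T a c" using assms chord_edge[OF subset_chords] by (auto simp: green_quad_def)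
  have "quad m T {a, c} = {a, c} \<union> {b, d}"
    using green_quad_quad(1)[OF assms] quad_eq[OF maximal m2 ac] by auto
  then have quad: "quad m T {a, c} = {a, c, b, d}" by auto
  have "lowering_quad a b c d" using assms by (simp add: green_quad_def)
  then show ?thesis
    unfolding lowering_quad_def red_def quad
    by (elim disjE exE conjE) (simp_all add: pure_def same_type_def)
qed

lemma pure_chord_green_quad:
  assumes C: "{Unbarred i, Unbarred j} \<in> T" and ij: "i < j"
    and nr: "\<not> red m T {Unbarred i, Unbarred j}"
  obtains b d where "green_quad m T (Unbarred i) b (Unbarred j) d"
proof -
  have p: "p i j" and "i + 1 < j" using chord_p[OF C] ij by auto
  obtain k where k: "i < k" "k < j" "p i k" "p k j" by (rule inner_apex[OF p \<open>i + 1 < j\<close>])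
  have "green_quad m T (Unbarred i) (Unbarred k) (Unbarred j) d"
    if "edge m T (Unbarred j) d" "edge m T d (Unbarred i)" "(\<exists>l<i. d = Unbarred l) \<or> (\<exists>e. d = Barred e)" for d
    unfolding green_quad_def lowering_quad_def using that C k by auto
  note gq = this
  from p ij show thesis
  proof (rule outer_apex)
    fix l assume "l < i" "p l i" "p l j"
    then show thesis using that gq[of "Unbarred l"] p_sym[of l j] by auto
  next
    fix w assume "j < w" "p i w" "p j w"
    then show thesis using nr red_Unbarred[OF p ij] by auto
  next
    fix b assume "q i b" "q j b"
    then show thesis using that gq[of "Barred b"] by auto
  qed
qed

lemma mixed_chord_green_quad:
  assumes C: "{Unbarred i, Barred e} \<in> T" and nr: "\<not> red m T {Unbarred i, Barred e}"
  obtains b d where "green_quad m T (Unbarred i) b (Barred e) d"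
proof -
  have q: "q i e" "\<not> (i = m \<and> e = 1)" "\<not> (i = 1 \<and> e = m)" using chord_q[OF C] by auto
  have q': "q e i" using q q_sym by simp
  note nr' = nr[unfolded red_mixed[OF q(1)]]
  obtain f where f: "f < e" "q i f" "p f e"
    by (rule mixed_apex[OF q(1,2)]) (use nr' in auto)
  have n: "\<not> (e = m \<and> i = 1)" using q(3) by blast
  obtain l where l: "l < i" "q e l" "p l i"
    by (rule mixed_apex[OF q' n]) (use nr' q_sym in auto)
  have "green_quad m T (Unbarred i) (Barred f) (Barred e) (Unbarred l)"
    unfolding green_quad_def lowering_quad_def using C f l q_sym by auto
  then show thesis by (rule that)
qed

lemma green_chord_green_quad:
  assumes C: "C \<in> T" and nr: "\<not> red m T C"
  obtains a b c d where "green_quad m T a b c d" "C = {a, c} \<or> C = bar ` {a, c}"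
proof -
  note found = that
  have "C \<in> chords m" using C subset_chords by blast
  then obtain u v where uv: "C = {u, v}" "u \<in> vertices m" "v \<in> vertices m" "u \<noteq> v"
    by (auto simp: chords_def)
  have PU: thesis if eq: "C = {Unbarred i, Unbarred j}" "i < j" for i j
  proof -
    obtain b d where "green_quad m T (Unbarred i) b (Unbarred j) d"
      using pure_chord_green_quad C nr eq by metis
    then show thesis by (rule found) (simp add: eq)
  qed
  have PB: thesis if eq: "C = {Barred i, Barred j}" "i < j" for i j
  proof -
    have U: "bar ` C = {Unbarred i, Unbarred j}" using eq by simp
    then have C': "{Unbarred i, Unbarred j} \<in> T" using C bar_in_iff by metis
    then have p: "p i j" using chord_p by blast
    have "\<not> red m T {Unbarred i, Unbarred j}"
      using nr red_Unbarred[OF p eq(2)] red_Barred[OF p eq(2)] eq by simp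
    with C' eq(2) obtain b d where "green_quad m T (Unbarred i) b (Unbarred j) d"
      by (rule pure_chord_green_quad)
    then show thesis by (rule found) (simp add: eq)
  qed
  have M: thesis if eq: "C = {Unbarred i, Barred e}" for i e
  proof -
    obtain b d where "green_quad m T (Unbarred i) b (Barred e) d"
      using mixed_chord_green_quad C nr eq by metis
    then show thesis by (rule found) (simp add: eq)
  qed
  show thesis
    using uv PU PB M by (cases u; cases v) (metis insert_commute linorder_neqE_nat)+
qed

lemma green_flip_iff:
  assumes "1 \<le> n" "m = n + 1"
  shows "green_flip n T V \<longleftrightarrow> (\<exists>a b c d. green_quad m T a b c d \<and> V = symmetric_flip {a, c} {b, d} T)"
proof
  assume "green_flip n T V"
  then obtain C where C: "C \<in> T" "\<not> red m T C"
    and V: "V = (T - {C, bar ` C}) \<union> {quad m T C - C, quad m T (bar ` C) - bar ` C}"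
    unfolding green_flip_def assms(2) by blast
  obtain a b c d where gq: "green_quad m T a b c d" and eq: "C = {a, c} \<or> C = bar ` {a, c}"
    by (rule green_chord_green_quad[OF C])
  have "V = symmetric_flip {a, c} {b, d} T"
    using eq
  proof
    assume eq: "C = {a, c}"
    show ?thesis unfolding V eq green_quad_quad[OF gq] by (simp add: symmetric_flip_def)
  next
    assume eq: "C = bar ` {a, c}"
    then have "bar ` C = {a, c}" by (simp add: image_image)
    then show ?thesis
      unfolding V \<open>bar ` C = {a, c}\<close> unfolding eq green_quad_quad[OF gq] by (auto simp: symmetric_flip_def)
  qed
  with gq show "\<exists>a b c d. green_quad m T a b c d \<and> V = symmetric_flip {a, c} {b, d} T" by blast
next
  assume "\<exists>a b c d. green_quad m T a b c d \<and> V = symmetric_flip {a, c} {b, d} T"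
  then obtain a b c d where gq: "green_quad m T a b c d" and V: "V = symmetric_flip {a, c} {b, d} T"
    by blast
  have "symmetric_triangulation m V"
    unfolding V using gq green_quad_crossing[OF gq] by (intro symmetric_flip) (auto simp: green_quad_def)
  then have VB: "V \<in> triangulations_B n" using triangulations_B_iff[OF assms(1)] assms(2) by simp
  have TB: "T \<in> triangulations_B n"
    using triangulations_B_iff[OF assms(1)] assms(2) symmetric_triangulation_axioms by simp
  have "V = (T - {{a, c}, bar ` {a, c}}) \<union> {quad m T {a, c} - {a, c}, quad m T (bar ` {a, c}) - bar ` {a, c}}"
    unfolding green_quad_quad[OF gq] V symmetric_flip_def ..
  then show "green_flip n T V"
    unfolding green_flip_def using VB TB green_quad_not_red[OF gq] gq assms(2)
    unfolding green_quad_def by blast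
qed

end

section \<open>Inversions of a triangulation\<close>

text \<open>
  A pair \<open>(j, k)\<close> says that the triangle of \<open>k\<close> comes before that of \<open>j\<close>, with \<open>j\<close> to the left of
  \<open>k\<close>.  Inversions between barred vertices are omitted, as they mirror those between unbarred ones.
  The vertex \<open>m\<close> has no triangle; counting it as inverted with everything removes boundary cases.
  Every condition has at most one premise of the form \<open>x \<in> J\<close>, whence closure under unions.
\<close>

locale inversion_set =
  fixes m :: nat and J :: "(vertex \<times> vertex) set"
  assumes m2: "2 \<le> m"
    and pairs: "x \<in> J \<Longrightarrow> (\<exists>j k. x = (Unbarred j, Unbarred k) \<and> 1 \<le> k \<and> k < j \<and> j \<le> m) \<or>
      (\<exists>j c. x = (Unbarred j, Barred c) \<and> 1 \<le> j \<and> j \<le> m \<and> 1 \<le> c \<and> c \<le> m)"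
    and outer_pure: "1 \<le> k \<Longrightarrow> k < m \<Longrightarrow> (Unbarred m, Unbarred k) \<in> J"
    and outer_mixed: "(Unbarred m, Barred 1) \<in> J"
    and pure_up: "(Unbarred j, Unbarred k) \<in> J \<Longrightarrow> j \<le> i \<Longrightarrow> i \<le> m \<Longrightarrow> (Unbarred i, Unbarred k) \<in> J"
    and mixed_up: "(Unbarred j, Barred c) \<in> J \<Longrightarrow> j \<le> i \<Longrightarrow> i \<le> m \<Longrightarrow> (Unbarred i, Barred c) \<in> J"
    and mixed_sym: "(Unbarred j, Barred c) \<in> J \<Longrightarrow> (Unbarred c, Barred j) \<in> J"
    and pure_split: "(Unbarred j, Unbarred l) \<in> J \<Longrightarrow> l < k \<Longrightarrow> k < j \<Longrightarrow>
      (Unbarred j, Unbarred k) \<in> J \<or> (Unbarred k, Unbarred l) \<in> J"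
    and mixed_split: "(Unbarred j, Barred c) \<in> J \<Longrightarrow> 1 \<le> k \<Longrightarrow> k < j \<Longrightarrow>
      (Unbarred j, Unbarred k) \<in> J \<or> (Unbarred k, Barred c) \<in> J"
begin

lemma pure_range: "(Unbarred j, Unbarred k) \<in> J \<Longrightarrow> 1 \<le> k \<and> k < j \<and> j \<le> m"
  using pairs by fastforce

lemma mixed_range: "(Unbarred j, Barred c) \<in> J \<Longrightarrow> 1 \<le> j \<and> j \<le> m \<and> 1 \<le> c \<and> c \<le> m"
  using pairs by fastforce

lemma mixed_up2:
  assumes "(Unbarred j, Barred c) \<in> J" "j \<le> i" "i \<le> m" "c \<le> e" "e \<le> m"
  shows "(Unbarred i, Barred e) \<in> J"
  using mixed_sym[OF mixed_up[OF mixed_sym[OF mixed_up[OF assms(1-3)]] assms(4,5)]] .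

lemma outer_mixed_left: "1 \<le> c \<Longrightarrow> c \<le> m \<Longrightarrow> (Unbarred m, Barred c) \<in> J"
  using mixed_up2[OF outer_mixed, of m c] by simp

lemma subset_vertices: "J \<subseteq> vertices m \<times> vertices m"
  using pairs by fastforce

lemma finite: "finite J"
  using subset_vertices by (rule finite_subset) simp

end

lemma inversion_set_Un:
  assumes "inversion_set m J" "inversion_set m K"
  shows "inversion_set m (J \<union> K)"
proof -
  interpret J: inversion_set m J by fact
  interpret K: inversion_set m K by fact
  show ?thesis
  proof
    show "2 \<le> m" by (rule J.m2)
    show "(\<exists>j k. x = (Unbarred j, Unbarred k) \<and> 1 \<le> k \<and> k < j \<and> j \<le> m) \<or>
      (\<exists>j c. x = (Unbarred j, Barred c) \<and> 1 \<le> j \<and> j \<le> m \<and> 1 \<le> c \<and> c \<le> m)" if "x \<in> J \<union> K" for x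
      using that J.pairs[of x] K.pairs[of x] by blast
    show "(Unbarred m, Unbarred k) \<in> J \<union> K" if "1 \<le> k" "k < m" for k
      using J.outer_pure[OF that] by simp
    show "(Unbarred m, Barred 1) \<in> J \<union> K"
      using J.outer_mixed by simp
    show "(Unbarred i, Unbarred k) \<in> J \<union> K" if "(Unbarred j, Unbarred k) \<in> J \<union> K" "j \<le> i" "i \<le> m" for j k i
      using that(1) J.pure_up[OF _ that(2,3)] K.pure_up[OF _ that(2,3)] by blast
    show "(Unbarred i, Barred c) \<in> J \<union> K" if "(Unbarred j, Barred c) \<in> J \<union> K" "j \<le> i" "i \<le> m" for j c i
      using that(1) J.mixed_up[OF _ that(2,3)] K.mixed_up[OF _ that(2,3)] by blast
    show "(Unbarred c, Barred j) \<in> J \<union> K" if "(Unbarred j, Barred c) \<in> J \<union> K" for j c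
      using that J.mixed_sym K.mixed_sym by blast
    show "(Unbarred j, Unbarred k) \<in> J \<union> K \<or> (Unbarred k, Unbarred l) \<in> J \<union> K"
      if "(Unbarred j, Unbarred l) \<in> J \<union> K" "l < k" "k < j" for j l k
      using that(1) J.pure_split[OF _ that(2,3)] K.pure_split[OF _ that(2,3)] by blast
    show "(Unbarred j, Unbarred k) \<in> J \<union> K \<or> (Unbarred k, Barred c) \<in> J \<union> K"
      if "(Unbarred j, Barred c) \<in> J \<union> K" "1 \<le> k" "k < j" for j c k
      using that(1) J.mixed_split[OF _ that(2,3)] K.mixed_split[OF _ that(2,3)] by blast
  qed
qed

context symmetric_triangulation
begin

text \<open>
  \<open>over k j\<close>: an edge passes strictly above \<open>k\<close> and has its left end in \<open>{k<..j}\<close>; following the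
  boundary from \<open>j\<close>, a path through \<open>j\<close> and above \<open>k\<close> results.  Likewise \<open>mix j c\<close> asks for a path
  through \<open>j\<close> and the barred copy of \<open>c\<close>.
\<close>

definition over :: "nat \<Rightarrow> nat \<Rightarrow> bool" where
  "over k j \<longleftrightarrow> (\<exists>i>k. i \<le> j \<and> ((\<exists>l<k. p l i) \<or> (\<exists>b. q i b)))"

definition mix :: "nat \<Rightarrow> nat \<Rightarrow> bool" where
  "mix j c \<longleftrightarrow> (\<exists>i\<le>j. \<exists>b\<le>c. q i b)"

definition inversions :: "(vertex \<times> vertex) set" where
  "inversions = {(Unbarred j, Unbarred k) | j k. 1 \<le> k \<and> k < j \<and> j \<le> m \<and> over k j} \<union>
     {(Unbarred j, Barred c) | j c. j \<le> m \<and> c \<le> m \<and> mix j c}"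

lemma inversions_pure: "(Unbarred j, Unbarred k) \<in> inversions \<longleftrightarrow> 1 \<le> k \<and> k < j \<and> j \<le> m \<and> over k j"
  by (auto simp: inversions_def)

lemma inversions_mixed: "(Unbarred j, Barred c) \<in> inversions \<longleftrightarrow> j \<le> m \<and> c \<le> m \<and> mix j c"
  by (auto simp: inversions_def)

lemma over_p: "p l i \<Longrightarrow> l < k \<Longrightarrow> k < i \<Longrightarrow> i \<le> j \<Longrightarrow> over k j"
  unfolding over_def by blast

lemma over_q: "q i b \<Longrightarrow> k < i \<Longrightarrow> i \<le> j \<Longrightarrow> over k j"
  unfolding over_def by blast

lemma overE:
  assumes "over k j"
  obtains l i where "l < k" "k < i" "i \<le> j" "p l i" | i b where "k < i" "i \<le> j" "q i b"
  using assms unfolding over_def by blast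

lemma mixI: "q i b \<Longrightarrow> i \<le> j \<Longrightarrow> b \<le> c \<Longrightarrow> mix j c"
  unfolding mix_def by blast

lemma mixE:
  assumes "mix j c"
  obtains i b where "i \<le> j" "b \<le> c" "q i b"
  using assms unfolding mix_def by blast

lemma over_mono: "over k j \<Longrightarrow> j \<le> i \<Longrightarrow> over k i"
  unfolding over_def by (meson order_trans)

lemma mix_mono: "mix j c \<Longrightarrow> j \<le> i \<Longrightarrow> c \<le> e \<Longrightarrow> mix i e"
  unfolding mix_def by (meson order_trans)

lemma mix_sym: "mix j c \<longleftrightarrow> mix c j"
  unfolding mix_def using q_sym by blast

lemma mix_range: "mix j c \<Longrightarrow> 1 \<le> j \<and> 1 \<le> c"
  unfolding mix_def using q_range by (meson order_trans)

lemma over_split: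
  assumes "over l j" "l < k" "k < j"
  shows "over k j \<or> over l k"
  using assms(1)
proof (rule overE)
  fix h i assume *: "h < l" "l < i" "i \<le> j" "p h i"
  show ?thesis
  proof (cases "i \<le> k")
    case True then show ?thesis using * over_p[of h i l k] by blast
  next
    case False then show ?thesis using * assms(2) over_p[of h i k j] by auto
  qed
next
  fix i b assume *: "l < i" "i \<le> j" "q i b"
  show ?thesis
  proof (cases "i \<le> k")
    case True then show ?thesis using * over_q[of i b l k] by blast
  next
    case False then show ?thesis using * over_q[of i b k j] by auto
  qed
qed

lemma mix_split:
  assumes "mix j c" "k < j"
  shows "over k j \<or> mix k c"
  using assms(1)
proof (rule mixE)
  fix i b assume *: "i \<le> j" "b \<le> c" "q i b"
  show ?thesis
  proof (cases "i \<le> k")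
    case True then show ?thesis using * mixI by blast
  next
    case False then show ?thesis using * over_q[of i b k j] by auto
  qed
qed

lemma inversion_set_inversions: "inversion_set m inversions"
proof
  show "2 \<le> m" by (rule m2)
  show "(\<exists>j k. x = (Unbarred j, Unbarred k) \<and> 1 \<le> k \<and> k < j \<and> j \<le> m) \<or>
      (\<exists>j c. x = (Unbarred j, Barred c) \<and> 1 \<le> j \<and> j \<le> m \<and> 1 \<le> c \<and> c \<le> m)" if "x \<in> inversions" for x
    using that mix_range unfolding inversions_def by blast
  show "(Unbarred m, Unbarred k) \<in> inversions" if "1 \<le> k" "k < m" for k
    using that over_q[OF q_outer(2)] by (simp add: inversions_pure)
  show "(Unbarred m, Barred 1) \<in> inversions"
    using mixI[OF q_outer(2)] m2 by (simp add: inversions_mixed)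
  show "(Unbarred i, Unbarred k) \<in> inversions" if "(Unbarred j, Unbarred k) \<in> inversions" "j \<le> i" "i \<le> m" for j k i
    using that over_mono by (auto simp: inversions_pure)
  show "(Unbarred i, Barred c) \<in> inversions" if "(Unbarred j, Barred c) \<in> inversions" "j \<le> i" "i \<le> m" for j c i
    using that mix_mono by (auto simp: inversions_mixed)
  show "(Unbarred c, Barred j) \<in> inversions" if "(Unbarred j, Barred c) \<in> inversions" for j c
    using that mix_sym by (auto simp: inversions_mixed)
  show "(Unbarred j, Unbarred k) \<in> inversions \<or> (Unbarred k, Unbarred l) \<in> inversions"
    if "(Unbarred j, Unbarred l) \<in> inversions" "l < k" "k < j" for j l k
    using that over_split[of l j k] by (auto simp: inversions_pure)
  show "(Unbarred j, Unbarred k) \<in> inversions \<or> (Unbarred k, Barred c) \<in> inversions"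
    if "(Unbarred j, Barred c) \<in> inversions" "1 \<le> k" "k < j" for j c k
    using that mix_split[of j c k] by (auto simp: inversions_pure inversions_mixed)
qed

text \<open>
  An edge forces some inversions and forbids others; conversely, when all forced inversions are
  present and all forbidden ones absent, no edge can cross it.
\<close>

lemma p_iff_inversions:
  assumes "1 \<le> i" "i < j" "j \<le> m"
  shows "p i j \<longleftrightarrow> (\<forall>k. i < k \<longrightarrow> k < j \<longrightarrow> (Unbarred j, Unbarred k) \<in> inversions \<and> (Unbarred k, Unbarred i) \<notin> inversions)"
proof
  assume p: "p i j"
  have "over k j" if "i < k" "k < j" for k using over_p[OF p that] by simp
  moreover have "\<not> over i k" if "i < k" "k < j" for k
  proof
    assume "over i k"
    then show False using pp[OF _ p] pq[OF p] that by (elim overE) (blast intro: le_less_trans)+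
  qed
  ultimately show "\<forall>k. i < k \<longrightarrow> k < j \<longrightarrow> (Unbarred j, Unbarred k) \<in> inversions \<and> (Unbarred k, Unbarred i) \<notin> inversions"
    using assms by (auto simp: inversions_pure)
next
  assume *: "\<forall>k. i < k \<longrightarrow> k < j \<longrightarrow> (Unbarred j, Unbarred k) \<in> inversions \<and> (Unbarred k, Unbarred i) \<notin> inversions"
  have over: "over k j" "\<not> over i k" if "i < k" "k < j" for k
    using * that assms by (auto simp: inversions_pure)
  show "p i j"
  proof (rule p_max[OF assms])
    fix k l assume k: "p k l" "i < k" "k < j"
    have "i \<le> l"
      using over(2)[OF k(2,3)] over_p[of l k i k] k p_sym by force
    moreover have "l \<le> j"
    proof (rule ccontr)
      assume "\<not> l \<le> j"
      then show False
        using over(1)[OF k(2,3)] pp[OF _ k(1)] pq[OF k(1)]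
        by (elim overE) (meson le_less_trans not_le)+
    qed
    ultimately show "i \<le> l \<and> l \<le> j" by simp
  next
    fix k b assume "q k b" "i < k"
    then show "\<not> k < j" using over(2)[of k] over_q[of k b i k] by blast
  qed
qed

lemma q_iff_inversions:
  assumes "1 \<le> i" "i \<le> m" "1 \<le> b" "b \<le> m"
  shows "q i b \<longleftrightarrow> (Unbarred i, Barred b) \<in> inversions \<and> (\<forall>k<i. \<forall>c<b. (Unbarred k, Barred c) \<notin> inversions) \<and>
    (\<forall>k<i. 1 \<le> k \<longrightarrow> (Unbarred i, Unbarred k) \<in> inversions) \<and> (\<forall>c<b. 1 \<le> c \<longrightarrow> (Unbarred b, Unbarred c) \<in> inversions)"
    (is "_ \<longleftrightarrow> ?inversions")
proof
  assume q: "q i b"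
  have "\<not> mix k c" if "k < i" "c < b" for k c
    using qq[OF _ q] that by (meson le_less_trans mixE)
  moreover have "over k i" if "k < i" for k using over_q[OF q that] by simp
  moreover have "over c b" if "c < b" for c using over_q[OF _ that, of i] q q_sym by simp
  ultimately show ?inversions using mixI[OF q] assms by (auto simp: inversions_pure inversions_mixed)
next
  assume *: ?inversions
  have mix: "mix i b" "\<And>k c. k < i \<Longrightarrow> c < b \<Longrightarrow> \<not> mix k c"
    using * assms by (auto simp: inversions_mixed)
  have over: "\<And>k. k < i \<Longrightarrow> 1 \<le> k \<Longrightarrow> over k i" "\<And>c. c < b \<Longrightarrow> 1 \<le> c \<Longrightarrow> over c b"
    using * by (auto simp: inversions_pure)
  have no_p: "\<not> i < l" if "over k i" "p k l" for k l i
  proof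
    assume "i < l"
    then show False using that(1) pp[OF _ that(2)] pq[OF that(2)] by (elim overE) (meson le_less_trans)+
  qed
  show "q i b"
  proof (rule q_max[OF assms])
    show "\<not> i < l" if "p k l" "k < i" for k l using no_p over(1) p_range that by blast
    show "\<not> b < l" if "p k l" "k < b" for k l using no_p over(2) p_range that by blast
    show "\<not> b < c" if "q j c" "i < j" for j c
      using mix(1) qq[OF _ that(1)] that(2) by (meson le_less_trans mixE)
    show "\<not> c < b" if "q j c" "j < i" for j c
      using mix(2)[of j c] mixI[OF that(1)] that(2) by blast
  qed
qed

end

lemma inversions_inj:
  assumes "symmetric_triangulation m T" "symmetric_triangulation m V"
    and eq: "symmetric_triangulation.inversions m T = symmetric_triangulation.inversions m V"
  shows "T = V"
proof -
  interpret T: symmetric_triangulation m T by fact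
  interpret V: symmetric_triangulation m V by fact
  have p': "T.p i j \<longleftrightarrow> V.p i j" if "i < j" for i j
  proof (cases "1 \<le> i \<and> j \<le> m")
    case True
    then show ?thesis using T.p_iff_inversions[of i j] V.p_iff_inversions[of i j] that eq by simp
  next
    case False
    then show ?thesis using T.p_range V.p_range by blast
  qed
  have p: "T.p i j \<longleftrightarrow> V.p i j" for i j
    using p'[of i j] p'[of j i] T.p_sym[of i j] V.p_sym[of i j] T.p_range V.p_range
    by (cases i j rule: linorder_cases) blast+
  have q: "T.q i b \<longleftrightarrow> V.q i b" for i b
  proof (cases "1 \<le> i \<and> i \<le> m \<and> 1 \<le> b \<and> b \<le> m")
    case True
    then show ?thesis using T.q_iff_inversions[of i b] V.q_iff_inversions[of i b] eq by simp
  next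
    case False
    then show ?thesis using T.q_range V.q_range by blast
  qed
  have e: "edge m T u v \<longleftrightarrow> edge m V u v" for u v
    by (cases u; cases v) (simp_all add: p q)
  have "C \<in> T \<longleftrightarrow> C \<in> V" if C: "C \<in> chords m" for C
  proof -
    obtain u v where uv: "C = {u, v}" "u \<in> vertices m" "v \<in> vertices m" "u \<noteq> v" "\<not> adjacent m u v"
      using C unfolding chords_def by blast
    then show ?thesis using e[of u v] by (auto simp: edge_def)
  qed
  then show ?thesis using T.subset_chords V.subset_chords by blast
qed

section \<open>The Tamari order as inclusion of inversions\<close>

context symmetric_triangulation
begin

lemma edge_symmetric_flip:
  assumes gq: "green_quad m T a b c d"
  shows "symmetric_triangulation m (symmetric_flip {a, c} {b, d} T)"
    and "edge m (symmetric_flip {a, c} {b, d} T) x y \<longleftrightarrow>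
      edge m T x y \<and> {x, y} \<noteq> {a, c} \<and> {x, y} \<noteq> {bar a, bar c} \<or> {x, y} = {b, d} \<or> {x, y} = {bar b, bar d}"
  using symmetric_flip[of a c b d] symmetric_flip_aux(2)[of a c b d x y] green_quad_crossing[OF gq] gq
  by (simp_all add: green_quad_def)

lemma symmetric_flip_neq:
  assumes gq: "green_quad m T a b c d"
  shows "symmetric_flip {a, c} {b, d} T \<noteq> T"
proof
  assume "symmetric_flip {a, c} {b, d} T = T"
  then have "{b, d} \<in> T" by (auto simp: symmetric_flip_def)
  then have "edge m T b d" using chord_edge[OF subset_chords] by blast
  moreover have "edge m T a c" using chord_edge[OF subset_chords] gq by (auto simp: green_quad_def)
  ultimately show False
    using green_quad_crossing[OF gq] noncrossing unfolding noncrossing_def by blast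
qed

lemma pure_flip_inversions:
  assumes gq: "green_quad m T (Unbarred i) (Unbarred k) (Unbarred j) d" and ikj: "i < k" "k < j"
    and V: "V = symmetric_flip {Unbarred i, Unbarred j} {Unbarred k, d} T"
  shows "inversions \<subseteq> symmetric_triangulation.inversions m V"
    and "symmetric_triangulation.inversions m V \<subseteq> inversions \<union> {(Unbarred x, Unbarred i) | x. k \<le> x}"
proof -
  interpret V: symmetric_triangulation m V
    unfolding V by (rule edge_symmetric_flip(1)[OF gq])
  note e = edge_symmetric_flip(2)[OF gq, folded V]
  have d: "(\<exists>l<i. d = Unbarred l) \<or> (\<exists>e. d = Barred e)"
    using gq ikj by (auto simp: green_quad_def lowering_quad_def)
  have ed: "p i k" "p k j" "edge m T (Unbarred j) d" "edge m T (Unbarred i) d"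
    using gq edge_commute[of m T d] by (auto simp: green_quad_def)
  have p: "V.p x y \<longleftrightarrow> p x y \<and> {x, y} \<noteq> {i, j} \<or> (\<exists>l. d = Unbarred l \<and> {x, y} = {k, l})" for x y
    using e[of "Unbarred x" "Unbarred y"] d by (auto simp: doubleton_eq_iff)
  have q: "V.q x y \<longleftrightarrow> q x y \<or> (\<exists>l. d = Barred l \<and> {(x, y), (y, x)} = {(k, l), (l, k)})" for x y
    using e[of "Unbarred x" "Barred y"] d by (auto simp: doubleton_eq_iff)
  have pV: "V.p x y" if "p x y" "\<not> (x = i \<and> y = j)" "x < y" for x y
    using that ikj by (auto simp: p doubleton_eq_iff)
  have qV: "V.q x y" if "q x y" for x y
    using that by (simp add: q)
  have dV: "(\<exists>l<i. d = Unbarred l \<and> V.p l j \<and> V.p l k \<and> p l i \<and> p l j) \<or> (\<exists>b. d = Barred b \<and> V.q j b \<and> q i b)"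
    using d
  proof (elim disjE exE conjE)
    fix l assume l: "l < i" "d = Unbarred l"
    then have "p l j" "p l i" using ed p_sym by auto
    then show ?thesis using l ikj pV[of l j] p[of l k] by (auto simp: insert_commute)
  next
    fix b assume b: "d = Barred b"
    then show ?thesis using ed qV by auto
  qed
  have over_V: "V.over x y" if "over x y" for x y
    using that
  proof (rule overE)
    fix l h assume *: "l < x" "x < h" "h \<le> y" "p l h"
    show ?thesis
    proof (cases "l = i \<and> h = j")
      case False
      then show ?thesis using pV[of l h] * V.over_p[of l h x y] by auto
    next
      case True
      consider "x < k" | "x = k" | "k < x" by linarith
      then show ?thesis
      proof cases
        case 1
        then show ?thesis using True * pV[of i k] ed ikj V.over_p[of i k x y] by auto
      next
        case 2
        have "V.over k j"
          using dV V.over_p[of _ j k j] V.over_q[of j _ k j] ikj by auto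
        then show ?thesis using 2 True * V.over_mono by blast
      next
        case 3
        then show ?thesis using True * pV[of k j] ed ikj V.over_p[of k j x y] by auto
      qed
    qed
  next
    fix h b assume "x < h" "h \<le> y" "q h b"
    then show ?thesis using qV V.over_q by blast
  qed
  have mix_V: "V.mix x y" if "mix x y" for x y
    using that qV V.mixI by (metis mixE)
  show "inversions \<subseteq> V.inversions"
    using over_V mix_V unfolding inversions_def V.inversions_def by blast
  have over_T: "over x y \<or> x = i \<and> k \<le> y" if "V.over x y" for x y
    using that
  proof (rule V.overE)
    fix l h assume *: "l < x" "x < h" "h \<le> y" "V.p l h"
    then consider "p l h" | "d = Unbarred l" "h = k" | "d = Unbarred h" "l = k"
      by (auto simp: p doubleton_eq_iff)
    then show ?thesis
    proof cases
      case 1 then show ?thesis using * over_p by blast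
    next
      case 2
      then have "p l i" "l < i" using dV by auto
      then show ?thesis
        using 2 * ikj ed over_p[of l i x y] over_p[of i k x y] by (cases x i rule: linorder_cases) auto
    next
      case 3
      then show ?thesis using dV * ikj by auto
    qed
  next
    fix h b assume *: "x < h" "h \<le> y" "V.q h b"
    then consider "q h b" | "d = Barred b" "h = k" | "d = Barred h" "b = k"
      by (auto simp: q doubleton_eq_iff)
    then show ?thesis
    proof cases
      case 1 then show ?thesis using * over_q by blast
    next
      case 2
      then have "q i b" using dV by auto
      then show ?thesis
        using 2 * ikj ed over_q[of i b x y] over_p[of i k x y] by (cases x i rule: linorder_cases) auto
    next
      case 3
      then have "q h i" using dV q_sym by auto
      then show ?thesis using * over_q by blast
    qed
  qed
  have mix_T: "mix x y" if "V.mix x y" for x y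
    using that
  proof (rule V.mixE)
    fix h b assume *: "h \<le> x" "b \<le> y" "V.q h b"
    then consider "q h b" | "d = Barred b" "h = k" | "d = Barred h" "b = k"
      by (auto simp: q doubleton_eq_iff)
    then show ?thesis
    proof cases
      case 1 then show ?thesis using * mixI by blast
    next
      case 2
      then have "q i b" using dV by auto
      then show ?thesis using 2 * ikj mixI[of i b x y] by simp
    next
      case 3
      then have "q h i" using dV q_sym by auto
      then show ?thesis using 3 * ikj mixI[of h i x y] by simp
    qed
  qed
  show "V.inversions \<subseteq> inversions \<union> {(Unbarred x, Unbarred i) | x. k \<le> x}"
    using over_T mix_T unfolding inversions_def V.inversions_def by blast
qed

lemma mixed_flip_inversions:
  assumes gq: "green_quad m T (Unbarred j) (Barred f) (Barred e) (Unbarred l)" and lj: "l < j" and fe: "f < e"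
    and V: "V = symmetric_flip {Unbarred j, Barred e} {Barred f, Unbarred l} T"
  shows "inversions \<subseteq> symmetric_triangulation.inversions m V"
    and "symmetric_triangulation.inversions m V \<subseteq>
      inversions \<union> {(Unbarred x, Barred y) | x y. x \<le> m \<and> y \<le> m \<and> (l \<le> x \<and> f \<le> y \<or> f \<le> x \<and> l \<le> y)}"
proof -
  interpret V: symmetric_triangulation m V
    unfolding V by (rule edge_symmetric_flip(1)[OF gq])
  note e = edge_symmetric_flip(2)[OF gq, folded V]
  have ed: "q j f" "q f j" "p f e" "q l e" "q e l" "p l j"
    using gq p_sym q_sym by (auto simp: green_quad_def)
  have p: "V.p x y \<longleftrightarrow> p x y" for x y
    using e[of "Unbarred x" "Unbarred y"] by (auto simp: doubleton_eq_iff)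
  have q: "V.q x y \<longleftrightarrow> q x y \<and> (x, y) \<noteq> (j, e) \<and> (x, y) \<noteq> (e, j) \<or> (x, y) = (l, f) \<or> (x, y) = (f, l)" for x y
    using e[of "Unbarred x" "Barred y"] by (auto simp: doubleton_eq_iff)
  have edV: "V.q j f" "V.q f j" "V.q l e" "V.q e l"
    using ed lj fe by (auto simp: q)
  have overV_p: "V.over x y" if "p a b" "a < x" "x < b" "b \<le> y" for a b x y
    using V.over_p[of a b x y] that p by blast
  have over_V: "V.over x y" if "over x y" for x y
    using that
  proof (rule overE)
    fix a b assume *: "a < x" "x < b" "b \<le> y" "p a b"
    then show ?thesis using overV_p by blast
  next
    fix h b assume *: "x < h" "h \<le> y" "q h b"
    consider "h = j" | "h = e" | "V.q h b" using * q by blast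
    then show ?thesis
    proof cases
      case 1
      then show ?thesis using edV(1) * V.over_q by blast
    next
      case 2
      then show ?thesis using edV(4) * V.over_q by blast
    next
      case 3
      then show ?thesis using * V.over_q by blast
    qed
  qed
  have mix_V: "V.mix x y" if "mix x y" for x y
    using that
  proof (rule mixE)
    fix h b assume *: "h \<le> x" "b \<le> y" "q h b"
    consider "h = j" "b = e" | "h = e" "b = j" | "V.q h b" using * q by blast
    then show ?thesis
    proof cases
      case 1 then show ?thesis using V.mixI[OF edV(1), of x y] * fe by simp
    next
      case 2 then show ?thesis using V.mixI[OF edV(2), of x y] * fe by simp
    next
      case 3 then show ?thesis using * V.mixI by blast
    qed
  qed
  show "inversions \<subseteq> V.inversions"
    using over_V mix_V unfolding inversions_def V.inversions_def by blast
  have over_T: "over x y" if "V.over x y" for x y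
    using that
  proof (rule V.overE)
    fix a b assume "a < x" "x < b" "b \<le> y" "V.p a b"
    then show ?thesis using p over_p by blast
  next
    fix h b assume *: "x < h" "h \<le> y" "V.q h b"
    then consider "q h b" | "h = l" | "h = f" using q by blast
    then show ?thesis
      using * ed over_q by cases blast+
  qed
  have mix_T: "mix x y \<or> l \<le> x \<and> f \<le> y \<or> f \<le> x \<and> l \<le> y" if "V.mix x y" for x y
    using that
  proof (rule V.mixE)
    fix h b assume *: "h \<le> x" "b \<le> y" "V.q h b"
    then consider "q h b" | "h = l" "b = f" | "h = f" "b = l" using q by blast
    then show ?thesis using * mixI by cases blast+
  qed
  show "V.inversions \<subseteq> inversions \<union> {(Unbarred x, Barred y) | x y. x \<le> m \<and> y \<le> m \<and> (l \<le> x \<and> f \<le> y \<or> f \<le> x \<and> l \<le> y)}"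
    using over_T mix_T unfolding inversions_def V.inversions_def by blast
qed

lemma green_quad_inversions_mono:
  assumes gq: "green_quad m T a b c d"
  shows "inversions \<subseteq> symmetric_triangulation.inversions m (symmetric_flip {a, c} {b, d} T)"
proof -
  have "lowering_quad a b c d" using gq by (simp add: green_quad_def)
  then consider i k j where "a = Unbarred i" "b = Unbarred k" "c = Unbarred j" "i < k" "k < j"
    | j f e l where "a = Unbarred j" "b = Barred f" "c = Barred e" "d = Unbarred l" "l < j" "f < e"
    unfolding lowering_quad_def by blast
  then show ?thesis
  proof cases
    case (1 i k j) then show ?thesis using pure_flip_inversions(1)[of i k j d] gq by simp
  next
    case (2 j f e l) then show ?thesis using mixed_flip_inversions(1)[of j f e l] gq by simp
  qed
qed

lemma progress_pure:
  assumes J: "inversion_set m J" and sub: "inversions \<subseteq> J"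
    and new: "(Unbarred y0, Unbarred i0) \<in> J - inversions"
  obtains a b c d where "green_quad m T a b c d"
    "symmetric_triangulation.inversions m (symmetric_flip {a, c} {b, d} T) \<subseteq> J"
proof -
  interpret J: inversion_set m J by fact
  interpret I: inversion_set m inversions by (rule inversion_set_inversions)
  define A where "A = {i. i \<le> m \<and> (\<exists>y. (Unbarred y, Unbarred i) \<in> J - inversions)}"
  have "i0 \<in> A" using new J.pure_range[of y0 i0] by (auto simp: A_def)
  moreover have fin: "finite A" by (simp add: A_def)
  ultimately have "Max A \<in> A" by (intro Max_in) auto
  define i where "i = Max A"
  have max: "h \<le> i" if "(Unbarred y, Unbarred h) \<in> J - inversions" for y h
    using that J.pure_range[of y h] fin unfolding i_def by (intro Max_ge) (auto simp: A_def)
  obtain y where y: "(Unbarred y, Unbarred i) \<in> J" "(Unbarred y, Unbarred i) \<notin> inversions"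
    using \<open>Max A \<in> A\<close> by (auto simp: A_def i_def)
  have r: "1 \<le> i" "i < y" "y \<le> m" using J.pure_range[OF y(1)] by auto
  have not_over: "\<not> over i y" using y(2) r by (simp add: inversions_pure)
  define j where "j = (LEAST j. over i j)"
  have "over i m" using over_q[OF q_outer(2)] r by simp
  then have oj: "over i j" unfolding j_def by (rule LeastI)
  have least: "j \<le> h" if "over i h" for h unfolding j_def by (rule Least_le) (rule that)
  have "j \<le> m" using least \<open>over i m\<close> by blast
  have "y < j" using oj not_over over_mono by (meson not_le_imp_less)
  have "i < j" using r \<open>y < j\<close> by simp
  have p: "p i j"
  proof (subst p_iff_inversions[OF r(1) \<open>i < j\<close> \<open>j \<le> m\<close>], intro allI impI conjI)
    fix k assume k: "i < k" "k < j"
    show "(Unbarred k, Unbarred i) \<notin> inversions" using least[of k] k by (auto simp: inversions_pure)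
    moreover have "(Unbarred j, Unbarred i) \<in> inversions" using oj r \<open>i < j\<close> \<open>j \<le> m\<close> by (simp add: inversions_pure)
    ultimately show "(Unbarred j, Unbarred k) \<in> inversions" using I.pure_split k by blast
  qed
  have "i + 1 < j" using r \<open>y < j\<close> by simp
  obtain k where k: "i < k" "k < j" "p i k" "p k j" by (rule inner_apex[OF p \<open>i + 1 < j\<close>])
  have kJ: "(Unbarred k, Unbarred i) \<in> J"
  proof (rule ccontr)
    assume nk: "(Unbarred k, Unbarred i) \<notin> J"
    then have "k < y" using J.pure_up[OF y(1), of k] k \<open>j \<le> m\<close> by force
    then have "(Unbarred y, Unbarred k) \<in> J" using J.pure_split[OF y(1) k(1)] nk by blast
    moreover have "(Unbarred y, Unbarred k) \<notin> inversions"
    proof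
      assume "(Unbarred y, Unbarred k) \<in> inversions"
      then have "over k y" by (simp add: inversions_pure)
      then show False using pp[OF _ k(4)] pq[OF k(4)] \<open>y < j\<close> by (elim overE) (meson le_less_trans)+
    qed
    ultimately show False using max[of y k] k by simp
  qed
  have C: "{Unbarred i, Unbarred j} \<in> T" by (rule p_chord[OF p \<open>i + 1 < j\<close>])
  have gq: "green_quad m T (Unbarred i) (Unbarred k) (Unbarred j) d"
    if "edge m T (Unbarred j) d" "edge m T d (Unbarred i)" "(\<exists>l<i. d = Unbarred l) \<or> (\<exists>e. d = Barred e)" for d
    unfolding green_quad_def lowering_quad_def using that C k by auto
  obtain d where d: "green_quad m T (Unbarred i) (Unbarred k) (Unbarred j) d"
    using p \<open>i < j\<close>
  proof (rule outer_apex)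
    fix l assume "l < i" "p l i" "p l j"
    then show ?thesis using that gq[of "Unbarred l"] p_sym[of l j] by auto
  next
    fix w assume w: "j < w" "p i w" "p j w"
    from oj show ?thesis
    proof (rule overE)
      fix l h assume "l < i" "i < h" "h \<le> j" "p l h"
      then show ?thesis using pp[OF _ w(2), of l h] w by simp
    next
      fix h b assume "i < h" "h \<le> j" "q h b"
      then show ?thesis using pq[OF w(2), of h b] w by simp
    qed
  next
    fix b assume "q i b" "q j b"
    then show ?thesis using that gq[of "Barred b"] by auto
  qed
  show thesis
  proof (rule that[OF d])
    have "{(Unbarred x, Unbarred i) | x. k \<le> x \<and> x \<le> m} \<subseteq> J" using J.pure_up[OF kJ] by blast
    moreover interpret V: symmetric_triangulation m "symmetric_flip {Unbarred i, Unbarred j} {Unbarred k, d} T"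
      by (rule edge_symmetric_flip(1)[OF d])
    have "V.inversions \<subseteq> inversions \<union> {(Unbarred x, Unbarred i) | x. k \<le> x}"
      by (rule pure_flip_inversions(2)[OF d k(1,2) refl])
    then have "V.inversions \<subseteq> inversions \<union> {(Unbarred x, Unbarred i) | x. k \<le> x \<and> x \<le> m}"
      using V.inversions_pure by blast
    ultimately show "V.inversions \<subseteq> J" using sub by blast
  qed
qed

lemma progress_mixed:
  assumes J: "inversion_set m J" and sub: "inversions \<subseteq> J"
    and pure: "\<And>j k. (Unbarred j, Unbarred k) \<in> J \<Longrightarrow> (Unbarred j, Unbarred k) \<in> inversions"
    and new: "(Unbarred x, Barred y) \<in> J - inversions"
  obtains a b c d where "green_quad m T a b c d"
    "symmetric_triangulation.inversions m (symmetric_flip {a, c} {b, d} T) \<subseteq> J"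
proof -
  interpret J: inversion_set m J by fact
  have xy: "1 \<le> x" "x \<le> m" "1 \<le> y" "y \<le> m" using J.mixed_range new by auto
  then have not_mix: "\<not> mix x y" using new by (simp add: inversions_mixed)
  define j where "j = (LEAST j. \<exists>b\<le>y. q j b)"
  have ex: "\<exists>b\<le>y. q m b" using q_outer(2) xy by blast
  have j: "\<exists>b\<le>y. q j b" unfolding j_def by (rule LeastI[where P="\<lambda>j. \<exists>b\<le>y. q j b"], rule ex)
  have least: "j \<le> h" if "q h b" "b \<le> y" for h b unfolding j_def by (rule Least_le) (use that in blast)
  obtain b where b: "b \<le> y" "q j b" using j by blast
  have "x < j" using not_mix mixI[OF b(2), of x y] b(1) by force
  define e where "e = Max {e. e \<le> m \<and> q j e}"
  have fin: "finite {e. e \<le> m \<and> q j e}" by simp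
  have b': "b \<in> {e. e \<le> m \<and> q j e}" using b q_range by blast
  have e: "q j e" using Max_in[OF fin] b' unfolding e_def by blast
  have emax: "h \<le> e" if "q j h" for h
    using Max_ge[OF fin] that q_range unfolding e_def by blast
  have q': "q e j" using e q_sym by simp
  have n: "\<not> (e = m \<and> j = 1)" using \<open>x < j\<close> xy by simp
  obtain l where l: "l < j" "q e l" "p l j"
    using q' n
  proof (rule mixed_apex)
    fix w assume "e < w" "p e w" "q w j"
    then show ?thesis using emax[of w] q_sym by simp
  qed
  have "y < e"
  proof (rule ccontr)
    assume "\<not> y < e"
    then have "j \<le> l" using least[of l e] l q_sym by simp
    then show False using l by simp
  qed
  have n': "\<not> (j = m \<and> e = 1)" using \<open>y < e\<close> xy by simp
  obtain f where f: "f < e" "q j f" "p f e"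
    using e n'
  proof (rule mixed_apex)
    fix k assume "j < k" "p j k" "q k e"
    then show ?thesis using qq[OF b(2), of k e] b \<open>y < e\<close> by simp
  qed
  have C: "{Unbarred j, Barred e} \<in> T" using q_chord[OF e n'] n by blast
  have gq: "green_quad m T (Unbarred j) (Barred f) (Barred e) (Unbarred l)"
    unfolding green_quad_def lowering_quad_def using C f l q_sym by auto
  have lower: "(Unbarred l, Barred y) \<in> J" if "(Unbarred x, Barred y) \<in> J" "x < j" "l < j" "p l j" for x y l j
  proof (cases "x \<le> l")
    case True
    then show ?thesis using J.mixed_up[OF that(1)] p_range[OF that(4)] by blast
  next
    case False
    have "(Unbarred x, Unbarred l) \<notin> J"
    proof
      assume "(Unbarred x, Unbarred l) \<in> J"
      then have "over l x" using pure by (simp add: inversions_pure)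
      then show False using pp[OF _ that(4)] pq[OF that(4)] that(2) by (elim overE) (meson le_less_trans)+
    qed
    then show ?thesis using J.mixed_split[OF that(1), of l] False p_range[OF that(4)] by auto
  qed
  have "(Unbarred l, Barred y) \<in> J" using lower[of x y j l] new \<open>x < j\<close> l by blast
  then have "(Unbarred f, Barred l) \<in> J" using lower[of y l e f] J.mixed_sym \<open>y < e\<close> f by blast
  then have lf: "(Unbarred f, Barred l) \<in> J" "(Unbarred l, Barred f) \<in> J" using J.mixed_sym by blast+
  show thesis
  proof (rule that[OF gq])
    have "{(Unbarred x, Barred y) | x y. x \<le> m \<and> y \<le> m \<and> (l \<le> x \<and> f \<le> y \<or> f \<le> x \<and> l \<le> y)} \<subseteq> J"
      using J.mixed_up2[OF lf(1)] J.mixed_up2[OF lf(2)] by blast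
    then show "symmetric_triangulation.inversions m (symmetric_flip {Unbarred j, Barred e} {Barred f, Unbarred l} T) \<subseteq> J"
      using mixed_flip_inversions(2)[OF gq l(1) f(1) refl] sub by blast
  qed
qed

lemma progress:
  assumes J: "inversion_set m J" and sub: "inversions \<subset> J"
  obtains a b c d where "green_quad m T a b c d"
    "symmetric_triangulation.inversions m (symmetric_flip {a, c} {b, d} T) \<subseteq> J"
proof (cases "\<exists>j k. (Unbarred j, Unbarred k) \<in> J - inversions")
  case True
  then show thesis using progress_pure[OF J] sub that by blast
next
  case False
  interpret J: inversion_set m J by fact
  obtain z where z: "z \<in> J" "z \<notin> inversions" using sub by blast
  then obtain x y where "(Unbarred x, Barred y) \<in> J - inversions" using False J.pairs[OF z(1)] by blast
  then show thesis using progress_mixed[OF J _ _ , of x y] sub False that by blast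
qed

end

lemma realize_above:
  assumes "1 \<le> n" "m = n + 1" "inversion_set m J" "symmetric_triangulation m T"
    "symmetric_triangulation.inversions m T \<subseteq> J"
  shows "\<exists>V. symmetric_triangulation m V \<and> symmetric_triangulation.inversions m V = J \<and> tamari_le n T V"
  using assms(4,5)
proof (induction "card (J - symmetric_triangulation.inversions m T)" arbitrary: T rule: less_induct)
  case less
  interpret T: symmetric_triangulation m T by fact
  interpret J: inversion_set m J by fact
  show ?case
  proof (cases "T.inversions = J")
    case True
    then show ?thesis using less.prems by (auto simp: tamari_le_def)
  next
    case False
    then have "T.inversions \<subset> J" using less.prems by blast
    then obtain a b c d where gq: "green_quad m T a b c d"
      and sub: "symmetric_triangulation.inversions m (symmetric_flip {a, c} {b, d} T) \<subseteq> J"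
      using T.progress[OF assms(3)] by blast
    let ?V = "symmetric_flip {a, c} {b, d} T"
    interpret V: symmetric_triangulation m ?V by (rule T.edge_symmetric_flip(1)[OF gq])
    have "T.inversions \<noteq> V.inversions"
      using T.symmetric_flip_neq[OF gq] inversions_inj[of m T ?V] T.symmetric_triangulation_axioms
        V.symmetric_triangulation_axioms by blast
    then have "J - V.inversions \<subset> J - T.inversions" using T.green_quad_inversions_mono[OF gq] sub by blast
    then have "card (J - V.inversions) < card (J - T.inversions)" using J.finite by (intro psubset_card_mono) auto
    then obtain W where W: "symmetric_triangulation m W" "symmetric_triangulation.inversions m W = J" "tamari_le n ?V W"
      using less.hyps[OF _ V.symmetric_triangulation_axioms sub] by blast
    have "green_flip n T ?V" using T.green_flip_iff[OF assms(1,2)] gq by blast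
    then have "tamari_le n T W" using W(3) unfolding tamari_le_def by (rule converse_rtranclp_into_rtranclp)
    then show ?thesis using W by blast
  qed
qed

lemma tamari_le_iff:
  assumes n: "1 \<le> n" "m = n + 1"
    and T: "symmetric_triangulation m T" and V: "symmetric_triangulation m V"
  shows "tamari_le n T V \<longleftrightarrow> symmetric_triangulation.inversions m T \<subseteq> symmetric_triangulation.inversions m V"
proof
  assume "tamari_le n T V"
  then have "(green_flip n)\<^sup>*\<^sup>* T V" by (simp add: tamari_le_def)
  then have "symmetric_triangulation m V \<and> symmetric_triangulation.inversions m T \<subseteq> symmetric_triangulation.inversions m V"
  proof induction
    case base
    then show ?case using T by simp
  next
    case (step U W)
    interpret U: symmetric_triangulation m U using step.IH by (rule conjunct1)
    have "\<exists>a b c d. green_quad m U a b c d \<and> W = symmetric_flip {a, c} {b, d} U"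
      using step.hyps(2) U.green_flip_iff[OF n, of W] by simp
    then obtain a b c d where gq: "green_quad m U a b c d" and W: "W = symmetric_flip {a, c} {b, d} U"
      by blast
    have "symmetric_triangulation.inversions m T \<subseteq> U.inversions" using step.IH by (rule conjunct2)
    also have "\<dots> \<subseteq> symmetric_triangulation.inversions m W" unfolding W by (rule U.green_quad_inversions_mono[OF gq])
    finally show ?case unfolding W using U.edge_symmetric_flip(1)[OF gq] by (rule conjI[rotated])
  qed
  then show "symmetric_triangulation.inversions m T \<subseteq> symmetric_triangulation.inversions m V" by simp
next
  assume sub: "symmetric_triangulation.inversions m T \<subseteq> symmetric_triangulation.inversions m V"
  interpret V: symmetric_triangulation m V by fact
  obtain W where W: "symmetric_triangulation m W" "symmetric_triangulation.inversions m W = V.inversions" "tamari_le n T W"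
    using realize_above[OF n V.inversion_set_inversions T sub] by blast
  then have "W = V" using inversions_inj[OF W(1) V W(2)] by simp
  then show "tamari_le n T V" using W by simp
qed

section \<open>The least triangulation\<close>

definition bottom_triangulation :: "nat \<Rightarrow> vertex set set" where
  "bottom_triangulation m = {{Unbarred i, Unbarred m} | i. 1 \<le> i \<and> i + 1 < m} \<union>
     {{Barred i, Barred m} | i. 1 \<le> i \<and> i + 1 < m} \<union> {{Unbarred m, Barred m}}"

lemma bottom_chords:
  assumes "2 \<le> m"
  shows "bottom_triangulation m \<subseteq> chords m"
  using assms adjacent_bar[of "Unbarred _" m "Unbarred m"]
  by (auto simp: bottom_triangulation_def doubleton_in_chords adjacent_Unbarred)

lemma bottom_symmetric_triangulation:
  assumes m: "2 \<le> m"
  shows "symmetric_triangulation m (bottom_triangulation m)"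
proof
  let ?T = "bottom_triangulation m"
  have sub: "?T \<subseteq> chords m" by (rule bottom_chords[OF m])
  have "\<not> crosses m C D" if "C \<in> ?T" "D \<in> ?T" for C D
  proof -
    have in_V: "C \<in> chords m" "D \<in> chords m" using that sub by auto
    have UB: "\<not> crossing m (Unbarred i) (Unbarred m) (Barred j) (Barred m)" if "1 \<le> j" "1 \<le> i" "i \<le> m" for i j
      using that m by (simp add: crossing_cases)
    have "\<exists>u v x y. C = {u, v} \<and> D = {x, y} \<and> \<not> crossing m u v x y"
      using that unfolding bottom_triangulation_def
      by (elim UnE CollectE exE conjE singletonE)
        (metis not_crossing_shared UB crossing_commute Suc_leD less_imp_le_nat Suc_eq_plus1)+
    then obtain u v x y where uv: "C = {u, v}" "D = {x, y}" "\<not> crossing m u v x y" by blast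
    then have "{u, v, x, y} \<subseteq> vertices m" using in_V by (auto simp: doubleton_in_chords)
    then show ?thesis using uv crosses_iff_crossing by simp
  qed
  then have nc: "noncrossing m ?T" using noncrossing_iff[OF sub] by blast
  have e: "edge m ?T (Unbarred i) (Unbarred m)" "edge m ?T (Barred i) (Barred m)" if "1 \<le> i" "i + 1 < m" for i
    by (rule chord_edge[OF sub]; use that in \<open>auto simp: bottom_triangulation_def\<close>)+
  have em: "edge m ?T (Unbarred m) (Barred m)"
    by (rule chord_edge[OF sub]) (simp add: bottom_triangulation_def)
  have adj: "adjacent m (Barred i) (Barred j) \<longleftrightarrow> j = i + 1 \<or> i = j + 1"
    if "1 \<le> i" "i \<le> m" "1 \<le> j" "j \<le> m" for i j
    using that adjacent_bar[of "Unbarred i" m "Unbarred j"] adjacent_Unbarred(1)[OF m, of i j] by simp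
  have pure: "edge m ?T (Unbarred i) (Unbarred j)" "edge m ?T (Barred i) (Barred j)"
    if r: "1 \<le> i" "i < j" "j \<le> m" and c: "j = i + 1 \<or> j = m" for i j
  proof -
    have "edge m ?T (Unbarred i) (Unbarred j) \<and> edge m ?T (Barred i) (Barred j)"
    proof (cases "j = i + 1")
      case True
      then show ?thesis using r adj[of i j] adjacent_Unbarred(1)[OF m, of i j] by (simp add: edge_def)
    next
      case False
      then show ?thesis using r c e[of i] by simp
    qed
    then show "edge m ?T (Unbarred i) (Unbarred j)" "edge m ?T (Barred i) (Barred j)" by auto
  qed
  have mixed: "edge m ?T (Unbarred i) (Barred b)"
    if r: "1 \<le> i" "i \<le> m" "1 \<le> b" "b \<le> m" and un: "uncrossed m ?T (Unbarred i) (Barred b)" for i b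
  proof -
    have "\<not> (i < m \<and> b < m)"
      using un em r m unfolding uncrossed_def crossing_def interleaved_def by force
    moreover have "\<not> (i = m \<and> 1 < b \<and> b < m)"
    proof
      assume b: "i = m \<and> 1 < b \<and> b < m"
      then have "crossing m (Barred (b - 1)) (Barred m) (Unbarred i) (Barred b)"
        by (auto simp: crossing_def interleaved_def)
      moreover have "edge m ?T (Barred (b - 1)) (Barred m)" by (rule e(2)) (use b in auto)
      ultimately show False using un unfolding uncrossed_def by blast
    qed
    moreover have "\<not> (b = m \<and> 1 < i \<and> i < m)"
    proof
      assume b: "b = m \<and> 1 < i \<and> i < m"
      then have "crossing m (Unbarred (i - 1)) (Unbarred m) (Unbarred i) (Barred b)"
        by (auto simp: crossing_def interleaved_def)
      moreover have "edge m ?T (Unbarred (i - 1)) (Unbarred m)" by (rule e(1)) (use b in auto)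
      ultimately show False using un unfolding uncrossed_def by blast
    qed
    ultimately consider "i = m" "b = m" | "i = m" "b = 1" | "i = 1" "b = m" using r by linarith
    then show ?thesis
      using em r m adjacent_Unbarred(2)[OF m, of i b] by cases (auto simp: edge_def)
  qed
  have gap: "j = i + 1 \<or> j = m" if r: "1 \<le> i" "i < j" "j \<le> m"
    and un: "uncrossed m ?T (Unbarred i) (Unbarred j) \<or> uncrossed m ?T (Barred i) (Barred j)" for i j
  proof (rule ccontr)
    assume ij: "\<not> (j = i + 1 \<or> j = m)"
    then have "crossing m (Unbarred (i + 1)) (Unbarred m) (Unbarred i) (Unbarred j)"
      "crossing m (Barred (i + 1)) (Barred m) (Barred i) (Barred j)"
      using r by (auto simp: crossing_def interleaved_def)
    moreover have "edge m ?T (Unbarred (i + 1)) (Unbarred m)" "edge m ?T (Barred (i + 1)) (Barred m)"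
      using e[of "i + 1"] ij r by auto
    ultimately show False using un unfolding uncrossed_def by blast
  qed
  have "edge m ?T u v" if uv: "u \<in> vertices m" "v \<in> vertices m" "u \<noteq> v" and un: "uncrossed m ?T u v" for u v
  proof -
    have un': "uncrossed m ?T v u" using un uncrossed_commute by simp
    from uv(1,2) show ?thesis
    proof (elim vertices_cases)
      fix i j assume eq: "u = Unbarred i" "v = Unbarred j" and r: "1 \<le> i" "i \<le> m" "1 \<le> j" "j \<le> m"
      then consider "i < j" | "j < i" using uv(3) by (metis linorder_neqE_nat)
      then show ?thesis
      proof cases
        case 1 then show ?thesis using gap[of i j] pure(1)[of i j] un eq r by simp
      next
        case 2 then show ?thesis using gap[of j i] pure(1)[of j i] un' eq r edge_commute by simp
      qed
    next
      fix i j assume eq: "u = Barred i" "v = Barred j" and r: "1 \<le> i" "i \<le> m" "1 \<le> j" "j \<le> m"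
      then consider "i < j" | "j < i" using uv(3) by (metis linorder_neqE_nat)
      then show ?thesis
      proof cases
        case 1 then show ?thesis using gap[of i j] pure(2)[of i j] un eq r by simp
      next
        case 2 then show ?thesis using gap[of j i] pure(2)[of j i] un' eq r edge_commute by simp
      qed
    next
      fix i j assume "u = Unbarred i" "v = Barred j" and r: "1 \<le> i" "i \<le> m" "1 \<le> j" "j \<le> m"
      then show ?thesis using mixed[of i j] un by simp
    next
      fix i j assume "u = Barred i" "v = Unbarred j" and r: "1 \<le> i" "i \<le> m" "1 \<le> j" "j \<le> m"
      then show ?thesis using mixed[of j i] un' edge_commute by simp
    qed
  qed
  then show "maximal_noncrossing m ?T" using nc by (simp add: maximal_noncrossing_def)
  have *: "bar ` C \<in> ?T" if "C \<in> ?T" for C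
    using that unfolding bottom_triangulation_def by auto
  show "(image bar) ` ?T = ?T"
  proof (intro equalityI subsetI)
    fix C assume "C \<in> ?T"
    then show "C \<in> (image bar) ` ?T"
      using *[of C] by (intro image_eqI[of _ _ "bar ` C"]) (simp_all add: image_image)
  qed (use * in auto)
qed (rule m)

lemma bottom_inversions:
  assumes "inversion_set m J"
  shows "symmetric_triangulation.inversions m (bottom_triangulation m) \<subseteq> J"
proof -
  interpret J: inversion_set m J by fact
  let ?T = "bottom_triangulation m"
  interpret T: symmetric_triangulation m ?T
    by (rule bottom_symmetric_triangulation[OF J.m2])
  have p: "i = m" if "T.p l i" "l + 1 < i" for l i
    using T.p_chord[OF that] that unfolding bottom_triangulation_def by (auto simp: doubleton_eq_iff)
  have q: "i = m \<or> i = 1 \<and> b = m" if "T.q i b" for i b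
    using T.q_chord[OF that] unfolding bottom_triangulation_def by (auto simp: doubleton_eq_iff)
  have over: "j = m" if "T.over k j" "1 \<le> k" "j \<le> m" for k j
    using that(1)
  proof (rule T.overE)
    fix l i assume "l < k" "k < i" "i \<le> j" "T.p l i"
    then show ?thesis using p[of l i] that by simp
  next
    fix i b assume "k < i" "i \<le> j" "T.q i b"
    then show ?thesis using q[of i b] that by auto
  qed
  have mix: "j = m \<or> c = m" if "T.mix j c" "j \<le> m" "c \<le> m" for j c
    using that(1)
  proof (rule T.mixE)
    fix i b assume "i \<le> j" "b \<le> c" "T.q i b"
    then show ?thesis using q[of i b] that by auto
  qed
  show ?thesis
  proof
    fix x assume "x \<in> T.inversions"
    then consider j k where "x = (Unbarred j, Unbarred k)" "1 \<le> k" "k < j" "j \<le> m" "T.over k j"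
      | j c where "x = (Unbarred j, Barred c)" "j \<le> m" "c \<le> m" "T.mix j c"
      unfolding T.inversions_def by blast
    then show "x \<in> J"
    proof cases
      case (1 j k)
      then show ?thesis using over[of k j] J.outer_pure by simp
    next
      case (2 j c)
      then have "1 \<le> j" "1 \<le> c" using T.mix_range by blast+
      then show ?thesis
        using 2 mix[of j c] J.outer_mixed_left[of c] J.mixed_sym[OF J.outer_mixed_left[of j]] by auto
    qed
  qed
qed

section \<open>The noncrossing partition of a triangulation\<close>

lemma cos_less_cos_arc:
  assumes "0 \<le> d" "d < \<bar>y\<bar>" "\<bar>y\<bar> < 2 * pi - d"
  shows "cos y < cos d"
proof (cases "\<bar>y\<bar> \<le> pi")
  case True
  then have "cos \<bar>y\<bar> < cos d" using assms by (intro cos_monotone_0_pi) auto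
  then show ?thesis by simp
next
  case False
  then have "cos (2 * pi - \<bar>y\<bar>) < cos d" using assms by (intro cos_monotone_0_pi) auto
  then show ?thesis by (simp add: cos_diff)
qed

lemma convex_hulls_separated_by_arc:
  assumes n: "1 \<le> n" and st: "1 \<le> s" "s \<le> t" "t \<le> 2 * n"
    and A: "\<And>x. x \<in> A \<Longrightarrow> s \<le> pos n x \<and> pos n x \<le> t"
    and B: "\<And>x. x \<in> B \<Longrightarrow> x \<in> vertices n \<and> \<not> (s \<le> pos n x \<and> pos n x \<le> t)"
  shows "convex hull (circle_point n ` A) \<inter> convex hull (circle_point n ` B) = {}"
proof -
  define u where "u = pi / (2 * real n)"
  define f where "f = u * (real s + real t)"
  define d where "d = u * (real t - real s + 1)"
  have u: "0 < u" "u * (4 * real n) = 2 * pi" using n by (auto simp: u_def)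
  have inner: "cis f \<bullet> circle_point n x = cos (u * (2 * real (pos n x)) - f)" for x
  proof -
    have "circle_point n x = cis (u * (2 * real (pos n x)))"
      by (simp add: circle_point_def u_def mult_ac)
    then show ?thesis by (simp add: inner_complex_def cos_diff algebra_simps)
  qed
  have d0: "0 \<le> d" using u st by (simp add: d_def)
  have dpi: "d \<le> pi"
  proof -
    have "d \<le> u * (2 * real n)" unfolding d_def using u(1) st by (intro mult_left_mono) auto
    then show ?thesis using u(2) by simp
  qed
  have inA: "cos d < cis f \<bullet> circle_point n x" if "x \<in> A" for x
  proof -
    have r: "real s \<le> real (pos n x)" "real (pos n x) \<le> real t" using A[OF that] by auto
    have "u * (2 * real (pos n x)) - f = u * (2 * real (pos n x) - real s - real t)"
      by (simp add: f_def algebra_simps)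
    moreover have "\<bar>u * (2 * real (pos n x) - real s - real t)\<bar> < d"
      unfolding abs_mult d_def using u(1) r by (simp add: abs_if)
    ultimately have "cos d < cos \<bar>u * (2 * real (pos n x)) - f\<bar>"
      using dpi by (intro cos_monotone_0_pi) auto
    then show ?thesis unfolding inner by simp
  qed
  have inB: "cis f \<bullet> circle_point n x < cos d" if "x \<in> B" for x
  proof -
    have r: "1 \<le> pos n x" "pos n x \<le> 2 * n" using B[OF that] pos_range[of x n] by auto
    let ?y = "2 * real (pos n x) - real s - real t"
    have y: "real t - real s + 1 < \<bar>?y\<bar>" "\<bar>?y\<bar> < 4 * real n - (real t - real s + 1)"
      using B[OF that] r st by (auto simp: abs_if)
    have "u * (2 * real (pos n x)) - f = u * ?y"
      by (simp add: f_def algebra_simps)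
    moreover have "d < \<bar>u * ?y\<bar>"
      unfolding abs_mult d_def using u(1) y(1) by simp
    moreover have "\<bar>u * ?y\<bar> < 2 * pi - d"
    proof -
      have "u * \<bar>?y\<bar> < u * (4 * real n - (real t - real s + 1))" using u(1) y(2) by simp
      also have "\<dots> = 2 * pi - d" unfolding d_def right_diff_distrib[of u "4 * real n"] u(2) ..
      finally show ?thesis unfolding abs_mult using u(1) by simp
    qed
    ultimately show ?thesis unfolding inner using cos_less_cos_arc d0 by simp
  qed
  have "convex hull (circle_point n ` A) \<subseteq> {z. cis f \<bullet> z > cos d}"
    using inA by (intro hull_minimal convex_halfspace_gt) auto
  moreover have "convex hull (circle_point n ` B) \<subseteq> {z. cis f \<bullet> z < cos d}"
    using inB by (intro hull_minimal convex_halfspace_lt) auto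
  ultimately show ?thesis by fastforce
qed

fun in_pure :: "nat \<Rightarrow> nat \<Rightarrow> vertex \<Rightarrow> bool" where
  "in_pure i j (Unbarred k) \<longleftrightarrow> i < k \<and> k < j"
| "in_pure i j (Barred k) \<longleftrightarrow> False"

fun in_mixed :: "nat \<Rightarrow> nat \<Rightarrow> vertex \<Rightarrow> bool" where
  "in_mixed i b (Unbarred k) \<longleftrightarrow> i \<le> k"
| "in_mixed i b (Barred k) \<longleftrightarrow> k < b"

lemma in_mixed_bar: "in_mixed i b (bar x) \<longleftrightarrow> \<not> in_mixed b i x"
  by (cases x) auto

lemma moved_chord_eq [simp]:
  "moved_chord m (Unbarred i) (Unbarred j) = (2 * i + 1, 2 * j - 1)"
  "moved_chord m (Barred i) (Barred j) = (2 * (m + i) + 1, 2 * (m + j) - 1)"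
  "moved_chord m (Unbarred i) (Barred b) = (2 * i - 1, 2 * (m + b) - 1)"
proof -
  have "pure {Unbarred i, Unbarred j}" "pure {Barred i, Barred j}" "\<not> pure {Unbarred i, Barred b}"
    by (auto simp: pure_def same_type_def)
  then show "moved_chord m (Unbarred i) (Unbarred j) = (2 * i + 1, 2 * j - 1)"
    "moved_chord m (Barred i) (Barred j) = (2 * (m + i) + 1, 2 * (m + j) - 1)"
    "moved_chord m (Unbarred i) (Barred b) = (2 * i - 1, 2 * (m + b) - 1)"
    by (simp_all add: moved_chord_def)
qed

context symmetric_triangulation
begin

text \<open>
  The labels of the endpoints of red chords.  After the endpoints have been moved, the vertices on
  one side of the chord are those satisfying \<^const>\<open>in_pure\<close> (up to \<^const>\<open>bar\<close>) and
  \<^const>\<open>in_mixed\<close>, respectively.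
\<close>

definition cut_pure :: "nat \<Rightarrow> nat \<Rightarrow> bool" where
  "cut_pure i j \<longleftrightarrow> i + 1 < j \<and> p i j \<and> (\<exists>w>j. p i w \<and> p j w)"

definition cut_mixed :: "nat \<Rightarrow> nat \<Rightarrow> bool" where
  "cut_mixed i b \<longleftrightarrow> q i b \<and> \<not> (i = m \<and> b = 1) \<and> \<not> (i = 1 \<and> b = m) \<and>
     ((\<exists>w>i. p i w \<and> q w b) \<or> (\<exists>w>b. q i w \<and> p b w))"

definition together :: "vertex \<Rightarrow> vertex \<Rightarrow> bool" where
  "together x y \<longleftrightarrow>
     (\<forall>i j. cut_pure i j \<longrightarrow> in_pure i j x = in_pure i j y \<and> in_pure i j (bar x) = in_pure i j (bar y)) \<and>
     (\<forall>i b. cut_mixed i b \<longrightarrow> in_mixed i b x = in_mixed i b y)"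

lemma cut_mixed_sym: "cut_mixed i b \<longleftrightarrow> cut_mixed b i"
  unfolding cut_mixed_def using q_sym by blast

lemma together_bar: "together (bar x) (bar y) \<longleftrightarrow> together x y"
  unfolding together_def using cut_mixed_sym by (auto simp: in_mixed_bar)

lemma pure_cases:
  assumes "{u, v} \<in> T" "pos m u < pos m v"
  obtains i j where "u = Unbarred i" "v = Unbarred j" "i + 1 < j" "p i j"
    | i j where "u = Barred i" "v = Barred j" "i + 1 < j" "p i j"
    | i b where "u = Unbarred i" "v = Barred b" "q i b" "\<not> (i = m \<and> b = 1)" "\<not> (i = 1 \<and> b = m)"
proof -
  note found = that
  have V: "u \<in> vertices m" "v \<in> vertices m"
    using chord_edge[OF subset_chords assms(1)] by (auto simp: edge_def)
  then show thesis
  proof (elim vertices_cases)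
    fix i j assume "u = Unbarred i" "v = Unbarred j"
    then show thesis using found(1)[of i j] chord_p[of i j] assms by simp
  next
    fix i j assume eq: "u = Barred i" "v = Barred j"
    then have "{Unbarred i, Unbarred j} \<in> T" using assms(1) bar_in_iff[of "{u, v}"] by simp
    then show thesis using found(2)[of i j] chord_p[of i j] assms eq by simp
  next
    fix i j assume "u = Unbarred i" "v = Barred j"
    then show thesis using found(3)[of i j] chord_q[of i j] assms by simp
  next
    fix i j assume "u = Barred i" "v = Unbarred j" "j \<le> m"
    then show thesis using assms by simp
  qed
qed

lemma moved_red_chords_eq:
  "moved_red_chords m T =
     {(2 * i + 1, 2 * j - 1) | i j. cut_pure i j} \<union>
     {(2 * (m + i) + 1, 2 * (m + j) - 1) | i j. cut_pure i j} \<union>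
     {(2 * i - 1, 2 * (m + b) - 1) | i b. cut_mixed i b}" (is "_ = ?U \<union> ?B \<union> ?M")
proof
  show "moved_red_chords m T \<subseteq> ?U \<union> ?B \<union> ?M"
  proof
    fix c assume "c \<in> moved_red_chords m T"
    then obtain u v where c: "c = moved_chord m u v" "{u, v} \<in> T" "red m T {u, v}" "pos m u < pos m v"
      unfolding moved_red_chords_def by blast
    from c(2,4) show "c \<in> ?U \<union> ?B \<union> ?M"
    proof (cases rule: pure_cases)
      case (1 i j)
      then have "cut_pure i j" using c(3) red_Unbarred[of i j] by (simp add: cut_pure_def)
      moreover have "c = (2 * i + 1, 2 * j - 1)"
        using c(1) 1 by simp
      ultimately show ?thesis by blast
    next
      case (2 i j)
      then have "cut_pure i j" using c(3) red_Barred[of i j] by (simp add: cut_pure_def)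
      moreover have "c = (2 * (m + i) + 1, 2 * (m + j) - 1)"
        using c(1) 2 by simp
      ultimately show ?thesis by blast
    next
      case (3 i b)
      then have "cut_mixed i b" using c(3) red_mixed[of i b] unfolding cut_mixed_def by blast
      moreover have "c = (2 * i - 1, 2 * (m + b) - 1)"
        using c(1) 3 by simp
      ultimately show ?thesis by blast
    qed
  qed
next
  have mem: "moved_chord m u v \<in> moved_red_chords m T"
    if "{u, v} \<in> T" "red m T {u, v}" "pos m u < pos m v" for u v
    unfolding moved_red_chords_def using that by blast
  have U: "(2 * i + 1, 2 * j - 1) \<in> moved_red_chords m T" if "cut_pure i j" for i j
    using that mem[of "Unbarred i" "Unbarred j"] p_chord[of i j] red_Unbarred[of i j]
    by (simp add: cut_pure_def)
  have B: "(2 * (m + i) + 1, 2 * (m + j) - 1) \<in> moved_red_chords m T" if "cut_pure i j" for i j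
  proof -
    have "{Barred i, Barred j} \<in> T"
      using that p_chord[of i j] bar_in_iff[of "{Unbarred i, Unbarred j}"] by (simp add: cut_pure_def)
    then show ?thesis
      using that mem[of "Barred i" "Barred j"] red_Barred[of i j]
      by (simp add: cut_pure_def)
  qed
  have M: "(2 * i - 1, 2 * (m + b) - 1) \<in> moved_red_chords m T" if c: "cut_mixed i b" for i b
  proof -
    have q: "q i b" using c by (simp add: cut_mixed_def)
    have "{Unbarred i, Barred b} \<in> T" "red m T {Unbarred i, Barred b}"
      using c q_chord[OF q] red_mixed[OF q] unfolding cut_mixed_def by blast+
    moreover have "i < m + b" using q_range[OF q] by linarith
    ultimately show ?thesis
      using mem[of "Unbarred i" "Barred b"]
      by simp
  qed
  show "?U \<union> ?B \<union> ?M \<subseteq> moved_red_chords m T" using U B M by blast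
qed

lemma unseparated_together:
  assumes m: "m = n + 1" and x: "x \<in> vertices n" and y: "y \<in> vertices n"
  shows "(\<forall>c\<in>moved_red_chords m T. \<not> moved_separates m c x y) \<longleftrightarrow> together x y"
proof -
  have U: "2 * pos m z \<in> {2 * i + 1<..<2 * j - 1} \<longleftrightarrow> in_pure i j z"
    if "z \<in> vertices n" "cut_pure i j" for z i j
  proof -
    have "1 \<le> i \<and> j \<le> m" using that(2) p_range[of i j] by (auto simp: cut_pure_def)
    then show ?thesis using that(1) m by (cases z) auto
  qed
  have B: "2 * pos m z \<in> {2 * (m + i) + 1<..<2 * (m + j) - 1} \<longleftrightarrow> in_pure i j (bar z)"
    if "z \<in> vertices n" for z i j
    using that m by (cases z) auto
  have M: "2 * pos m z \<in> {2 * i - 1<..<2 * (m + b) - 1} \<longleftrightarrow> in_mixed i b z"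
    if "z \<in> vertices n" "cut_mixed i b" for z i b
  proof -
    have "1 \<le> i \<and> i \<le> m \<and> 1 \<le> b \<and> b \<le> m" using that(2) q_range[of i b] by (auto simp: cut_mixed_def)
    then show ?thesis using that(1) m by (cases z) auto
  qed
  have U': "moved_separates m (2 * i + 1, 2 * j - 1) x y \<longleftrightarrow> in_pure i j x \<noteq> in_pure i j y"
    if "cut_pure i j" for i j
    unfolding moved_separates_def prod.case U[OF x that] U[OF y that] ..
  have B': "moved_separates m (2 * (m + i) + 1, 2 * (m + j) - 1) x y \<longleftrightarrow>
      in_pure i j (bar x) \<noteq> in_pure i j (bar y)" for i j
    unfolding moved_separates_def prod.case B[OF x] B[OF y] ..
  have M': "moved_separates m (2 * i - 1, 2 * (m + b) - 1) x y \<longleftrightarrow> in_mixed i b x \<noteq> in_mixed i b y"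
    if "cut_mixed i b" for i b
    unfolding moved_separates_def prod.case M[OF x that] M[OF y that] ..
  have u: "(\<forall>c\<in>{(2 * i + 1, 2 * j - 1) | i j. cut_pure i j}. \<not> moved_separates m c x y) \<longleftrightarrow>
    (\<forall>i j. cut_pure i j \<longrightarrow> in_pure i j x = in_pure i j y)"
    using U' by fastforce
  have b: "(\<forall>c\<in>{(2 * (m + i) + 1, 2 * (m + j) - 1) | i j. cut_pure i j}. \<not> moved_separates m c x y) \<longleftrightarrow>
    (\<forall>i j. cut_pure i j \<longrightarrow> in_pure i j (bar x) = in_pure i j (bar y))"
    using B' by fastforce
  have mx: "(\<forall>c\<in>{(2 * i - 1, 2 * (m + b) - 1) | i b. cut_mixed i b}. \<not> moved_separates m c x y) \<longleftrightarrow>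
    (\<forall>i b. cut_mixed i b \<longrightarrow> in_mixed i b x = in_mixed i b y)"
    using M' by fastforce
  show ?thesis
    unfolding moved_red_chords_eq together_def ball_Un u b mx by blast
qed

end

definition together_rel :: "nat \<Rightarrow> vertex set set \<Rightarrow> (vertex \<times> vertex) set" where
  "together_rel n T = {(x, y). x \<in> vertices n \<and> y \<in> vertices n \<and> symmetric_triangulation.together (n + 1) T x y}"

context symmetric_triangulation
begin

context
  fixes n :: nat
  assumes m_eq: "m = n + 1"
begin

lemma together_refl: "together x x"
  by (simp add: together_def)

lemma together_sym: "together x y \<Longrightarrow> together y x"
  by (simp add: together_def)

lemma together_trans: "together x y \<Longrightarrow> together y z \<Longrightarrow> together x z"
  by (simp add: together_def)

lemma together_rel_eq: "together_rel n T = {(x, y). x \<in> vertices n \<and> y \<in> vertices n \<and> together x y}"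
  by (simp add: together_rel_def m_eq)

lemma psi_eq: "psi n T = vertices n // together_rel n T"
proof -
  have "{(x, y). x \<in> vertices n \<and> y \<in> vertices n \<and>
     (\<forall>c\<in>moved_red_chords (n + 1) T. \<not> moved_separates (n + 1) c x y)} = together_rel n T"
    unfolding together_rel_eq using unseparated_together[OF m_eq] by (auto simp: m_eq)
  then show ?thesis by (simp add: psi_def)
qed

lemma together_equiv: "equiv (vertices n) (together_rel n T)"
  unfolding together_rel_eq
  by (rule equivI) (auto simp: refl_on_def sym_def trans_def intro: together_refl together_sym together_trans)

lemma psi_block: "A \<in> psi n T \<longleftrightarrow> (\<exists>x\<in>vertices n. A = {y \<in> vertices n. together x y})"
  unfolding psi_eq quotient_def together_rel_eq by auto

lemma psi_bar: "(image bar) ` psi n T = psi n T"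
proof -
  have *: "bar ` A \<in> psi n T" if "A \<in> psi n T" for A
  proof -
    from that obtain x where x: "x \<in> vertices n" "A = {y \<in> vertices n. together x y}"
      unfolding psi_block by blast
    have "bar ` A = {y \<in> vertices n. together (bar x) y}"
    proof (intro equalityI subsetI)
      fix y assume "y \<in> {y \<in> vertices n. together (bar x) y}"
      then have "bar y \<in> A" using x together_bar[of x "bar y"] by simp
      then show "y \<in> bar ` A" by (metis bar_bar imageI)
    qed (use x together_bar in auto)
    then show ?thesis unfolding psi_block using x(1) by (intro bexI[of _ "bar x"]) auto
  qed
  show ?thesis
  proof (intro equalityI subsetI)
    fix A assume "A \<in> psi n T"
    then show "A \<in> (image bar) ` psi n T"
      using *[of A] by (intro image_eqI[of _ _ "bar ` A"]) (simp_all add: image_image)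
  qed (use * in auto)
qed

lemma hulls_disjoint:
  assumes n: "1 \<le> n" and AB: "A \<subseteq> vertices n" "B \<subseteq> vertices n" "A \<noteq> {}"
    and st: "1 \<le> s" "t \<le> 2 * n" and arc: "\<And>x. x \<in> vertices n \<Longrightarrow> P x \<longleftrightarrow> s \<le> pos n x \<and> pos n x \<le> t"
    and A: "\<And>x. x \<in> A \<Longrightarrow> P x" and B: "\<And>x. x \<in> B \<Longrightarrow> \<not> P x"
  shows "convex hull (circle_point n ` A) \<inter> convex hull (circle_point n ` B) = {}"
proof (rule convex_hulls_separated_by_arc[OF n st(1) _ st(2)])
  show "s \<le> pos n x \<and> pos n x \<le> t" if "x \<in> A" for x using that A AB arc by blast
  show "x \<in> vertices n \<and> \<not> (s \<le> pos n x \<and> pos n x \<le> t)" if "x \<in> B" for x using that B AB arc by blast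
  show "s \<le> t" using AB A arc by (meson all_not_in_conv order_trans subsetD)
qed

lemma hulls_disjoint_sym:
  assumes n: "1 \<le> n" and AB: "A \<subseteq> vertices n" "B \<subseteq> vertices n" "A \<noteq> {}" "B \<noteq> {}"
    and st: "1 \<le> s" "t \<le> 2 * n" and arc: "\<And>x. x \<in> vertices n \<Longrightarrow> P x \<longleftrightarrow> s \<le> pos n x \<and> pos n x \<le> t"
    and A: "\<And>z. z \<in> A \<Longrightarrow> P z = P x" and B: "\<And>z. z \<in> B \<Longrightarrow> P z = P y" and xy: "P x \<noteq> P y"
  shows "convex hull (circle_point n ` A) \<inter> convex hull (circle_point n ` B) = {}"
proof (cases "P x")
  case True
  then show ?thesis
    using hulls_disjoint[OF n AB(1,2,3) st arc] A B xy by blast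
next
  case False
  then show ?thesis
    using hulls_disjoint[OF n AB(2,1,4) st arc] A B xy by blast
qed

lemma psi_NC_B:
  assumes n: "1 \<le> n"
  shows "psi n T \<in> NC_B n"
proof -
  have "partition_on (vertices n) (psi n T)"
    unfolding psi_eq by (rule partition_on_quotient[OF together_equiv])
  moreover have "convex hull (circle_point n ` A) \<inter> convex hull (circle_point n ` B) = {}"
    if AB: "A \<in> psi n T" "B \<in> psi n T" "A \<noteq> B" for A B
  proof -
    obtain x y where x: "x \<in> vertices n" "A = {z \<in> vertices n. together x z}"
      and y: "y \<in> vertices n" "B = {z \<in> vertices n. together y z}"
      using AB unfolding psi_block by blast
    have ne: "A \<noteq> {}" "B \<noteq> {}" using x y together_refl by auto
    have sub: "A \<subseteq> vertices n" "B \<subseteq> vertices n" using x y by auto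
    have "\<not> together x y"
      using AB(3) x y together_sym together_trans by blast
    then consider i j where "cut_pure i j" "in_pure i j x \<noteq> in_pure i j y"
      | i j where "cut_pure i j" "in_pure i j (bar x) \<noteq> in_pure i j (bar y)"
      | i b where "cut_mixed i b" "in_mixed i b x \<noteq> in_mixed i b y"
      unfolding together_def by blast
    then show ?thesis
    proof cases
      case (1 i j)
      have r: "1 \<le> i" "j \<le> m" "i + 1 < j" using 1(1) p_range[of i j] by (auto simp: cut_pure_def)
      show ?thesis
      proof (rule hulls_disjoint_sym[OF n sub ne, of "i + 1" "j - 1" "in_pure i j"])
        show "j - 1 \<le> 2 * n" using r m_eq by auto
        show "in_pure i j z = (i + 1 \<le> pos n z \<and> pos n z \<le> j - 1)" if "z \<in> vertices n" for z
          using that r m_eq by (cases z) auto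
        show "in_pure i j z = in_pure i j x" if "z \<in> A" for z using that 1(1) x by (auto simp: together_def)
        show "in_pure i j z = in_pure i j y" if "z \<in> B" for z using that 1(1) y by (auto simp: together_def)
      qed (use 1 in auto)
    next
      case (2 i j)
      have r: "1 \<le> i" "j \<le> m" "i + 1 < j" using 2(1) p_range[of i j] by (auto simp: cut_pure_def)
      show ?thesis
      proof (rule hulls_disjoint_sym[OF n sub ne, of "n + i + 1" "n + j - 1" "\<lambda>z. in_pure i j (bar z)"])
        show "n + j - 1 \<le> 2 * n" using r m_eq by auto
        show "in_pure i j (bar z) = (n + i + 1 \<le> pos n z \<and> pos n z \<le> n + j - 1)" if "z \<in> vertices n" for z
          using that r m_eq by (cases z) auto
        show "in_pure i j (bar z) = in_pure i j (bar x)" if "z \<in> A" for z using that 2(1) x by (auto simp: together_def)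
        show "in_pure i j (bar z) = in_pure i j (bar y)" if "z \<in> B" for z using that 2(1) y by (auto simp: together_def)
      qed (use 2 in auto)
    next
      case (3 i b)
      have r: "1 \<le> i" "i \<le> m" "1 \<le> b" "b \<le> m" using 3(1) q_range[of i b] by (auto simp: cut_mixed_def)
      show ?thesis
      proof (rule hulls_disjoint_sym[OF n sub ne, of i "n + b - 1" "in_mixed i b"])
        show "n + b - 1 \<le> 2 * n" using r m_eq by auto
        show "in_mixed i b z = (i \<le> pos n z \<and> pos n z \<le> n + b - 1)" if "z \<in> vertices n" for z
          using that r m_eq by (cases z) auto
        show "in_mixed i b z = in_mixed i b x" if "z \<in> A" for z using that 3(1) x by (auto simp: together_def)
        show "in_mixed i b z = in_mixed i b y" if "z \<in> B" for z using that 3(1) y by (auto simp: together_def)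
      qed (use 3 r in auto)
    qed
  qed
  ultimately show ?thesis using psi_bar unfolding NC_B_def by blast
qed

lemma zero_block_together:
  assumes "1 \<le> l" "l \<le> n"
  shows "{Unbarred l, Barred l} \<in> psi n T \<longleftrightarrow>
    together (Unbarred l) (Barred l) \<and> (\<forall>y\<in>vertices n. together (Unbarred l) y \<longrightarrow> y \<in> {Unbarred l, Barred l})"
    (is "?Z \<in> _ \<longleftrightarrow> ?R")
proof
  assume "?Z \<in> psi n T"
  then obtain x where x: "x \<in> vertices n" "?Z = {y \<in> vertices n. together x y}"
    unfolding psi_block by blast
  then have xl: "together x (Unbarred l)" "together x (Barred l)" by auto
  have "together x y" if "together (Unbarred l) y" for y using xl that together_trans by blast
  then show ?R using x(2) xl together_trans together_sym by blast
next
  assume ?R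
  then have "?Z = {y \<in> vertices n. together (Unbarred l) y}"
    using assms together_refl by auto
  then show "?Z \<in> psi n T" unfolding psi_block using assms by (intro bexI[of _ "Unbarred l"]) auto
qed

lemma zero_block_if:
  assumes l: "1 \<le> l" "l \<le> n" and q1: "q (l + 1) (l + 1)" and q2: "q l (l + 1)"
  shows "{Unbarred l, Barred l} \<in> psi n T"
proof -
  have q3: "q (l + 1) l" using q2 q_sym by simp
  have p1: "p l (l + 1)" using p_Suc l m_eq by simp
  have pure: "\<not> in_pure i j (Unbarred l)" if "cut_pure i j" for i j
    using that pq[OF _ q2, of i j] by (auto simp: cut_pure_def)
  have low: "\<not> (i \<le> l \<and> b \<le> l)" if "q i b" for i b
    using qq[OF that q1] by auto
  have high: "i = l + 1 \<and> b = l + 1" if "q i b" "l < i" "l < b" for i b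
  proof -
    have "b = l + 1" using qq[OF q2 that(1)] that by fastforce
    moreover have "q b i" using that(1) q_sym by simp
    then have "i = l + 1" using qq[OF q2, of b i] that by fastforce
    ultimately show ?thesis by simp
  qed
  have nc: "\<not> cut_mixed (l + 1) (l + 1)"
  proof
    assume "cut_mixed (l + 1) (l + 1)"
    then obtain w where "l + 1 < w" "q w (l + 1)" using q_sym unfolding cut_mixed_def by blast
    then show False using qq[OF q3, of w "l + 1"] by simp
  qed
  have mixed: "i \<le> l \<longleftrightarrow> l < b" if "cut_mixed i b" for i b
  proof -
    have "q i b" using that by (simp add: cut_mixed_def)
    moreover have "\<not> (i = l + 1 \<and> b = l + 1)" using that nc by blast
    ultimately have "\<not> (i \<le> l \<and> b \<le> l)" "\<not> (l < i \<and> l < b)" using low high by blast+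
    then show ?thesis by linarith
  qed
  have "together (Unbarred l) (Barred l)"
    unfolding together_def using pure mixed by auto
  moreover have "y \<in> {Unbarred l, Barred l}" if y: "y \<in> vertices n" "together (Unbarred l) y" for y
  proof (rule ccontr)
    assume ny: "y \<notin> {Unbarred l, Barred l}"
    have n2: "2 \<le> n"
      using y(1) l ny by (cases y) auto
    have c1: "cut_mixed l (l + 1)"
      unfolding cut_mixed_def using q1 q2 p1 l n2 m_eq by auto
    then have c2: "cut_mixed (l + 1) l" using cut_mixed_sym by simp
    have tm: "in_mixed i b (Unbarred l) = in_mixed i b y" if "cut_mixed i b" for i b
      using y(2) that unfolding together_def by blast
    have "in_mixed l (l + 1) y" "\<not> in_mixed (l + 1) l y"
      using tm[OF c1] tm[OF c2] by simp_all
    then show False using ny by (cases y) auto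
  qed
  ultimately show ?thesis using zero_block_together[OF l] by blast
qed

lemma zero_block_only_if:
  assumes i: "1 \<le> i" "i \<le> n" and Z: "{Unbarred i, Barred i} \<in> psi n T"
  shows "q (i + 1) (i + 1) \<and> q i (i + 1)"
proof -
  have tog: "together (Unbarred i) (Barred i)"
    and only: "\<And>y. y \<in> vertices n \<Longrightarrow> together (Unbarred i) y \<Longrightarrow> y \<in> {Unbarred i, Barred i}"
    using Z zero_block_together[OF i] by auto
  have mixed: "k \<le> i \<longleftrightarrow> i < b" if "cut_mixed k b" for k b
    using tog that by (auto simp: together_def)
  obtain k where k: "q k k" using diameter by blast
  have "1 \<le> k" "k \<le> m" using q_range[OF k] by auto
  have not_corner: "\<not> (k = m \<and> k = 1)" using m2 by simp
  have "\<not> cut_mixed k k" using mixed[of k k] by auto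
  then have not_red: "\<not> (\<exists>w>k. p k w \<and> q w k)"
    using k not_corner unfolding cut_mixed_def by blast
  obtain l where l: "l < k" "q k l" "p l k"
    using k not_corner by (rule mixed_apex) (use not_red in blast)+
  have l': "q l k" using l q_sym by simp
  have l1: "1 \<le> l" using q_range[OF l'] by simp
  have "l \<le> i"
  proof (rule ccontr)
    assume "\<not> l \<le> i"
    then have "cut_mixed k l" unfolding cut_mixed_def using l k i by auto
    then show False using mixed[of k l] \<open>\<not> l \<le> i\<close> l by simp
  qed
  have "i < k"
  proof (rule ccontr)
    assume "\<not> i < k"
    then have "cut_mixed l k" unfolding cut_mixed_def using l l' k i m_eq by auto
    then show False using mixed[of l k] \<open>\<not> i < k\<close> \<open>l \<le> i\<close> by simp
  qed
  have inside: "together (Unbarred l) (Unbarred c)"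
    if c: "l < c" "c < k" and "\<And>a b. cut_pure a b \<Longrightarrow> \<not> in_pure a b (Unbarred c)" for c
  proof -
    have "\<not> in_pure a b (Unbarred l)" if "cut_pure a b" for a b
      using that pq[OF _ l', of a b] by (auto simp: cut_pure_def)
    moreover have "a \<le> l \<longleftrightarrow> a \<le> c" if "cut_mixed a b" for a b
    proof -
      have "q a b" using that by (simp add: cut_mixed_def)
      then have "\<not> (l < a \<and> a < k)" using pq[OF l(3)] by blast
      then show ?thesis using c by linarith
    qed
    ultimately show ?thesis unfolding together_def using that(3) by auto
  qed
  have "i = l"
  proof (rule ccontr)
    assume "i \<noteq> l"
    then have "l < i" using \<open>l \<le> i\<close> by simp
    have "\<not> in_pure a b (Unbarred i)" if "cut_pure a b" for a b
      using tog that unfolding together_def by auto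
    then have "together (Unbarred i) (Unbarred l)"
      using inside[OF \<open>l < i\<close> \<open>i < k\<close>] together_sym by blast
    then show False using only[of "Unbarred l"] \<open>i \<noteq> l\<close> \<open>l < i\<close> l1 i by auto
  qed
  have "k = l + 1"
  proof (rule ccontr)
    assume "k \<noteq> l + 1"
    then have "l + 1 < k" using l by simp
    obtain c where c: "l < c" "c < k" "p l c" "p c k" by (rule inner_apex[OF l(3) \<open>l + 1 < k\<close>])
    have "\<not> in_pure a b (Unbarred c)" if ab: "cut_pure a b" for a b
    proof
      assume "in_pure a b (Unbarred c)"
      then have acb: "a < c" "c < b" by auto
      obtain w where w: "p a b" "b < w" "p a w" using ab by (auto simp: cut_pure_def)
      have "\<not> l < a" using pp[OF c(3) w(1)] acb by blast
      moreover have "\<not> a < l" using pq[OF w(1) l'] acb(2) c(1) by (meson less_trans)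
      ultimately have "a = l" by simp
      have "\<not> b < k" using pp[OF w(1) c(4)] acb by blast
      then have "k < w" using w by simp
      then show False using pq[OF w(3) k] \<open>a = l\<close> l by simp
    qed
    then have "together (Unbarred i) (Unbarred c)" using inside[OF c(1,2)] \<open>i = l\<close> by simp
    then show False using only[of "Unbarred c"] c \<open>i = l\<close> \<open>k \<le> m\<close> m_eq by auto
  qed
  with k l' \<open>i = l\<close> show ?thesis by simp
qed

end

end

section \<open>Triangulations without small zero blocks\<close>

text \<open>Expresses by inversions that \<open>l\<close> and its barred copy form a block.\<close>

definition small_zero_block :: "nat \<Rightarrow> (vertex \<times> vertex) set \<Rightarrow> bool" where
  "small_zero_block l J \<longleftrightarrow> (Unbarred l, Barred l) \<notin> J \<and> (Unbarred l, Barred (l + 1)) \<in> J \<and>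
     (\<forall>k<l. 1 \<le> k \<longrightarrow> (Unbarred l, Unbarred k) \<in> J) \<and> (\<forall>k\<le>l. 1 \<le> k \<longrightarrow> (Unbarred (l + 1), Unbarred k) \<in> J)"

context symmetric_triangulation
begin

lemma small_zero_block_iff:
  assumes "1 \<le> l" "l < m"
  shows "small_zero_block l inversions \<longleftrightarrow> q (l + 1) (l + 1) \<and> q l (l + 1)"
proof -
  interpret I: inversion_set m inversions by (rule inversion_set_inversions)
  have q1: "q (l + 1) (l + 1) \<longleftrightarrow> (Unbarred (l + 1), Barred (l + 1)) \<in> inversions \<and>
      (\<forall>k<l + 1. \<forall>c<l + 1. (Unbarred k, Barred c) \<notin> inversions) \<and>
      (\<forall>k<l + 1. 1 \<le> k \<longrightarrow> (Unbarred (l + 1), Unbarred k) \<in> inversions)"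
    using q_iff_inversions[of "l + 1" "l + 1"] assms by auto
  have q2: "q l (l + 1) \<longleftrightarrow> (Unbarred l, Barred (l + 1)) \<in> inversions \<and>
      (\<forall>k<l. \<forall>c<l + 1. (Unbarred k, Barred c) \<notin> inversions) \<and>
      (\<forall>k<l. 1 \<le> k \<longrightarrow> (Unbarred l, Unbarred k) \<in> inversions) \<and>
      (\<forall>c<l + 1. 1 \<le> c \<longrightarrow> (Unbarred (l + 1), Unbarred c) \<in> inversions)"
    using q_iff_inversions[of l "l + 1"] assms by auto
  have up: "(Unbarred (l + 1), Barred (l + 1)) \<in> inversions" if "(Unbarred l, Barred (l + 1)) \<in> inversions"
    using I.mixed_up[OF that, of "l + 1"] assms by simp
  have down: "(Unbarred k, Barred c) \<notin> inversions" if "(Unbarred l, Barred l) \<notin> inversions" "k \<le> l" "c \<le> l" for k c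
    using I.mixed_up2[of k c l l] that assms by auto
  show ?thesis
    unfolding q1 q2 small_zero_block_def using up down by (auto simp: less_Suc_eq_le)
qed

end

lemma triangulations_S_iff:
  assumes n: "1 \<le> n" and S: "S \<subseteq> {1..n}"
  shows "T \<in> triangulations_S n S \<longleftrightarrow> symmetric_triangulation (n + 1) T \<and>
    (\<forall>l\<in>S. \<not> small_zero_block l (symmetric_triangulation.inversions (n + 1) T))"
proof (cases "symmetric_triangulation (n + 1) T")
  case True
  interpret symmetric_triangulation "n + 1" T by fact
  have "{Unbarred l, Barred l} \<in> psi n T \<longleftrightarrow> small_zero_block l inversions" if "l \<in> S" for l
  proof -
    have l: "1 \<le> l" "l \<le> n" using that S by auto
    then show ?thesis
      using zero_block_if[OF refl l] zero_block_only_if[OF refl l] small_zero_block_iff[of l] by auto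
  qed
  then show ?thesis
    using True psi_NC_B[OF refl n] triangulations_B_iff[OF n, of T]
    by (auto simp: triangulations_S_def NC_S_def)
next
  case False
  then show ?thesis using triangulations_B_iff[OF n, of T] by (auto simp: triangulations_S_def)
qed

definition mixed_from :: "nat \<Rightarrow> nat \<Rightarrow> (vertex \<times> vertex) set" where
  "mixed_from m l = {(Unbarred x, Barred y) | x y. l \<le> x \<and> x \<le> m \<and> l \<le> y \<and> y \<le> m}"

lemma mixed_from_iff [simp]:
  "(Unbarred x, Unbarred y) \<notin> mixed_from m l"
  "(Unbarred x, Barred y) \<in> mixed_from m l \<longleftrightarrow> l \<le> x \<and> x \<le> m \<and> l \<le> y \<and> y \<le> m"
  by (auto simp: mixed_from_def)

lemma inversion_set_Un_mixed_from:
  assumes J: "inversion_set m J" and z: "small_zero_block l J" and l: "1 \<le> l" "l \<le> m"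
  shows "inversion_set m (J \<union> mixed_from m l)"
proof -
  interpret J: inversion_set m J by fact
  show ?thesis
  proof
    show "2 \<le> m" by (rule J.m2)
    show "(\<exists>j k. x = (Unbarred j, Unbarred k) \<and> 1 \<le> k \<and> k < j \<and> j \<le> m) \<or>
      (\<exists>j c. x = (Unbarred j, Barred c) \<and> 1 \<le> j \<and> j \<le> m \<and> 1 \<le> c \<and> c \<le> m)"
      if x: "x \<in> J \<union> mixed_from m l" for x
    proof (cases "x \<in> J")
      case True then show ?thesis by (rule J.pairs)
    next
      case False
      then obtain j c where "x = (Unbarred j, Barred c)" "l \<le> j" "j \<le> m" "l \<le> c" "c \<le> m"
        using x unfolding mixed_from_def by blast
      then show ?thesis using l(1) by auto
    qed
    show "(Unbarred m, Unbarred k) \<in> J \<union> mixed_from m l" if "1 \<le> k" "k < m" for k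
      using J.outer_pure[OF that] by simp
    show "(Unbarred m, Barred 1) \<in> J \<union> mixed_from m l"
      using J.outer_mixed by simp
    show "(Unbarred i, Unbarred k) \<in> J \<union> mixed_from m l"
      if "(Unbarred j, Unbarred k) \<in> J \<union> mixed_from m l" "j \<le> i" "i \<le> m" for j k i
      using that J.pure_up[of j k i] by simp
    show "(Unbarred i, Barred c) \<in> J \<union> mixed_from m l"
      if "(Unbarred j, Barred c) \<in> J \<union> mixed_from m l" "j \<le> i" "i \<le> m" for j c i
      using that J.mixed_up[of j c i] by auto
    show "(Unbarred c, Barred j) \<in> J \<union> mixed_from m l"
      if "(Unbarred j, Barred c) \<in> J \<union> mixed_from m l" for j c
      using that J.mixed_sym[of j c] by auto
    show "(Unbarred j, Unbarred k) \<in> J \<union> mixed_from m l \<or> (Unbarred k, Unbarred h) \<in> J \<union> mixed_from m l"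
      if "(Unbarred j, Unbarred h) \<in> J \<union> mixed_from m l" "h < k" "k < j" for j h k
      using that J.pure_split[of j h k] by simp
    show "(Unbarred j, Unbarred k) \<in> J \<union> mixed_from m l \<or> (Unbarred k, Barred c) \<in> J \<union> mixed_from m l"
      if jc: "(Unbarred j, Barred c) \<in> J \<union> mixed_from m l" "1 \<le> k" "k < j" for j c k
    proof (cases "(Unbarred j, Barred c) \<in> J")
      case True then show ?thesis using J.mixed_split[of j c k] jc by blast
    next
      case False
      then have r: "l \<le> j" "j \<le> m" "l \<le> c" "c \<le> m" using jc(1) by auto
      show ?thesis
      proof (cases "l \<le> k")
        case True then show ?thesis using r jc(3) by auto
      next
        case False
        then have "(Unbarred l, Unbarred k) \<in> J" using z jc(2) unfolding small_zero_block_def by auto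
        then show ?thesis using J.pure_up r by blast
      qed
    qed
  qed
qed

lemma no_small_zero_block_Un_mixed_from:
  assumes J: "inversion_set m J" and z: "small_zero_block l J" and l: "l \<le> m"
  shows "\<not> small_zero_block h (J \<union> mixed_from m l)"
proof
  interpret J: inversion_set m J by fact
  assume h: "small_zero_block h (J \<union> mixed_from m l)"
  then have in1: "(Unbarred h, Barred (h + 1)) \<in> J \<union> mixed_from m l"
    and notin: "(Unbarred h, Barred h) \<notin> J \<union> mixed_from m l"
    by (auto simp: small_zero_block_def)
  have "h \<le> m" using in1 J.mixed_range[of h "h + 1"] by auto
  then have "h < l" using notin by auto
  then have "(Unbarred h, Barred (h + 1)) \<in> J" using in1 by auto
  then have "(Unbarred l, Barred l) \<in> J" using J.mixed_up2 \<open>h < l\<close> l by fastforce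
  then show False using z by (simp add: small_zero_block_def)
qed

lemma small_zero_block_mono:
  assumes "small_zero_block l J" "J \<subseteq> K" "\<not> small_zero_block l K"
  shows "(Unbarred l, Barred l) \<in> K"
  using assms unfolding small_zero_block_def by blast

lemma inversion_set_mixed_from_subset:
  assumes "inversion_set m K" "(Unbarred l, Barred l) \<in> K"
  shows "mixed_from m l \<subseteq> K"
proof -
  interpret inversion_set m K by fact
  show ?thesis using mixed_up2[OF assms(2)] by (auto simp: mixed_from_def)
qed

definition admissible :: "nat \<Rightarrow> nat set \<Rightarrow> (vertex \<times> vertex) set \<Rightarrow> bool" where
  "admissible m S J \<longleftrightarrow> inversion_set m J \<and> (\<forall>l\<in>S. \<not> small_zero_block l J)"

lemma admissible_closure:
  assumes J: "inversion_set m J" and S: "S \<subseteq> {1..m}"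
  obtains K where "admissible m S K" "J \<subseteq> K" "\<And>L. admissible m S L \<Longrightarrow> J \<subseteq> L \<Longrightarrow> K \<subseteq> L"
proof (cases "\<exists>l\<in>S. small_zero_block l J")
  case False
  then show thesis using that[of J] J by (auto simp: admissible_def)
next
  case True
  then obtain l where l: "l \<in> S" "small_zero_block l J" by blast
  then have r: "1 \<le> l" "l \<le> m" using S by auto
  show thesis
  proof (rule that[of "J \<union> mixed_from m l"])
    show "admissible m S (J \<union> mixed_from m l)"
      using inversion_set_Un_mixed_from[OF J l(2) r] no_small_zero_block_Un_mixed_from[OF J l(2) r(2)]
      by (simp add: admissible_def)
    show "J \<union> mixed_from m l \<subseteq> L" if "admissible m S L" "J \<subseteq> L" for L
      using that l small_zero_block_mono[OF l(2)] inversion_set_mixed_from_subset[of m L l]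
      unfolding admissible_def by blast
  qed simp
qed

lemma admissible_sup:
  assumes J: "admissible m S J" and K: "admissible m S K" and S: "S \<subseteq> {1..m}"
  obtains U where "admissible m S U" "J \<subseteq> U" "K \<subseteq> U"
    "\<And>L. admissible m S L \<Longrightarrow> J \<subseteq> L \<Longrightarrow> K \<subseteq> L \<Longrightarrow> U \<subseteq> L"
proof -
  have "inversion_set m (J \<union> K)"
    using J K by (intro inversion_set_Un) (simp_all add: admissible_def)
  then obtain U where "admissible m S U" "J \<union> K \<subseteq> U" "\<And>L. admissible m S L \<Longrightarrow> J \<union> K \<subseteq> L \<Longrightarrow> U \<subseteq> L"
    using admissible_closure[OF _ S] by metis
  then show thesis using that[of U] by simp
qed

lemma admissible_inf:
  assumes J: "admissible m S J" and K: "admissible m S K" and S: "S \<subseteq> {1..m}"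
    and ex: "inversion_set m B" "\<And>L. inversion_set m L \<Longrightarrow> B \<subseteq> L"
  obtains U where "admissible m S U" "U \<subseteq> J" "U \<subseteq> K"
    "\<And>L. admissible m S L \<Longrightarrow> L \<subseteq> J \<Longrightarrow> L \<subseteq> K \<Longrightarrow> L \<subseteq> U"
proof -
  have JK: "inversion_set m J" "inversion_set m K" using J K by (auto simp: admissible_def)
  define F where "F = {L. inversion_set m L \<and> L \<subseteq> J \<inter> K}"
  have "F \<subseteq> Pow J" by (auto simp: F_def)
  then have "finite F" using inversion_set.finite[OF JK(1)] by (rule finite_subset[OF _ finite_Pow_iff[THEN iffD2]])
  moreover have "B \<in> F" using ex JK by (auto simp: F_def)
  moreover have "L \<union> L' \<in> F" if "L \<in> F" "L' \<in> F" for L L'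
    using that inversion_set_Un by (auto simp: F_def)
  ultimately have "\<exists>U\<in>F. \<forall>L\<in>F. L \<subseteq> U"
  proof -
    assume *: "finite F" "B \<in> F" "\<And>L L'. L \<in> F \<Longrightarrow> L' \<in> F \<Longrightarrow> L \<union> L' \<in> F"
    obtain U where U: "U \<in> F" "\<And>L. L \<in> F \<Longrightarrow> U \<subseteq> L \<Longrightarrow> U = L"
      using finite_has_maximal[of F] * by blast
    have "L \<subseteq> U" if "L \<in> F" for L using U(2)[OF *(3)[OF U(1) that]] by blast
    then show ?thesis using U(1) by blast
  qed
  then obtain U where "U \<in> F" and max: "\<And>L. L \<in> F \<Longrightarrow> L \<subseteq> U" by blast
  then have U: "inversion_set m U" "U \<subseteq> J" "U \<subseteq> K" by (auto simp: F_def)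
  have U_max: "L \<subseteq> U" if "inversion_set m L" "L \<subseteq> J" "L \<subseteq> K" for L
    using max[of L] that by (simp add: F_def)
  obtain C where C: "admissible m S C" "U \<subseteq> C" "\<And>L. admissible m S L \<Longrightarrow> U \<subseteq> L \<Longrightarrow> C \<subseteq> L"
    using admissible_closure[OF U(1) S] by metis
  have "C \<subseteq> J" "C \<subseteq> K" using C(3) J K U by auto
  moreover from this have "C \<subseteq> U" using U_max C(1) by (simp add: admissible_def)
  moreover have "L \<subseteq> C" if "admissible m S L" "L \<subseteq> J" "L \<subseteq> K" for L
    using U_max[of L] that C(2) by (auto simp: admissible_def)
  ultimately show thesis using that[of C] C(1) by blast
qed

theorem mainTheorem6:
  fixes n :: nat and S :: "nat set"
  assumes "n \<ge> 1" and "S \<subseteq> {1..n}"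
  shows "Lattice.lattice \<lparr>carrier = triangulations_S n S, eq = (=), le = tamari_le n\<rparr>"
proof -
  let ?m = "n + 1"
  let ?inversions = "symmetric_triangulation.inversions ?m"
  have S: "S \<subseteq> {1..?m}" using assms(2) by auto
  have in_S: "T \<in> triangulations_S n S \<longleftrightarrow> symmetric_triangulation ?m T \<and> admissible ?m S (?inversions T)" for T
    using triangulations_S_iff[OF assms, of T] symmetric_triangulation.inversion_set_inversions[of ?m T]
    unfolding admissible_def by blast
  have le: "tamari_le n T V \<longleftrightarrow> ?inversions T \<subseteq> ?inversions V"
    if "T \<in> triangulations_S n S" "V \<in> triangulations_S n S" for T V
    using tamari_le_iff[OF assms(1) refl, of T V] that in_S by blast
  have inj: "T = V" if "T \<in> triangulations_S n S" "V \<in> triangulations_S n S" "?inversions T = ?inversions V" for T V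
    using inversions_inj[of ?m T V] that in_S by blast
  have bot: "symmetric_triangulation ?m (bottom_triangulation ?m)"
    using assms(1) by (intro bottom_symmetric_triangulation) simp
  have surj: "\<exists>T\<in>triangulations_S n S. ?inversions T = J" if "admissible ?m S J" for J
    using realize_above[OF assms(1) refl _ bot bottom_inversions, of J] that in_S
    unfolding admissible_def by blast
  have Upper: "U \<in> Upper \<lparr>carrier = triangulations_S n S, eq = (=), le = tamari_le n\<rparr> {T, V} \<longleftrightarrow>
      U \<in> triangulations_S n S \<and> ?inversions T \<subseteq> ?inversions U \<and> ?inversions V \<subseteq> ?inversions U"
    and Lower: "U \<in> Lower \<lparr>carrier = triangulations_S n S, eq = (=), le = tamari_le n\<rparr> {T, V} \<longleftrightarrow>
      U \<in> triangulations_S n S \<and> ?inversions U \<subseteq> ?inversions T \<and> ?inversions U \<subseteq> ?inversions V"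
    if "T \<in> triangulations_S n S" "V \<in> triangulations_S n S" for T U V
    using that le unfolding Upper_def Lower_def by auto
  show ?thesis
  proof (unfold_locales, simp_all)
    fix T V
    assume TV: "T \<in> triangulations_S n S" "V \<in> triangulations_S n S"
    show "T = V" if "tamari_le n T V" "tamari_le n V T" using that TV le inj by blast
    have adm: "admissible ?m S (?inversions T)" "admissible ?m S (?inversions V)" using TV in_S by auto
    obtain J where J: "admissible ?m S J" "?inversions T \<subseteq> J" "?inversions V \<subseteq> J"
      "\<And>L. admissible ?m S L \<Longrightarrow> ?inversions T \<subseteq> L \<Longrightarrow> ?inversions V \<subseteq> L \<Longrightarrow> J \<subseteq> L"
      using admissible_sup[OF adm S] by metis
    obtain U where U: "U \<in> triangulations_S n S" "?inversions U = J" using surj[OF J(1)] by blast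
    show "\<exists>s. least \<lparr>carrier = triangulations_S n S, eq = (=), le = tamari_le n\<rparr> s
        (Upper \<lparr>carrier = triangulations_S n S, eq = (=), le = tamari_le n\<rparr> {T, V})"
      unfolding least_def using U J le in_S Upper[OF TV]
      by (intro exI[of _ U]) auto
    obtain K where K: "admissible ?m S K" "K \<subseteq> ?inversions T" "K \<subseteq> ?inversions V"
      "\<And>L. admissible ?m S L \<Longrightarrow> L \<subseteq> ?inversions T \<Longrightarrow> L \<subseteq> ?inversions V \<Longrightarrow> L \<subseteq> K"
      using admissible_inf[OF adm S symmetric_triangulation.inversion_set_inversions[OF bot] bottom_inversions] by blast
    obtain W where W: "W \<in> triangulations_S n S" "?inversions W = K" using surj[OF K(1)] by blast
    show "\<exists>s. greatest \<lparr>carrier = triangulations_S n S, eq = (=), le = tamari_le n\<rparr> s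
        (Lower \<lparr>carrier = triangulations_S n S, eq = (=), le = tamari_le n\<rparr> {T, V})"
      unfolding greatest_def using W K le in_S Lower[OF TV]
      by (intro exI[of _ W]) auto
  next
    fix T V W
    assume "T \<in> triangulations_S n S" "V \<in> triangulations_S n S" "W \<in> triangulations_S n S"
      "tamari_le n T V" "tamari_le n V W"
    then show "tamari_le n T W" using le by blast
  next
    fix T
    assume "T \<in> triangulations_S n S"
    then show "tamari_le n T T" using le by blast
  qed
qed

end
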